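(* Let $n\in(5/2,+\infty)$ and $u_0\in\mathscr{A}$. Let $u:(-\mathscr{T},T)\to\mathscr{A}$ be the maximal $\mathscr{A}$-solution of the Euler Cauchy problem with datum $u_0$, let $(u_j)_{j\ge 0}$ be the coefficients given by the recursion $u_j=\frac1j\sum_{\ell=0}^{j-1}\mathscr{P}(u_\ell,u_{j-\ell-1})$ $(j\ge1)$, and let $\nu_{nj}:=\sum_{\ell=0}^{j}\langle u_\ell|u_{j-\ell}\rangle_n\in\mathbb{R}$. Let $\tau_n$ be the convergence radius of $\sum_{j\ge0}u_jt^j$ in $H^n$ and $\theta_n$ the convergence radius of the real power series $\sum_{j\ge0}\nu_{nj}t^j$. Then $$\tau_n\le\theta_n\le\min(\mathscr{T},T)\qquad\text{and}\qquad \|u(t)\|_n^2=\sum_{j=0}^{+\infty}\nu_{nj}t^j\quad\text{for all } t\in(-\theta_n,\theta_n).$$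
   Context: Torus: $\mathbb{T}^3:=(\mathbb{R}/2\pi\mathbb{Z})^3$. $D'$ is the space of $\mathbb{R}^3$-valued distributions on $\mathbb{T}^3$; $v\in D'$ has Fourier coefficients $v_k\in\mathbb{C}^3$ ($k\in\mathbb{Z}^3$), $v=\sum_k v_ke^{ik\cdot x}$, $v_{-k}=\overline{v_k}$. For $a,b\in\mathbb{C}^3$, $a\cdot b=\sum_s a_sb_s$. For real $n\ge0$, $H^n:=\{v\in D' : \sum_k|k|^{2n}|v_k|^2<\infty,\ v_0=0,\ k\cdot v_k=0\ \forall k\}$, a Hilbert space with $\langle v|w\rangle_n=\sum_k|k|^{2n}\overline{v_k}\cdot w_k$ and norm $\|v\|_n$. $\mathscr{A}$ is the space of real-analytic, zero mean, divergence free vector fields $\mathbb{T}^3\to\mathbb{R}^3$. It is the union over $\rho>1$ of $\mathscr{A}_\rho:=\{v\in D':\liminf_{k\to\infty}|v_k|^{-1/(|k_1|+|k_2|+|k_3|)}>\rho,\ v_0=0,\ k\cdot v_k=0\}$ (with $0^{-1/m}:=+\infty$), each normed by $\sup|\sum_kv_kz^k|$ over $z\in\mathbb{C}^3$ with $1/\rho\le|z_s|\le\rho$ for $s=1,2,3$; $\mathscr{A}$ carries the locally convex inductive limit topology of these spaces. $\mathscr{A}$ embeds continuously in every $H^n$. $\mathscr{P}(v,w):=-\mathfrak{L}(v\cdot\nabla w)$ with $\mathfrak{L}$ the Leray projection onto divergence free fields; in Fourier terms $\mathscr{P}(v,w)_k=-i\sum_{h}(v_h\cdot(k-h))\,\mathfrak{L}_kw_{k-h}$,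 where $\mathfrak{L}_kc=c-(k\cdot c)k/|k|^2$ for $k\ne0$, $\mathfrak{L}_0c=c$. $\mathscr{P}$ maps $\mathscr{A}\times\mathscr{A}$ continuously to $\mathscr{A}$, and $H^n\times H^{n+1}$ continuously to $H^n$ for $n>3/2$. The Euler Cauchy problem is $\partial u/\partial t=\mathscr{P}(u,u)$, $u(0)=u_0$. An $\mathscr{A}$-solution is a real-analytic map $u:(-\mathscr{T},T)\to\mathscr{A}$ ($\mathscr{T},T\in(0,+\infty]$) solving the problem; for $n>5/2$ an $H^n$-solution is a map in $C((-\mathscr{T},T),H^n)\cap C^1((-\mathscr{T},T),H^{n-1})$ solving it. It is known that for $u_0\in\mathscr{A}$ there is a unique maximal (non-extendable) $\mathscr{A}$-solution, and that for every $n>5/2$ it coincides (same domain) with the unique maximal $H^n$-solution with datum $u_0$. Convergence radii take values in $[0,+\infty]$: $\tau_n=\liminf_{j\to+\infty}\|u_j\|_n^{-1/j}$, $\theta_n=\liminf_{j\to+\infty}|\nu_{nj}|^{-1/j}$, with $0^{-1/j}:=+\infty$. *)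

theory Defs
  imports "HOL-Analysis.Analysis"
begin

text \<open>
  A vector field or distribution on the torus \<open>(\<real>/2\<pi>\<int>)^3\<close> is represented by its family of
  Fourier coefficients \<open>v k\<close>, where \<open>v = \<Sum>k. v k e\<^bsup>ik\<cdot>x\<^esup>\<close>.
\<close>

type_synonym field3 = "int^3 \<Rightarrow> complex^3"

definition cvec :: "int^3 \<Rightarrow> complex^3"
  where "cvec k = (\<chi> s. of_int (k $ s))"

text \<open>Bilinear, without conjugation.\<close>

definition cdot :: "complex^3 \<Rightarrow> complex^3 \<Rightarrow> complex"
  where "cdot a b = (\<Sum>s\<in>UNIV. a $ s * b $ s)"

definition vcnj :: "complex^3 \<Rightarrow> complex^3"
  where "vcnj a = (\<chi> s. cnj (a $ s))"

definition euclid_norm :: "int^3 \<Rightarrow> real"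
  where "euclid_norm k = sqrt (\<Sum>s\<in>UNIV. (of_int (k $ s))\<^sup>2)"

definition l1_norm :: "int^3 \<Rightarrow> real"
  where "l1_norm k = (\<Sum>s\<in>UNIV. \<bar>of_int (k $ s)\<bar>)"

text \<open>
  Real distributions on the torus: a family of coefficients is that of a distribution iff it
  grows at most polynomially, and the distribution is real iff \<open>v (-k)\<close> is the conjugate of
  \<open>v k\<close>.
\<close>

definition distributions :: "field3 set"
  where "distributions = {v.
    (\<exists>C m. \<forall>k. norm (v k) \<le> C * (1 + euclid_norm k) ^ m) \<and>
    (\<forall>k. v (- k) = vcnj (v k))}"

text \<open>Zero mean, divergence free distributions.\<close>

definition solenoidal :: "field3 set"
  where "solenoidal = {v \<in> distributions. v 0 = 0 \<and> (\<forall>k. cdot (cvec k) (v k) = 0)}"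


subsection \<open>Sobolev spaces\<close>

definition H_space :: "real \<Rightarrow> field3 set"
  where "H_space n = {v \<in> solenoidal.
    (\<lambda>k. euclid_norm k powr (2 * n) * (norm (v k))\<^sup>2) summable_on UNIV}"

text \<open>
  The sum is real on real fields, since the terms for \<open>k\<close> and \<open>-k\<close> are conjugate; \<open>Re\<close> only
  adjusts the type.
\<close>

definition H_inner :: "real \<Rightarrow> field3 \<Rightarrow> field3 \<Rightarrow> real"
  where "H_inner n v w =
    Re (\<Sum>\<^sub>\<infinity>k. of_real (euclid_norm k powr (2 * n)) * cdot (vcnj (v k)) (w k))"

definition H_norm :: "real \<Rightarrow> field3 \<Rightarrow> real"
  where "H_norm n v = sqrt (H_inner n v v)"


subsection \<open>Analytic fields\<close>

definition A_rho :: "real \<Rightarrow> field3 set"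
  where "A_rho \<rho> = {v \<in> solenoidal.
    Liminf cofinite
      (\<lambda>k. if v k = 0 then \<infinity> else ereal (norm (v k) powr (- 1 / l1_norm k))) > ereal \<rho>}"

definition A_rho_norm :: "real \<Rightarrow> field3 \<Rightarrow> real"
  where "A_rho_norm \<rho> v =
    (SUP z\<in>{z :: complex^3. \<forall>s. 1 / \<rho> \<le> cmod (z $ s) \<and> cmod (z $ s) \<le> \<rho>}.
      norm (\<Sum>\<^sub>\<infinity>k. (\<Prod>s\<in>UNIV. z $ s powi (k $ s)) *s v k))"

definition A_space :: "field3 set"
  where "A_space = (\<Union>\<rho>\<in>{1<..}. A_rho \<rho>)"

text \<open>
  The locally convex inductive limit topology, i.e. the finest locally convex topology for which
  all inclusions \<open>A_rho \<rho> \<rightarrow> A_space\<close> are continuous, is the one defined by all seminorms whose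
  restrictions to the normed spaces \<open>A_rho \<rho>\<close> are continuous, that is, bounded.
\<close>

definition A_seminorm :: "(field3 \<Rightarrow> real) \<Rightarrow> bool"
  where "A_seminorm p \<longleftrightarrow>
    (\<forall>v\<in>A_space. \<forall>w\<in>A_space. p (\<lambda>k. v k + w k) \<le> p v + p w) \<and>
    (\<forall>c. \<forall>v\<in>A_space. p (\<lambda>k. c *\<^sub>R v k) = \<bar>c\<bar> * p v) \<and>
    (\<forall>\<rho>>1. \<exists>C. \<forall>v\<in>A_rho \<rho>. p v \<le> C * A_rho_norm \<rho> v)"

definition A_topology :: "field3 topology"
  where "A_topology = topology_generated_by
    {{w \<in> A_space. p (\<lambda>k. w k - v k) < e} | p v e. A_seminorm p \<and> v \<in> A_space \<and> 0 < e}"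

lemma topspace_A_topology: "topspace A_topology = A_space"
proof -
  let ?B = "{{w \<in> A_space. p (\<lambda>k. w k - v k) < e} | p v e.
    A_seminorm p \<and> v \<in> A_space \<and> (0::real) < e}"
  have "w \<in> \<Union>?B" if w: "w \<in> A_space" for w
  proof -
    have p: "A_seminorm (\<lambda>_. 0)"
      by (auto simp: A_seminorm_def intro: exI[of _ 0])
    have "\<exists>p v e. A_space = {w \<in> A_space. p (\<lambda>k. w k - v k) < e} \<and>
        A_seminorm p \<and> v \<in> A_space \<and> (0::real) < e"
      by (rule exI[of _ "\<lambda>_. 0"], rule exI[of _ w], rule exI[of _ 1]) (use p w in auto)
    then have "A_space \<in> ?B" by blast
    with w show ?thesis by blast
  qed
  then have "\<Union>?B = A_space" by blast
  then show ?thesis by (simp add: A_topology_def topology_generated_by_topspace)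
qed


subsection \<open>The Euler equation\<close>

definition Leray :: "int^3 \<Rightarrow> complex^3 \<Rightarrow> complex^3"
  where "Leray k c =
    (if k = 0 then c
     else c - (cdot (cvec k) c / of_real ((euclid_norm k)\<^sup>2)) *s cvec k)"

definition euler_P :: "field3 \<Rightarrow> field3 \<Rightarrow> field3"
  where "euler_P v w = (\<lambda>k.
    (- \<i>) *s (\<Sum>\<^sub>\<infinity>h. cdot (v h) (cvec (k - h)) *s Leray k (w (k - h))))"

text \<open>The interval from \<open>-S\<close> to \<open>T\<close>, with \<open>S\<close> and \<open>T\<close> possibly infinite.\<close>

definition time_interval :: "ereal \<Rightarrow> ereal \<Rightarrow> real set"
  where "time_interval S T = {t. - S < ereal t \<and> ereal t < T}"

text \<open>Around each time the map is the sum of a power series convergent in the topology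
  of the space of analytic fields.\<close>

definition A_real_analytic_on :: "real set \<Rightarrow> (real \<Rightarrow> field3) \<Rightarrow> bool"
  where "A_real_analytic_on I u \<longleftrightarrow>
    (\<forall>t0\<in>I. \<exists>\<delta>>0. \<exists>a. (\<forall>j. a j \<in> A_space) \<and>
      (\<forall>t\<in>I. \<bar>t - t0\<bar> < \<delta> \<longrightarrow>
        limitin A_topology (\<lambda>N k. \<Sum>j<N. (t - t0) ^ j *\<^sub>R a j k) (u t) sequentially))"

definition A_solution :: "field3 \<Rightarrow> ereal \<Rightarrow> ereal \<Rightarrow> (real \<Rightarrow> field3) \<Rightarrow> bool"
  where "A_solution u0 S T u \<longleftrightarrow>
    0 < S \<and> 0 < T \<and>
    (\<forall>t\<in>time_interval S T. u t \<in> A_space) \<and>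
    A_real_analytic_on (time_interval S T) u \<and>
    (\<forall>t\<in>time_interval S T.
      limitin A_topology (\<lambda>h k. (1 / h) *\<^sub>R (u (t + h) k - u t k)) (euler_P (u t) (u t)) (at 0)) \<and>
    u 0 = u0"

definition maximal_A_solution :: "field3 \<Rightarrow> ereal \<Rightarrow> ereal \<Rightarrow> (real \<Rightarrow> field3) \<Rightarrow> bool"
  where "maximal_A_solution u0 S T u \<longleftrightarrow>
    A_solution u0 S T u \<and>
    (\<forall>S' T' u'. A_solution u0 S' T' u' \<and> S \<le> S' \<and> T \<le> T' \<and>
      (\<forall>t\<in>time_interval S T. u' t = u t) \<longrightarrow> S' = S \<and> T' = T)"


subsection \<open>Power series in time\<close>

fun euler_coeff :: "field3 \<Rightarrow> nat \<Rightarrow> field3"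
  where "euler_coeff u0 j =
    (if j = 0 then u0
     else (\<lambda>k. (1 / real j) *\<^sub>R
       (\<Sum>l\<in>{..<j}. euler_P (euler_coeff u0 l) (euler_coeff u0 (j - l - 1)) k)))"

declare euler_coeff.simps [simp del]

definition euler_nu :: "real \<Rightarrow> field3 \<Rightarrow> nat \<Rightarrow> real"
  where "euler_nu n u0 j = (\<Sum>l\<le>j. H_inner n (euler_coeff u0 l) (euler_coeff u0 (j - l)))"

text \<open>Convergence radius of a power series whose coefficients have norms \<open>a j\<close>.\<close>

definition radius :: "(nat \<Rightarrow> real) \<Rightarrow> ereal"
  where "radius a = liminf (\<lambda>j. if a j = 0 then \<infinity> else ereal (a j powr (- 1 / real j)))"

definition tau :: "real \<Rightarrow> field3 \<Rightarrow> ereal"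
  where "tau n u0 = radius (\<lambda>j. H_norm n (euler_coeff u0 j))"

definition theta :: "real \<Rightarrow> field3 \<Rightarrow> ereal"
  where "theta n u0 = radius (\<lambda>j. \<bar>euler_nu n u0 j\<bar>)"

end

theory Submission
  imports Defs
begin

text \<open>
  Everything happens on the Fourier side.  A solution is determined near each time by its Taylor
  series, whose coefficients are forced by the recursion, so that \<open>t \<mapsto> \<parallel>u(t)\<parallel>\<^sub>n\<^sup>2\<close> is real-analytic and
  equals \<open>\<Sum>j. \<nu>\<^sub>n\<^sub>j t\<^sup>j\<close> wherever both are defined.  If \<open>\<theta>\<^sub>n\<close> exceeded \<open>T\<close>, then \<open>\<parallel>u(t)\<parallel>\<^sub>n\<close> would stay
  bounded on \<open>[0, T)\<close>.  A Gevrey energy estimate with the weights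
  \<open>|k|\<^sup>n exp(\<phi>(t) min(|k|, N))\<close>, uniform in \<open>N\<close>, shows that the radius of analyticity, which shrinks
  like \<open>\<phi>(t) = \<phi>(0) exp(-\<kappa> t)\<close>, then stays bounded away from zero.  The Cauchy--Kovalevskaya
  existence time depends only on an analytic norm of the datum, so the solution could be continued
  past \<open>T\<close>, against maximality.  The bound by \<open>S\<close> follows by reversing time.
\<close>

subsection \<open>Wave vectors\<close>

text \<open>The inductive limit topology enters through two facts: each \<open>wnorm n\<close> is
  one of its continuous seminorms, and errors \<epsilon> exp(- \<sigma> |k|) with fixed \<sigma> and
  \<epsilon> \<rightarrow> 0 converge in it. In between, weighted absolute sums are used, because
  they bound products termwise.

  The obstacle in the Gevrey estimate: u(t) is analytic for each t, but perhaps with a width below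
  \<phi>(t), so the untruncated energy could be infinite. With min(|k|, N) the weight is a constant
  multiple of |k|^n outside a finite ball, and the energy E is finite and differentiable in t.

  The nonlinearity puts a derivative on one factor. Antisymmetry turns it into a difference of
  weights, leaving at most C1 M E, with M a bound on the \<open>H_norm\<close>, plus C2 \<phi>
  sqrt(E) D, where D carries one extra factor min(|k|, N). Since \<phi>' = - \<kappa> \<phi>
  contributes - 2 \<kappa> \<phi> D to E', the choice \<kappa> = C2 sqrt(B) cancels the second term
  as long as E \<le> B, and the first, being linear in E, gives Gronwall growth.\<close>

lemma cvec_add: "cvec (h + k) = cvec h + cvec k"
  and cvec_minus: "cvec (- k) = - cvec k"
  and cvec_0 [simp]: "cvec 0 = 0"
  by (simp_all add: cvec_def vec_eq_iff)

lemma vcnj_cvec [simp]: "vcnj (cvec k) = cvec k"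
  by (simp add: vcnj_def cvec_def)

lemma norm_cvec: "norm (cvec k) = euclid_norm k"
  by (simp add: norm_vec_def L2_set_def cvec_def euclid_norm_def)

lemma euclid_norm_nonneg [simp]: "0 \<le> euclid_norm k"
  by (metis norm_cvec norm_ge_zero)

lemma euclid_norm_0 [simp]: "euclid_norm 0 = 0"
  by (metis cvec_0 norm_cvec norm_zero)

lemma euclid_norm_minus [simp]: "euclid_norm (- k) = euclid_norm k"
  by (metis cvec_minus norm_cvec norm_minus_cancel)

lemma euclid_norm_add_le: "euclid_norm (h + k) \<le> euclid_norm h + euclid_norm k"
  by (metis cvec_add norm_cvec norm_triangle_ineq)

lemma euclid_norm_diff_le: "\<bar>euclid_norm (h + k) - euclid_norm k\<bar> \<le> euclid_norm h"
  by (metis add_diff_cancel_right' cvec_add norm_cvec norm_triangle_ineq3)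

lemma component_le_euclid_norm: "\<bar>of_int (k $ s)\<bar> \<le> euclid_norm k"
proof -
  have "\<bar>of_int (k $ s)\<bar> = norm (cvec k $ s)"
    by (simp add: cvec_def)
  then show ?thesis
    by (metis Finite_Cartesian_Product.norm_nth_le norm_cvec)
qed

lemma euclid_norm_ge_1: "k \<noteq> 0 \<Longrightarrow> 1 \<le> euclid_norm k"
proof -
  assume "k \<noteq> 0"
  then obtain s where "k $ s \<noteq> 0" by (auto simp: vec_eq_iff)
  then have "1 \<le> \<bar>k $ s\<bar>" by linarith
  then have "1 \<le> \<bar>real_of_int (k $ s)\<bar>" by linarith
  with component_le_euclid_norm[of k s] show ?thesis by linarith
qed

lemma euclid_norm_eq_0_iff [simp]: "euclid_norm k = 0 \<longleftrightarrow> k = 0"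
  using euclid_norm_ge_1[of k] by (cases "k = 0") auto

lemma euclid_le_l1_norm: "euclid_norm k \<le> l1_norm k"
  unfolding euclid_norm_def l1_norm_def using L2_set_le_sum_abs[of "\<lambda>s. of_int (k $ s)" UNIV]
  by (simp add: L2_set_def)

lemma l1_le_euclid_norm: "l1_norm k \<le> 3 * euclid_norm k"
proof -
  have "l1_norm k \<le> (\<Sum>s\<in>(UNIV::3 set). euclid_norm k)"
    unfolding l1_norm_def by (intro sum_mono component_le_euclid_norm)
  then show ?thesis by simp
qed

lemma finite_euclid_norm_le: "finite {k. euclid_norm k \<le> R}"
proof -
  let ?B = "{k :: int^3. \<forall>s. k $ s \<in> {- \<lceil>R\<rceil>..\<lceil>R\<rceil>}}"
  have "?B \<subseteq> (\<lambda>f. vec_lambda f) ` (UNIV \<rightarrow>\<^sub>E {- \<lceil>R\<rceil>..\<lceil>R\<rceil>})"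
  proof
    fix k :: "int^3" assume "k \<in> ?B"
    then have "k = vec_lambda (vec_nth k)" "vec_nth k \<in> UNIV \<rightarrow>\<^sub>E {- \<lceil>R\<rceil>..\<lceil>R\<rceil>}" by auto
    then show "k \<in> (\<lambda>f. vec_lambda f) ` (UNIV \<rightarrow>\<^sub>E {- \<lceil>R\<rceil>..\<lceil>R\<rceil>})" by blast
  qed
  moreover have "finite ((UNIV :: 3 set) \<rightarrow>\<^sub>E {- \<lceil>R\<rceil>..\<lceil>R\<rceil>})"
    by (intro finite_PiE) auto
  ultimately have "finite ?B"
    by (meson finite_imageI finite_subset)
  moreover have "{k. euclid_norm k \<le> R} \<subseteq> ?B"
  proof
    fix k assume "k \<in> {k. euclid_norm k \<le> R}"
    then have "\<bar>real_of_int (k $ s)\<bar> \<le> R" for s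
      using component_le_euclid_norm[of k s] by auto
    then have "\<bar>k $ s\<bar> \<le> \<lceil>R\<rceil>" for s
      by (metis le_of_int_ceiling of_int_abs of_int_le_iff order_trans)
    then show "k \<in> ?B"
      by (auto simp: abs_le_iff) (smt (verit) minus_le_iff)+
  qed
  ultimately show ?thesis by (rule finite_subset[rotated])
qed

section \<open>Summability of powers over the lattice\<close>

lemma summable_int_powr:
  assumes "1 < q"
  shows "(\<lambda>m::int. max 1 \<bar>real_of_int m\<bar> powr (- q)) summable_on UNIV"
proof -
  let ?f = "\<lambda>m::int. max 1 \<bar>real_of_int m\<bar> powr (- q)"
  have s: "summable (\<lambda>n. real n powr (- q))"
    using assms by (simp add: summable_real_powr_iff)
  have "(\<lambda>n. real n powr (- q)) summable_on UNIV"
    by (intro summable_nonneg_imp_summable_on s) auto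
  then have n: "(\<lambda>n. real n powr (- q)) summable_on {1..}"
    by (rule summable_on_subset) auto
  have "(?f \<circ> int) summable_on {1..}" "(?f \<circ> (\<lambda>n. - int n)) summable_on {1..}"
    by (rule summable_on_cong[THEN iffD1, OF _ n]; simp add: max_def)+
  then have "?f summable_on int ` {1..}" "?f summable_on (\<lambda>n. - int n) ` {1..}"
    by (subst summable_on_reindex; simp add: inj_on_def)+
  then have "?f summable_on insert 0 (int ` {1..} \<union> (\<lambda>n. - int n) ` {1..})"
    by (auto intro!: summable_on_union simp: summable_on_insert_iff)
  moreover have "insert 0 (int ` {1..} \<union> (\<lambda>n. - int n) ` {1..}) = UNIV"
  proof -
    have "m \<in> insert 0 (int ` {1..} \<union> (\<lambda>n. - int n) ` {1..})" for m
      by (cases m rule: int_cases2) (auto simp: image_iff intro: bexI[of _ "nat \<bar>m\<bar>"])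
    then show ?thesis by blast
  qed
  ultimately show ?thesis by simp
qed

lemma summable_int3_prod:
  fixes f :: "int \<Rightarrow> real"
  assumes f: "f summable_on UNIV" and nn: "\<And>m. 0 \<le> f m"
  shows "(\<lambda>k::int^3. \<Prod>s\<in>UNIV. f (k $ s)) summable_on UNIV"
proof -
  have f2: "(\<lambda>(a, b). f a * f b) summable_on UNIV \<times> UNIV"
    by (rule summable_on_SigmaI[where g = "\<lambda>a. f a * infsum f UNIV"])
      (auto intro!: has_sum_cmult_right has_sum_infsum f summable_on_cmult_left nn mult_nonneg_nonneg)
  have f2': "(\<lambda>(b, c). f b * f c) summable_on UNIV" using f2 by simp
  have f3: "(\<lambda>(a, p). f a * (case p of (b, c) \<Rightarrow> f b * f c)) summable_on UNIV \<times> (UNIV \<times> UNIV)"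
    by (rule summable_on_SigmaI[where g = "\<lambda>a. f a * infsum (\<lambda>(b, c). f b * f c) (UNIV \<times> UNIV)"])
      (auto intro!: has_sum_cmult_right has_sum_infsum f f2' summable_on_cmult_left nn mult_nonneg_nonneg)
  let ?j = "\<lambda>k::int^3. (k $ 1, k $ 2, k $ 3)"
  let ?i = "\<lambda>(a, b, c). vector [a, b, c] :: int^3"
  have "(\<lambda>k::int^3. \<Prod>s\<in>UNIV. f (k $ s)) summable_on UNIV \<longleftrightarrow>
    (\<lambda>(a, p). f a * (case p of (b, c) \<Rightarrow> f b * f c)) summable_on UNIV \<times> (UNIV \<times> UNIV)"
  proof (rule summable_on_reindex_bij_witness[where j = ?j and i = ?i])
    show "?i (?j k) = k" for k by (simp add: vec_eq_iff forall_3 vector_3)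
    show "?j (?i p) = p" for p by (cases p) (simp add: vector_3)
    show "(case ?j k of (a, p) \<Rightarrow> f a * (case p of (b, c) \<Rightarrow> f b * f c)) = (\<Prod>s\<in>UNIV. f (k $ s))" for k
      unfolding UNIV_3 by (simp add: mult.assoc)
  qed auto
  with f3 show ?thesis by simp
qed

text \<open>For k \<noteq> 0, |k| is at least max 1 |k_s| for each s, so |k| powr (- p) is at most a
  product of three one-dimensional terms with exponent p / 3 > 1. The \<open>max 1\<close> keeps the
  factor of a vanishing component equal to 1, since \<open>0 powr x = 0\<close>; for the same reason
  the origin contributes nothing to the left side.\<close>

lemma summable_euclid_powr:
  assumes "3 < p"
  shows "(\<lambda>k. euclid_norm k powr (- p)) summable_on UNIV"
proof (rule summable_on_comparison_test)
  show "(\<lambda>k::int^3. \<Prod>s\<in>UNIV. max 1 \<bar>real_of_int (k $ s)\<bar> powr (- (p / 3))) summable_on UNIV"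
    using assms by (intro summable_int3_prod summable_int_powr) auto
  fix k :: "int^3"
  show "euclid_norm k powr - p \<le> (\<Prod>s\<in>UNIV. max 1 \<bar>real_of_int (k $ s)\<bar> powr - (p / 3))"
  proof (cases "k = 0")
    case False
    have "euclid_norm k powr - p = euclid_norm k powr (- (p / 3) + - (p / 3) + - (p / 3))"
      by simp
    also have "\<dots> = (\<Prod>s\<in>(UNIV::3 set). euclid_norm k powr - (p / 3))"
      by (simp only: powr_add UNIV_3) simp
    also have "\<dots> \<le> (\<Prod>s\<in>UNIV. max 1 \<bar>real_of_int (k $ s)\<bar> powr - (p / 3))"
      using assms euclid_norm_ge_1[OF False] component_le_euclid_norm[of k]
      by (intro prod_mono conjI powr_mono2') auto
    finally show ?thesis .
  qed (simp add: prod_nonneg)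
qed simp

subsection \<open>The bilinear dot product\<close>

lemma norm_cdot_le: "norm (cdot a b) \<le> norm a * norm b"
proof -
  have "norm (cdot a b) \<le> (\<Sum>s\<in>UNIV. \<bar>norm (a $ s)\<bar> * \<bar>norm (b $ s)\<bar>)"
    unfolding cdot_def by (rule sum_norm_le) (simp add: norm_mult)
  also have "\<dots> \<le> norm a * norm b"
    unfolding norm_vec_def by (rule L2_set_mult_ineq)
  finally show ?thesis .
qed

lemma bounded_bilinear_cdot: "bounded_bilinear cdot"
proof
  show "\<exists>K. \<forall>a b. norm (cdot a b) \<le> norm a * norm b * K"
    by (rule exI[of _ 1]) (simp add: norm_cdot_le)
qed (simp_all add: cdot_def sum.distrib algebra_simps scaleR_sum_right)

interpretation cdot: bounded_bilinear cdot
  by (rule bounded_bilinear_cdot)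

lemma cdot_commute: "cdot a b = cdot b a"
  by (simp add: cdot_def mult.commute)

lemma cdot_cmult_right: "cdot a (c *s b) = c * cdot a b"
  by (simp add: cdot_def sum_distrib_left mult_ac)

lemma cnj_cdot: "cnj (cdot a b) = cdot (vcnj a) (vcnj b)"
  by (simp add: cdot_def vcnj_def)

lemma vcnj_vcnj [simp]: "vcnj (vcnj a) = a"
  and vcnj_cmult: "vcnj (c *s a) = cnj c *s vcnj a"
  and vcnj_diff: "vcnj (a - b) = vcnj a - vcnj b"
  by (simp_all add: vcnj_def vec_eq_iff)

lemma norm_vcnj [simp]: "norm (vcnj a) = norm a"
  by (simp add: vcnj_def norm_vec_def)

lemma bounded_linear_vcnj: "bounded_linear vcnj"
  by (rule bounded_linear_intro[where K = 1]) (auto simp: vcnj_def vec_eq_iff norm_vec_def)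

lemma cdot_vcnj_self: "cdot (vcnj a) a = of_real ((norm a)\<^sup>2)"
proof -
  have "cdot (vcnj a) a = (\<Sum>s\<in>UNIV. of_real ((norm (a $ s))\<^sup>2))"
    unfolding cdot_def vcnj_def
    by (intro sum.cong refl) (simp add: complex_norm_square mult.commute del: of_real_power)
  then show ?thesis
    by (simp add: norm_vec_def L2_set_def sum_nonneg)
qed

lemma cdot_cvec_self: "cdot (cvec k) (cvec k) = of_real ((euclid_norm k)\<^sup>2)"
  using cdot_vcnj_self[of "cvec k"] by (simp add: norm_cvec)

lemma norm_cmult: "norm (c *s a) = cmod c * norm (a :: complex^3)"
  by (simp add: norm_vec_def L2_set_def norm_mult power_mult_distrib flip: sum_distrib_left)
     (simp add: real_sqrt_mult)

lemma bounded_bilinear_cmult: "bounded_bilinear (\<lambda>c (a :: complex^3). c *s a)"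
proof
  show "\<exists>K. \<forall>a b. norm (a *s b) \<le> norm a * norm (b :: complex^3) * K"
    by (rule exI[of _ 1]) (simp add: norm_cmult)
qed (simp_all add: vec_eq_iff algebra_simps)

interpretation cmult: bounded_bilinear "\<lambda>c (a :: complex^3). c *s a"
  by (rule bounded_bilinear_cmult)

subsection \<open>Leray projection\<close>

lemma Leray_add: "Leray k (a + b) = Leray k a + Leray k b"
  by (simp add: Leray_def cdot.add_right add_divide_distrib vec_eq_iff algebra_simps)

lemma Leray_scaleR: "Leray k (r *\<^sub>R a) = r *\<^sub>R Leray k a"
  by (simp add: Leray_def cdot.scaleR_right vec_eq_iff algebra_simps)
    (simp add: scaleR_conv_of_real)

text \<open>The projection has norm 1; the triangle inequality gives 2, which only affects
  constants.\<close>

lemma norm_Leray_le: "norm (Leray k a) \<le> 2 * norm a"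
proof (cases "k = 0")
  case False
  then have pos: "0 < euclid_norm k" using euclid_norm_ge_1[of k] by simp
  have "norm (Leray k a) \<le> norm a + norm ((cdot (cvec k) a / of_real ((euclid_norm k)\<^sup>2)) *s cvec k)"
    using False by (simp add: Leray_def norm_triangle_ineq4)
  also have "norm ((cdot (cvec k) a / of_real ((euclid_norm k)\<^sup>2)) *s cvec k)
      = norm (cdot (cvec k) a) / euclid_norm k"
    using pos by (simp add: norm_cmult norm_divide norm_power norm_cvec) (simp add: power2_eq_square)
  also have "\<dots> \<le> norm a"
    using norm_cdot_le[of "cvec k" a] pos by (simp add: norm_cvec field_simps)
  finally show ?thesis by simp
qed (simp add: Leray_def)

lemma cdot_Leray: "k \<noteq> 0 \<Longrightarrow> cdot (cvec k) (Leray k a) = 0"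
  by (simp add: Leray_def cdot.diff_right cdot_cmult_right cdot_cvec_self)

text \<open>Pairing with a divergence free coefficient removes the pressure: this is how the
  projection disappears from the energy balance.\<close>

lemma cdot_Leray_orthogonal:
  "cdot (cvec k) b = 0 \<Longrightarrow> cdot b (Leray k a) = cdot b a"
  by (simp add: Leray_def cdot.diff_right cdot_cmult_right cdot_commute)

lemma Leray_uminus_vcnj: "Leray (- k) (vcnj a) = vcnj (Leray k a)"
  by (auto simp: Leray_def cvec_minus cdot.minus_left vcnj_diff vcnj_cmult cnj_cdot vec_eq_iff)

subsection \<open>Exponential decay of the coefficients\<close>

lemma power_le_fact_exp:
  fixes y :: real
  assumes "0 \<le> y"
  shows "y ^ m \<le> fact m * exp y"
proof -
  have "(\<Sum>i\<in>{m}. y ^ i /\<^sub>R fact i) \<le> (\<Sum>i. y ^ i /\<^sub>R fact i)"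
    using assms by (intro sum_le_suminf summable_exp_generic) auto
  then show ?thesis
    by (simp add: exp_def field_simps)
qed

lemma powr_exp_bounded:
  fixes s \<sigma> :: real
  assumes "0 < \<sigma>"
  obtains C where "0 \<le> C" "\<And>x. 1 \<le> x \<Longrightarrow> x powr s * exp (- \<sigma> * x) \<le> C"
proof -
  define m where "m = nat \<lceil>s\<rceil>"
  have "x powr s * exp (- \<sigma> * x) \<le> fact m / \<sigma> ^ m" if "1 \<le> x" for x
  proof -
    have "x powr s \<le> x powr real m"
      using that by (intro powr_mono) (auto simp: m_def of_nat_ceiling)
    also have "\<dots> = x ^ m"
      using that by (simp add: powr_realpow)
    also have "\<dots> = (\<sigma> * x) ^ m / \<sigma> ^ m"
      using assms by (simp add: power_mult_distrib)
    also have "\<dots> \<le> fact m * exp (\<sigma> * x) / \<sigma> ^ m"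
      using assms that by (intro divide_right_mono power_le_fact_exp) auto
    finally have "x powr s * exp (- \<sigma> * x) \<le> fact m * exp (\<sigma> * x) / \<sigma> ^ m * exp (- \<sigma> * x)"
      by (intro mult_right_mono) auto
    also have "\<dots> = fact m / \<sigma> ^ m"
      by (simp add: exp_minus)
    finally show ?thesis .
  qed
  moreover have "0 \<le> fact m / \<sigma> ^ m" using assms by simp
  ultimately show thesis using that by blast
qed

lemma summable_powr_exp:
  assumes "0 < \<sigma>"
  shows "(\<lambda>k. euclid_norm k powr s * exp (- \<sigma> * euclid_norm k)) summable_on UNIV"
proof -
  obtain C where C: "0 \<le> C" "\<And>x. 1 \<le> x \<Longrightarrow> x powr (s + 4) * exp (- \<sigma> * x) \<le> C"
    using powr_exp_bounded[OF assms] by metis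
  show ?thesis
  proof (rule summable_on_comparison_test)
    show "(\<lambda>k. C * euclid_norm k powr (- 4)) summable_on UNIV"
      by (intro summable_on_cmult_right summable_euclid_powr) simp
    fix k :: "int^3"
    show "euclid_norm k powr s * exp (- \<sigma> * euclid_norm k) \<le> C * euclid_norm k powr - 4"
    proof (cases "k = 0")
      case False
      then have k: "1 \<le> euclid_norm k" by (rule euclid_norm_ge_1)
      have "euclid_norm k powr s * exp (- \<sigma> * euclid_norm k)
          = (euclid_norm k powr (s + 4) * exp (- \<sigma> * euclid_norm k)) * euclid_norm k powr - 4"
        using powr_add[of "euclid_norm k" "s + 4" "- 4"] by simp
      also have "\<dots> \<le> C * euclid_norm k powr - 4"
        by (intro mult_right_mono C(2) k) auto
      finally show ?thesis .
    qed simp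
  qed auto
qed

lemma summable_exp_decay:
  assumes "0 < \<sigma>"
  shows "(\<lambda>k. exp (- \<sigma> * euclid_norm k)) summable_on UNIV"
proof -
  have "(\<lambda>k. euclid_norm k powr 0 * exp (- \<sigma> * euclid_norm k)) summable_on - {0}"
    by (rule summable_on_subset[OF summable_powr_exp[OF assms]]) auto
  then have "(\<lambda>k. exp (- \<sigma> * euclid_norm k)) summable_on - {0}"
    by (rule summable_on_cong[THEN iffD1, rotated]) auto
  then have "(\<lambda>k. exp (- \<sigma> * euclid_norm k)) summable_on insert 0 (- {0})"
    by (simp only: summable_on_insert_iff)
  moreover have "insert 0 (- {0}) = (UNIV :: (int^3) set)" by blast
  ultimately show ?thesis by simp
qed

text \<open>The working form of analyticity: by \<open>A_spaceI\<close> and \<open>A_spaceE\<close>,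
  a solenoidal family lies in \<open>A_space\<close> iff it decays in this sense for some \<sigma> >
  0. Keeping \<sigma> and \<open>C\<close> as parameters allows bounds that are uniform along
  sequences.\<close>

definition exp_decay :: "real \<Rightarrow> real \<Rightarrow> field3 \<Rightarrow> bool"
  where "exp_decay \<sigma> C v \<longleftrightarrow> (\<forall>k. norm (v k) \<le> C * exp (- \<sigma> * euclid_norm k))"

lemma exp_decay_nonneg: "exp_decay \<sigma> C v \<Longrightarrow> 0 \<le> C"
  by (drule exp_decay_def[THEN iffD1, THEN spec[of _ 0]]) (auto intro: order_trans[OF norm_ge_zero])

lemma exp_decay_imp_growth:
  assumes "exp_decay \<sigma> C v" "0 < \<sigma>"
  shows "\<exists>C m. \<forall>k. norm (v k) \<le> C * (1 + euclid_norm k) ^ m"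
proof (intro exI allI)
  fix k
  have "norm (v k) \<le> C * exp (- \<sigma> * euclid_norm k)"
    using assms(1) by (auto simp: exp_decay_def)
  also have "\<dots> \<le> C * 1"
    using assms exp_decay_nonneg by (intro mult_left_mono) auto
  finally show "norm (v k) \<le> C * (1 + euclid_norm k) ^ 0" by simp
qed

text \<open>The strict inequality leaves room for an \<open>r\<close> between \<rho> and the lower
  limit. All but finitely many coefficients are then below r to the power - |k|_1, and
  \<open>C\<close> absorbs the rest.\<close>

lemma A_rho_decay:
  assumes v: "v \<in> A_rho \<rho>" and \<rho>: "1 < \<rho>"
  obtains \<sigma> C where "ln \<rho> < \<sigma>" "0 \<le> C" "\<And>k. norm (v k) \<le> C * exp (- \<sigma> * l1_norm k)"
proof -
  let ?f = "\<lambda>k. if v k = 0 then \<infinity> else ereal (norm (v k) powr (- 1 / l1_norm k))"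
  from v have "ereal \<rho> < Liminf cofinite ?f" by (simp add: A_rho_def)
  then obtain r where r: "ereal \<rho> < ereal r" "ereal r < Liminf cofinite ?f"
    using ereal_dense2 by blast
  have r1: "1 < r" "\<rho> < r" using r \<rho> by auto
  \<comment> \<open>The origin joins the exceptional set, because \<open>- 1 / l1_norm k\<close> is
    a division by zero there.\<close>
  define K where "K = insert 0 {k. \<not> ereal r < ?f k}"
  have K: "finite K"
    using less_LiminfD[OF r(2)] by (simp add: eventually_cofinite K_def)
  define C where "C = 1 + (\<Sum>k\<in>K. norm (v k) * exp (ln r * l1_norm k))"
  have C1: "1 \<le> C" unfolding C_def by (simp add: sum_nonneg)
  have "norm (v k) \<le> C * exp (- ln r * l1_norm k)" for k
  proof (cases "k \<in> K")
    case True
    then have "norm (v k) * exp (ln r * l1_norm k) \<le> C"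
      unfolding C_def using K
      by (intro order_trans[OF member_le_sum[of k K "\<lambda>k. norm (v k) * exp (ln r * l1_norm k)"]]) auto
    then show ?thesis by (simp add: exp_minus field_simps)
  next
    case False
    then have k: "k \<noteq> 0" "ereal r < ?f k" by (auto simp: K_def)
    show ?thesis
    proof (cases "v k = 0")
      case vk: False
      have m: "0 < l1_norm k"
        using euclid_le_l1_norm[of k] euclid_norm_ge_1[OF k(1)] by simp
      have "r < norm (v k) powr (- 1 / l1_norm k)" using k vk by simp
      then have "(norm (v k) powr (- 1 / l1_norm k)) powr (- l1_norm k) < r powr (- l1_norm k)"
        using r1 m by (intro powr_less_mono2_neg) auto
      then have "norm (v k) \<le> exp (- ln r * l1_norm k)"
        using m vk r1 by (simp add: powr_powr) (simp add: powr_def mult.commute)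
      also have "\<dots> \<le> C * exp (- ln r * l1_norm k)"
        using C1 by simp
      finally show ?thesis .
    qed (use C1 in auto)
  qed
  moreover have "ln \<rho> < ln r" using r1 \<rho> by simp
  ultimately show thesis using that[of "ln r" C] C1 by auto
qed

lemma decay_imp_A_rho:
  assumes v: "v \<in> solenoidal" and \<rho>: "1 < \<rho>" and \<sigma>: "ln \<rho> < \<sigma>"
    and le: "\<And>k. norm (v k) \<le> C * exp (- \<sigma> * l1_norm k)"
  shows "v \<in> A_rho \<rho>"
proof -
  let ?f = "\<lambda>k. if v k = 0 then \<infinity> else ereal (norm (v k) powr (- 1 / l1_norm k))"
  obtain \<tau> where \<tau>: "ln \<rho> < \<tau>" "\<tau> < \<sigma>" using \<sigma> dense by blast
  define B where "B = max C 1"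
  \<comment> \<open>Beyond |k|_1 = R the gain exp(- (\<sigma> - \<tau>) |k|_1) has absorbed the
    constant \<open>B\<close>, which leaves pure decay at the rate \<tau> > ln \<rho>.\<close>
  define R where "R = ln B / (\<sigma> - \<tau>)"
  have "eventually (\<lambda>k. ereal (exp \<tau>) \<le> ?f k) cofinite"
    unfolding eventually_cofinite
  proof (rule finite_subset)
    show "finite (insert 0 {k. euclid_norm k \<le> R})"
      by (simp add: finite_euclid_norm_le)
    show "{k. \<not> ereal (exp \<tau>) \<le> ?f k} \<subseteq> insert 0 {k. euclid_norm k \<le> R}"
    proof (rule subsetI, rule ccontr)
      fix k assume *: "k \<in> {k. \<not> ereal (exp \<tau>) \<le> ?f k}" "k \<notin> insert 0 {k. euclid_norm k \<le> R}"
      then have vk: "v k \<noteq> 0" and ks: "k \<noteq> 0" "R < l1_norm k"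
        using euclid_le_l1_norm[of k] by (auto split: if_splits)
      have m: "0 < l1_norm k"
        using euclid_le_l1_norm[of k] euclid_norm_ge_1[OF ks(1)] by simp
      have "ln B \<le> (\<sigma> - \<tau>) * l1_norm k"
        using ks(2) \<tau> by (simp add: R_def field_simps)
      then have "B \<le> exp ((\<sigma> - \<tau>) * l1_norm k)"
        by (metis B_def exp_le_cancel_iff exp_ln less_max_iff_disj zero_less_one)
      have "norm (v k) \<le> B * exp (- \<sigma> * l1_norm k)"
        by (rule order_trans[OF le]) (simp add: B_def)
      also have "\<dots> \<le> exp ((\<sigma> - \<tau>) * l1_norm k) * exp (- \<sigma> * l1_norm k)"
        by (intro mult_right_mono) (fact, simp)
      also have "\<dots> = exp (- \<tau> * l1_norm k)"
        by (simp add: algebra_simps flip: exp_add)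
      finally have "norm (v k) \<le> exp (- \<tau> * l1_norm k)" .
      then have "exp (- \<tau> * l1_norm k) powr (- 1 / l1_norm k) \<le> norm (v k) powr (- 1 / l1_norm k)"
        using m vk by (intro powr_mono2') auto
      then have "exp \<tau> \<le> norm (v k) powr (- 1 / l1_norm k)"
        using m by (simp add: exp_powr_real)
      with * vk show False by simp
    qed
  qed
  then have "ereal (exp \<tau>) \<le> Liminf cofinite ?f"
    by (rule Liminf_bounded)
  moreover have "\<rho> < exp \<tau>"
    using \<tau> \<rho> by (metis exp_less_cancel_iff exp_ln less_trans zero_less_one)
  ultimately show ?thesis
    using v less_le_trans[of "ereal \<rho>" "ereal (exp \<tau>)"] by (simp add: A_rho_def)
qed

lemma A_spaceI:
  assumes "v \<in> solenoidal" "exp_decay \<sigma> C v" "0 < \<sigma>"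
  shows "v \<in> A_space"
proof -
  have "norm (v k) \<le> C * exp (- (\<sigma> / 3) * l1_norm k)" for k
  proof -
    have "norm (v k) \<le> C * exp (- \<sigma> * euclid_norm k)"
      using assms by (simp add: exp_decay_def)
    also have "\<dots> \<le> C * exp (- (\<sigma> / 3) * l1_norm k)"
      using assms l1_le_euclid_norm[of k] exp_decay_nonneg[OF assms(2)]
      by (intro mult_left_mono) (auto simp: field_simps)
    finally show ?thesis .
  qed
  \<comment> \<open>\<sigma> / 3 pays for |k|_1 \<le> 3 |k|; half of it is taken because decay
    strictly faster than ln \<rho> is required.\<close>
  then have "v \<in> A_rho (exp (\<sigma> / 6))"
    using assms by (intro decay_imp_A_rho[where \<sigma> = "\<sigma> / 3"]) auto
  then show ?thesis
    using assms by (auto simp: A_space_def intro!: bexI[of _ "exp (\<sigma> / 6)"])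
qed

lemma A_spaceE:
  assumes "v \<in> A_space"
  obtains \<sigma> C where "0 < \<sigma>" "exp_decay \<sigma> C v"
proof -
  obtain \<rho> where \<rho>: "1 < \<rho>" "v \<in> A_rho \<rho>" using assms by (auto simp: A_space_def)
  then obtain \<sigma> C where *: "ln \<rho> < \<sigma>" "0 \<le> C" "\<And>k. norm (v k) \<le> C * exp (- \<sigma> * l1_norm k)"
    using A_rho_decay by metis
  have \<sigma>: "0 < \<sigma>" using *(1) ln_gt_zero[OF \<rho>(1)] by linarith
  have "norm (v k) \<le> C * exp (- \<sigma> * euclid_norm k)" for k
    using *(2) \<sigma> euclid_le_l1_norm[of k]
    by (intro order_trans[OF *(3)] mult_left_mono) auto
  then show thesis using that \<sigma> by (auto simp: exp_decay_def)
qed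

lemma A_space_solenoidal: "v \<in> A_space \<Longrightarrow> v \<in> solenoidal"
  by (auto simp: A_space_def A_rho_def)

lemma exp_decay_mono:
  assumes "exp_decay \<sigma> C v" "\<sigma>' \<le> \<sigma>" "C \<le> C'"
  shows "exp_decay \<sigma>' C' v"
  unfolding exp_decay_def
proof
  fix k
  have "C * exp (- \<sigma> * euclid_norm k) \<le> C' * exp (- \<sigma>' * euclid_norm k)"
    using assms exp_decay_nonneg[OF assms(1)] by (intro mult_mono) (auto intro: mult_right_mono)
  with assms(1) show "norm (v k) \<le> C' * exp (- \<sigma>' * euclid_norm k)"
    by (auto simp: exp_decay_def intro: order_trans)
qed

lemma solenoidalD:
  assumes "v \<in> solenoidal"
  shows "v 0 = 0" "cdot (cvec k) (v k) = 0" "v (- k) = vcnj (v k)"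
  using assms by (auto simp: solenoidal_def distributions_def)

lemma solenoidalI:
  assumes "exp_decay \<sigma> C v" "0 < \<sigma>"
    and "v 0 = 0" "\<And>k. cdot (cvec k) (v k) = 0" "\<And>k. v (- k) = vcnj (v k)"
  shows "v \<in> solenoidal"
  using assms exp_decay_imp_growth[OF assms(1,2)] by (auto simp: solenoidal_def distributions_def)

lemma A_space_add:
  assumes "v \<in> A_space" "w \<in> A_space"
  shows "(\<lambda>k. v k + w k) \<in> A_space"
proof -
  obtain \<sigma> C where v: "0 < \<sigma>" "exp_decay \<sigma> C v" using A_spaceE[OF assms(1)] .
  obtain \<sigma>' C' where w: "0 < \<sigma>'" "exp_decay \<sigma>' C' w" using A_spaceE[OF assms(2)] .
  let ?s = "min \<sigma> \<sigma>'"
  have *: "exp_decay ?s C v" "exp_decay ?s C' w"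
    using v w by (auto intro: exp_decay_mono)
  have d: "exp_decay ?s (C + C') (\<lambda>k. v k + w k)"
    unfolding exp_decay_def
  proof
    fix k
    show "norm (v k + w k) \<le> (C + C') * exp (- ?s * euclid_norm k)"
      using *[unfolded exp_decay_def, THEN spec, of k] norm_triangle_ineq[of "v k" "w k"]
      by (simp add: distrib_right)
  qed
  note s = solenoidalD[OF A_space_solenoidal[OF assms(1)]] solenoidalD[OF A_space_solenoidal[OF assms(2)]]
  have "(\<lambda>k. v k + w k) \<in> solenoidal"
    using v w
    by (intro solenoidalI[OF d]) (auto simp: s cdot.add_right linear_add[OF bounded_linear.linear[OF bounded_linear_vcnj]])
  then show ?thesis
    using v w by (intro A_spaceI[OF _ d]) auto
qed

lemma A_space_scaleR:
  assumes "v \<in> A_space"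
  shows "(\<lambda>k. c *\<^sub>R v k) \<in> A_space"
proof -
  obtain \<sigma> C where v: "0 < \<sigma>" "exp_decay \<sigma> C v" using A_spaceE[OF assms(1)] .
  have d: "exp_decay \<sigma> (\<bar>c\<bar> * C) (\<lambda>k. c *\<^sub>R v k)"
    using v by (auto simp: exp_decay_def mult.assoc intro: mult_left_mono)
  note s = solenoidalD[OF A_space_solenoidal[OF assms(1)]]
  have "(\<lambda>k. c *\<^sub>R v k) \<in> solenoidal"
    using v by (intro solenoidalI[OF d])
      (auto simp: s cdot.scaleR_right linear_cmul[OF bounded_linear.linear[OF bounded_linear_vcnj]])
  then show ?thesis
    using v by (intro A_spaceI[OF _ d]) auto
qed

lemma A_space_diff: "v \<in> A_space \<Longrightarrow> w \<in> A_space \<Longrightarrow> (\<lambda>k. v k - w k) \<in> A_space"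
  using A_space_add[of v "\<lambda>k. (-1) *\<^sub>R w k"] A_space_scaleR[of w "-1"] by simp

lemma A_space_zero: "(\<lambda>k. 0) \<in> A_space"
  by (rule A_spaceI[where \<sigma> = 1 and C = 0], rule solenoidalI[where \<sigma> = 1 and C = 0])
    (auto simp: exp_decay_def vcnj_def vec_eq_iff cdot.zero_right)

lemma A_space_sum:
  assumes "\<And>i. i \<in> I \<Longrightarrow> v i \<in> A_space"
  shows "(\<lambda>k. \<Sum>i\<in>I. v i k) \<in> A_space"
  using assms by (induction I rule: infinite_finite_induct) (auto intro: A_space_zero A_space_add)

subsection \<open>Cauchy estimates\<close>

lemma has_sum_finite_sum:
  fixes f :: "'i \<Rightarrow> 'a \<Rightarrow> 'b::topological_comm_monoid_add"
  assumes "\<And>i. i \<in> I \<Longrightarrow> (f i has_sum s i) A"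
  shows "((\<lambda>x. \<Sum>i\<in>I. f i x) has_sum (\<Sum>i\<in>I. s i)) A"
  using assms by (induction I rule: infinite_finite_induct) (auto intro: has_sum_add)

lemma powi_le_exp:
  fixes x \<rho> :: real
  assumes "1 < \<rho>" "1 / \<rho> \<le> x" "x \<le> \<rho>"
  shows "x powi m \<le> exp (ln \<rho> * \<bar>of_int m\<bar>)"
proof -
  have x: "0 < x" using assms(1,2) by (meson divide_pos_pos less_le_trans less_trans zero_less_one)
  have "ln (1 / \<rho>) \<le> ln x" using assms x by (subst ln_le_cancel_iff) auto
  then have "\<bar>ln x\<bar> \<le> ln \<rho>" using assms x by (simp add: ln_div abs_le_iff)
  then have "of_int m * ln x \<le> \<bar>of_int m\<bar> * ln \<rho>"
    by (metis abs_ge_self abs_ge_zero abs_mult mult_left_mono order_trans)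
  moreover have "x powi m = exp (of_int m * ln x)"
    using x powr_real_of_int'[of x m] by (simp add: powr_def)
  ultimately show ?thesis by (simp add: mult.commute)
qed

lemma prod_exp_l1: "(\<Prod>s\<in>UNIV. exp (a * \<bar>of_int (k $ s)\<bar>)) = exp (a * l1_norm k)"
  by (simp add: l1_norm_def sum_distrib_left exp_sum)

lemma norm_monomial_le:
  assumes "1 < \<rho>" "\<And>s. 1 / \<rho> \<le> cmod (z $ s) \<and> cmod (z $ s) \<le> \<rho>"
  shows "cmod (\<Prod>s\<in>UNIV. z $ s powi (k $ s)) \<le> exp (ln \<rho> * l1_norm k)"
proof -
  have "cmod (\<Prod>s\<in>UNIV. z $ s powi (k $ s)) = (\<Prod>s\<in>UNIV. cmod (z $ s) powi (k $ s))"
    by (simp add: norm_power_int flip: prod_norm)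
  also have "\<dots> \<le> (\<Prod>s\<in>UNIV. exp (ln \<rho> * \<bar>of_int (k $ s)\<bar>))"
    using assms by (intro prod_mono conjI powi_le_exp) (auto intro: zero_le_power_int)
  finally show ?thesis by (simp add: prod_exp_l1)
qed

lemma summable_exp_l1:
  assumes "0 < \<sigma>"
  shows "(\<lambda>k. exp (- \<sigma> * l1_norm k)) summable_on UNIV"
  by (rule summable_on_comparison_test[OF summable_exp_decay[OF assms]])
    (use assms euclid_le_l1_norm in auto)

lemma series_abs_summable:
  fixes v :: field3 and z :: "complex^3"
  assumes "1 < \<rho>" "ln \<rho> < \<sigma>" "\<And>k. norm (v k) \<le> C * exp (- \<sigma> * l1_norm k)"
    and "\<And>s. 1 / \<rho> \<le> cmod (z $ s) \<and> cmod (z $ s) \<le> \<rho>"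
  shows "norm ((\<Prod>s\<in>UNIV. z $ s powi (k $ s)) *s v k) \<le> C * exp (- (\<sigma> - ln \<rho>) * l1_norm k)"
    and "(\<lambda>k. norm ((\<Prod>s\<in>UNIV. z $ s powi (k $ s)) *s v k)) summable_on UNIV"
proof -
  show *: "norm ((\<Prod>s\<in>UNIV. z $ s powi (k $ s)) *s v k) \<le> C * exp (- (\<sigma> - ln \<rho>) * l1_norm k)" for k
  proof -
    have "norm ((\<Prod>s\<in>UNIV. z $ s powi (k $ s)) *s v k)
        \<le> exp (ln \<rho> * l1_norm k) * (C * exp (- \<sigma> * l1_norm k))"
      unfolding norm_cmult by (intro mult_mono norm_monomial_le assms) auto
    then show ?thesis by (simp add: algebra_simps flip: exp_add)
  qed
  show "(\<lambda>k. norm ((\<Prod>s\<in>UNIV. z $ s powi (k $ s)) *s v k)) summable_on UNIV"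
    using assms(2)
    by (intro Infinite_Sum.abs_summable_on_comparison_test'[OF _ *] summable_on_cmult_right summable_exp_l1) auto
qed

text \<open>\<open>A_rho_norm\<close> is a real supremum, meaningful only for a nonempty set that is
  bounded above. Decay faster than ln \<rho> bounds it, and z = 1 lies in the annuli.\<close>

lemma
  fixes v :: field3 and z :: "complex^3"
  assumes "1 < \<rho>" "ln \<rho> < \<sigma>" "\<And>k. norm (v k) \<le> C * exp (- \<sigma> * l1_norm k)"
  shows A_rho_norm_le: "A_rho_norm \<rho> v \<le> C * (\<Sum>\<^sub>\<infinity>k. exp (- (\<sigma> - ln \<rho>) * l1_norm k))"
    and le_A_rho_norm: "(\<And>s. 1 / \<rho> \<le> cmod (z $ s) \<and> cmod (z $ s) \<le> \<rho>) \<Longrightarrow>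
      norm (\<Sum>\<^sub>\<infinity>k. (\<Prod>s\<in>UNIV. z $ s powi (k $ s)) *s v k) \<le> A_rho_norm \<rho> v"
proof -
  let ?Z = "{z :: complex^3. \<forall>s. 1 / \<rho> \<le> cmod (z $ s) \<and> cmod (z $ s) \<le> \<rho>}"
  let ?f = "\<lambda>z. norm (\<Sum>\<^sub>\<infinity>k. (\<Prod>s\<in>UNIV. z $ s powi (k $ s)) *s v k)"
  let ?B = "C * (\<Sum>\<^sub>\<infinity>k. exp (- (\<sigma> - ln \<rho>) * l1_norm k))"
  have B: "?f z \<le> ?B" if "z \<in> ?Z" for z
  proof -
    have z: "1 / \<rho> \<le> cmod (z $ s) \<and> cmod (z $ s) \<le> \<rho>" for s using that by auto
    note * = series_abs_summable[OF assms z]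
    have "?f z \<le> (\<Sum>\<^sub>\<infinity>k. norm ((\<Prod>s\<in>UNIV. z $ s powi (k $ s)) *s v k))"
      by (rule norm_infsum_bound) (rule *(2))
    also have "\<dots> \<le> (\<Sum>\<^sub>\<infinity>k. C * exp (- (\<sigma> - ln \<rho>) * l1_norm k))"
      using assms(2)
      by (intro infsum_mono *(1) summable_on_cmult_right summable_exp_l1) (use *(2) in auto)
    finally show ?thesis by (simp add: infsum_cmult_right')
  qed
  have "1 \<in> ?Z" using assms(1) by simp
  then have "?Z \<noteq> {}" by blast
  then show "A_rho_norm \<rho> v \<le> ?B"
    unfolding A_rho_norm_def by (rule cSUP_least) (rule B)
  show "?f z \<le> A_rho_norm \<rho> v" if "\<And>s. 1 / \<rho> \<le> cmod (z $ s) \<and> cmod (z $ s) \<le> \<rho>"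
    unfolding A_rho_norm_def using B that by (intro cSUP_upper bdd_aboveI2[where M = ?B]) auto
qed

text \<open>The discrete substitute for the mean of w^m over the unit circle: for M > 0 it is 1 if M
  divides m and 0 otherwise. With finitely many sample points the bound of the field on the annuli
  applies directly, without integration.\<close>

definition root_avg :: "nat \<Rightarrow> int \<Rightarrow> complex"
  where "root_avg M m = (\<Sum>a<M. cis (2 * pi * of_nat a / of_nat M) powi m) / of_nat M"

lemma root_avg_0: "0 < M \<Longrightarrow> root_avg M 0 = 1"
  by (simp add: root_avg_def)

lemma norm_root_avg_le: "norm (root_avg M m) \<le> 1"
proof -
  have "norm (\<Sum>a<M. cis (2 * pi * of_nat a / of_nat M) powi m) \<le> (\<Sum>a<M. 1)"
    by (intro sum_norm_le) (simp add: norm_power_int)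
  then show ?thesis by (simp add: root_avg_def norm_divide divide_le_eq)
qed

lemma root_avg_eq_0:
  assumes "m \<noteq> 0" "\<bar>m\<bar> < int M"
  shows "root_avg M m = 0"
proof -
  define w where "w = cis (2 * pi * of_int m / of_nat M)"
  have M: "0 < M" using assms by auto
  have a: "cis (2 * pi * of_nat a / of_nat M) powi m = w ^ a" for a
    
  proof -
    have "of_int m * (2 * pi * of_nat a / of_nat M) = of_nat a * (2 * pi * of_int m / of_nat M)"
      by simp
    then show ?thesis by (simp only: w_def cis_power_int Complex.DeMoivre)
  qed
  have "w ^ M = cis (2 * pi * of_int m)"
    using M by (simp add: w_def Complex.DeMoivre)
  then have wM: "w ^ M = 1" by (simp add: cis_multiple_2pi)
  have "w \<noteq> 1"
  proof
    assume "w = 1"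
    then have "exp (\<i> * of_real (2 * pi * of_int m / of_nat M)) = 1"
      by (simp add: w_def cis_conv_exp)
    then obtain n :: int where "2 * pi * of_int m / of_nat M = of_int (2 * n) * pi"
      by (auto simp: exp_eq_1)
    then have "of_int m = (of_int (n * int M) :: real)"
      using M by (simp add: field_simps)
    then have "m = n * int M" by linarith
    with assms show False
      by (metis abs_mult abs_of_nat dual_order.strict_iff_not mult_eq_0_iff mult_le_cancel_right1
          of_nat_less_0_iff zero_less_abs_iff int_one_le_iff_zero_less)
  qed
  then have "(\<Sum>a<M. w ^ a) = 0"
    using wM by (simp add: geometric_sum)
  then show ?thesis by (simp add: root_avg_def a)
qed

text \<open>Averaging over the \<open>M\<close>-th roots of unity in every variable extracts a Fourier coefficient,
  up to the aliases \<open>j \<noteq> k\<close>, \<open>j \<equiv> k (mod M)\<close>, which disappear as \<open>M \<rightarrow> \<infinity>\<close>.\<close>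

lemma Cauchy_estimate:
  assumes v: "v \<in> A_rho \<rho>" and \<rho>: "1 < \<rho>"
  shows "exp (ln \<rho> * l1_norm k) * norm (v k) \<le> A_rho_norm \<rho> v"
proof -
  obtain \<sigma> C where \<sigma>: "ln \<rho> < \<sigma>" and C: "\<And>k. norm (v k) \<le> C * exp (- \<sigma> * l1_norm k)"
    using A_rho_decay[OF v \<rho>] by metis
  \<comment> \<open>The radii follow the sign of each k_s, so that r_s powi k_s = \<rho>^|k_s|: at
    these radii the monomial of index \<open>k\<close> is as large as the annuli allow.\<close>
  define r where "r s = (if 0 \<le> k $ s then \<rho> else 1 / \<rho>)" for s
  define c where "c j = (\<Prod>s\<in>UNIV. complex_of_real (r s) powi (j $ s)) *s v j" for j
  have r: "1 / \<rho> \<le> r s" "r s \<le> \<rho>" "0 < r s" for s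
    using \<rho> less_trans[of "1 / \<rho>" 1 \<rho>] by (auto simp: r_def)
  have c_abs: "(\<lambda>j. norm (c j)) summable_on UNIV"
    using series_abs_summable(2)[OF \<rho> \<sigma> C, of "\<chi> s. complex_of_real (r s)"] r
    by (simp add: c_def abs_of_pos)
  have ck: "norm (c k) = exp (ln \<rho> * l1_norm k) * norm (v k)"
  proof -
    have "r s powi (k $ s) = exp (ln \<rho> * \<bar>of_int (k $ s)\<bar>)" for s
    proof -
      have "r s powi (k $ s) = exp (of_int (k $ s) * ln (r s))"
        using r(3)[of s] powr_real_of_int'[of "r s" "k $ s"] by (simp add: powr_def)
      then show ?thesis using \<rho> by (auto simp: r_def ln_div)
    qed
    then show ?thesis
      using r(3) by (simp add: c_def norm_cmult norm_power_int abs_of_pos prod_exp_l1 flip: prod_norm)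
  qed
  define g where "g M j = (\<Prod>s\<in>UNIV. root_avg M (j $ s - k $ s)) *s c j" for M j
  have g_le: "norm (g M j) \<le> norm (c j)" for M j
  proof -
    have "cmod (\<Prod>s\<in>UNIV. root_avg M (j $ s - k $ s)) \<le> 1"
      by (simp add: prod_le_1 norm_root_avg_le flip: prod_norm)
    then show ?thesis unfolding g_def norm_cmult by (simp add: mult_left_le_one_le)
  qed
  have g_abs: "(\<lambda>j. norm (g M j)) summable_on A" for M A
    by (rule Infinite_Sum.abs_summable_on_comparison_test'[OF summable_on_subset[OF c_abs, of A]]) (use g_le in auto)
  define S where "S M = infsum (g M) UNIV" for M
  have S_le: "norm (S M) \<le> A_rho_norm \<rho> v" if M: "0 < M" for M
  proof -
    \<comment> \<open>The M^3 sample points; \<open>\<epsilon>\<close> holds the conjugate phases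
      that single out the index \<open>k\<close>. \<open>S M\<close> is the mean of phase times
      field over these points, hence at most the supremum.\<close>
    define z :: "(3 \<Rightarrow> nat) \<Rightarrow> complex^3"
      where "z a = (\<chi> s. of_real (r s) * cis (2 * pi * of_nat (a s) / of_nat M))" for a
    define \<epsilon> where "\<epsilon> a = (\<Prod>s\<in>UNIV. cis (2 * pi * of_nat (a s) / of_nat M) powi (- k $ s))"
      for a :: "3 \<Rightarrow> nat"
    let ?P = "(UNIV :: 3 set) \<rightarrow>\<^sub>E {..<M}"
    have cz: "1 / \<rho> \<le> cmod (z a $ s) \<and> cmod (z a $ s) \<le> \<rho>" for a s
      using r[of s] by (simp add: z_def norm_mult)
    note sm = series_abs_summable(2)[OF \<rho> \<sigma> C cz, THEN abs_summable_summable]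
    have trm: "(\<Sum>a\<in>?P. \<epsilon> a *s ((\<Prod>s\<in>UNIV. z a $ s powi (j $ s)) *s v j))
        = of_nat (M ^ 3) *s ((\<Prod>s\<in>UNIV. root_avg M (j $ s - k $ s)) *s c j)" for j
    proof -
      have "(\<Sum>a\<in>?P. \<epsilon> a *s ((\<Prod>s\<in>UNIV. z a $ s powi (j $ s)) *s v j))
          = (\<Sum>a\<in>?P. (\<Prod>s\<in>UNIV. cis (2 * pi * of_nat (a s) / of_nat M) powi (j $ s - k $ s)) *s c j)"
      proof (rule sum.cong[OF refl])
        fix a
        have "\<epsilon> a * (\<Prod>s\<in>UNIV. z a $ s powi (j $ s)) =
            (\<Prod>s\<in>UNIV. cis (2 * pi * of_nat (a s) / of_nat M) powi (j $ s - k $ s)) *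
            (\<Prod>s\<in>UNIV. complex_of_real (r s) powi (j $ s))"
          unfolding \<epsilon>_def z_def prod.distrib[symmetric]
          by (intro prod.cong refl)
            (simp add: power_int_mult_distrib power_int_diff power_int_minus field_simps)
        then show "\<epsilon> a *s ((\<Prod>s\<in>UNIV. z a $ s powi (j $ s)) *s v j)
            = (\<Prod>s\<in>UNIV. cis (2 * pi * of_nat (a s) / of_nat M) powi (j $ s - k $ s)) *s c j"
          by (simp add: c_def vector_smult_assoc)
      qed
      also have "\<dots> = (\<Sum>a\<in>?P. \<Prod>s\<in>UNIV. cis (2 * pi * of_nat (a s) / of_nat M) powi (j $ s - k $ s)) *s c j"
        by (rule cmult.sum_left[symmetric])
      also have "(\<Sum>a\<in>?P. \<Prod>s\<in>UNIV. cis (2 * pi * of_nat (a s) / of_nat M) powi (j $ s - k $ s))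
          = (\<Prod>s\<in>UNIV. \<Sum>b<M. cis (2 * pi * of_nat b / of_nat M) powi (j $ s - k $ s))"
        by (rule prod_sum_PiE[symmetric]) auto
      also have "\<dots> = (\<Prod>s\<in>(UNIV::3 set). of_nat M * root_avg M (j $ s - k $ s))"
        using M by (simp add: root_avg_def)
      also have "\<dots> = of_nat (M ^ 3) * (\<Prod>s\<in>UNIV. root_avg M (j $ s - k $ s))"
        by (simp add: prod.distrib)
      finally show ?thesis by (simp add: vector_smult_assoc)
    qed
    have "(\<Sum>a\<in>?P. \<epsilon> a *s (\<Sum>\<^sub>\<infinity>j. (\<Prod>s\<in>UNIV. z a $ s powi (j $ s)) *s v j))
        = (\<Sum>a\<in>?P. \<Sum>\<^sub>\<infinity>j. \<epsilon> a *s ((\<Prod>s\<in>UNIV. z a $ s powi (j $ s)) *s v j))"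
      by (intro sum.cong refl infsumI[symmetric] has_sum_bounded_linear[OF cmult.bounded_linear_right]
          has_sum_infsum sm)
    also have "\<dots> = (\<Sum>\<^sub>\<infinity>j. \<Sum>a\<in>?P. \<epsilon> a *s ((\<Prod>s\<in>UNIV. z a $ s powi (j $ s)) *s v j))"
      by (intro infsumI[symmetric] has_sum_finite_sum has_sum_bounded_linear[OF cmult.bounded_linear_right]
          has_sum_infsum sm summable_on_bounded_linear[OF cmult.bounded_linear_right])
    also have "\<dots> = of_nat (M ^ 3) *s S M"
      unfolding trm S_def g_def[symmetric]
      by (intro infsumI has_sum_bounded_linear[OF cmult.bounded_linear_right]
          has_sum_infsum g_abs abs_summable_summable)
    finally have eq: "of_nat (M ^ 3) *s S M
        = (\<Sum>a\<in>?P. \<epsilon> a *s (\<Sum>\<^sub>\<infinity>j. (\<Prod>s\<in>UNIV. z a $ s powi (j $ s)) *s v j))" ..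
    have "norm (of_nat (M ^ 3) *s S M) \<le> (\<Sum>a\<in>?P. A_rho_norm \<rho> v)"
      unfolding eq
    proof (rule sum_norm_le)
      fix a
      have "cmod (\<epsilon> a) = 1" by (simp add: \<epsilon>_def norm_power_int flip: prod_norm)
      then show "norm (\<epsilon> a *s (\<Sum>\<^sub>\<infinity>j. (\<Prod>s\<in>UNIV. z a $ s powi (j $ s)) *s v j)) \<le> A_rho_norm \<rho> v"
        unfolding norm_cmult using le_A_rho_norm[OF \<rho> \<sigma> C cz, of a] by simp
    qed
    then have "real M ^ 3 * norm (S M) \<le> real M ^ 3 * A_rho_norm \<rho> v"
      by (simp add: norm_cmult norm_power card_PiE)
    then show ?thesis using M by simp
  qed
  have "norm (c k) \<le> A_rho_norm \<rho> v + \<epsilon>" if \<epsilon>: "0 < \<epsilon>" for \<epsilon>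
  proof -
    have nc: "(\<lambda>j. norm (c j)) summable_on UNIV" using c_abs .
    obtain F0 where F0: "finite F0" "dist (sum (\<lambda>j. norm (c j)) F0) (\<Sum>\<^sub>\<infinity>j. norm (c j)) \<le> \<epsilon>"
      using infsum_finite_approximation[OF nc \<epsilon>] by auto
    define F where "F = insert k F0"
    have F: "finite F" "k \<in> F" using F0 by (auto simp: F_def)
    have tail: "(\<Sum>\<^sub>\<infinity>j\<in>- F. norm (c j)) \<le> \<epsilon>"
    proof -
      have "(\<Sum>\<^sub>\<infinity>j. norm (c j)) = sum (\<lambda>j. norm (c j)) F + (\<Sum>\<^sub>\<infinity>j\<in>- F. norm (c j))"
        using infsum_Un_disjoint[of "\<lambda>j. norm (c j)" F "- F"] F nc summable_on_subset[OF nc]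
        by (simp add: Compl_partition)
      moreover have "sum (\<lambda>j. norm (c j)) F0 \<le> sum (\<lambda>j. norm (c j)) F"
        using F by (intro sum_mono2) (auto simp: F_def)
      ultimately show ?thesis using F0(2) by (simp add: dist_real_def)
    qed
    \<comment> \<open>\<open>M\<close> exceeds every component of j - k for j in \<open>F\<close>,
      so no alias of \<open>k\<close> lies in \<open>F\<close>; those outside contribute at most the
      tail \<open>\<epsilon>\<close>.\<close>
    define M where "M = nat (1 + (\<Sum>j\<in>F. \<Sum>s\<in>UNIV. \<bar>j $ s - k $ s\<bar>))"
    have nn: "0 \<le> (\<Sum>j\<in>F. \<Sum>s\<in>UNIV. \<bar>j $ s - k $ s\<bar>)" by (intro sum_nonneg) auto
    have M: "0 < M" using nn by (simp add: M_def)
    have small: "\<bar>j $ s - k $ s\<bar> < int M" if "j \<in> F" for j s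
    proof -
      have "\<bar>j $ s - k $ s\<bar> \<le> (\<Sum>s\<in>UNIV. \<bar>j $ s - k $ s\<bar>)"
        by (rule member_le_sum) auto
      also have "\<dots> \<le> (\<Sum>j\<in>F. \<Sum>s\<in>UNIV. \<bar>j $ s - k $ s\<bar>)"
        using F that by (intro member_le_sum[of j F "\<lambda>j. \<Sum>s\<in>UNIV. \<bar>j $ s - k $ s\<bar>"]) (auto intro: sum_nonneg)
      finally show ?thesis using nn by (simp add: M_def)
    qed
    let ?g = "g M"
    have gF: "?g j = (if j = k then c k else 0)" if "j \<in> F" for j
    proof (cases "j = k")
      case False
      then obtain s where "j $ s \<noteq> k $ s" by (auto simp: vec_eq_iff)
      then have "root_avg M (j $ s - k $ s) = 0" using small[OF that] by (intro root_avg_eq_0) auto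
      then have "(\<Prod>s\<in>UNIV. root_avg M (j $ s - k $ s)) = 0" by (intro prod_zero) auto
      then show ?thesis using False by (simp add: g_def)
    qed (simp add: g_def root_avg_0[OF M])
    have "S M = sum ?g F + infsum ?g (- F)"
      unfolding S_def using infsum_Un_disjoint[of ?g F "- F"] F g_abs[THEN abs_summable_summable]
      by (simp add: Compl_partition)
    also have "sum ?g F = (\<Sum>j\<in>F. if j = k then c k else 0)"
      by (intro sum.cong gF refl)
    also have "\<dots> = c k" using F by simp
    finally have "norm (c k) \<le> norm (S M) + norm (infsum ?g (- F))"
      by (metis add_diff_cancel_right' norm_triangle_ineq4)
    moreover have "norm (infsum ?g (- F)) \<le> (\<Sum>\<^sub>\<infinity>j\<in>- F. norm (c j))"
      by (rule order_trans[OF norm_infsum_bound[OF g_abs]])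
        (intro infsum_mono g_abs summable_on_subset[OF nc] g_le; simp)
    ultimately show ?thesis using S_le[OF M] tail by linarith
  qed
  then show ?thesis using ck by (metis field_le_epsilon)
qed

subsection \<open>Weighted summability and the topology of analytic fields\<close>

text \<open>Weighted absolute sums, in which convolutions are estimated termwise. The weight
  vanishes at the origin (\<open>0 powr n = 0\<close>), so \<open>v 0 = 0\<close> is demanded
  separately to let \<open>wnorm\<close> control every coefficient.\<close>

definition wspace :: "real \<Rightarrow> field3 set"
  where "wspace n = {v. v 0 = 0 \<and> (\<lambda>k. euclid_norm k powr n * norm (v k)) summable_on UNIV}"

definition wnorm :: "real \<Rightarrow> field3 \<Rightarrow> real"
  where "wnorm n v = (\<Sum>\<^sub>\<infinity>k. euclid_norm k powr n * norm (v k))"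

lemma wnorm_nonneg: "0 \<le> wnorm n v"
  unfolding wnorm_def by (intro infsum_nonneg) auto

lemma wspace_add:
  assumes "v \<in> wspace n" "w \<in> wspace n"
  shows "(\<lambda>k. v k + w k) \<in> wspace n" "wnorm n (\<lambda>k. v k + w k) \<le> wnorm n v + wnorm n w"
proof -
  have s: "(\<lambda>k. euclid_norm k powr n * norm (v k) + euclid_norm k powr n * norm (w k)) summable_on UNIV"
    using assms by (intro summable_on_add) (auto simp: wspace_def)
  have le: "euclid_norm k powr n * norm (v k + w k)
      \<le> euclid_norm k powr n * norm (v k) + euclid_norm k powr n * norm (w k)" for k
    unfolding distrib_left[symmetric] by (intro mult_left_mono norm_triangle_ineq) auto
  have s': "(\<lambda>k. euclid_norm k powr n * norm (v k + w k)) summable_on UNIV"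
    by (rule summable_on_comparison_test[OF s]) (use le in auto)
  then show "(\<lambda>k. v k + w k) \<in> wspace n" using assms by (simp add: wspace_def)
  have "wnorm n (\<lambda>k. v k + w k)
      \<le> (\<Sum>\<^sub>\<infinity>k. euclid_norm k powr n * norm (v k) + euclid_norm k powr n * norm (w k))"
    unfolding wnorm_def by (intro infsum_mono s s' le)
  also have "\<dots> = wnorm n v + wnorm n w"
    unfolding wnorm_def using assms by (intro infsum_add) (auto simp: wspace_def)
  finally show "wnorm n (\<lambda>k. v k + w k) \<le> wnorm n v + wnorm n w" .
qed

lemma wnorm_scaleR: "wnorm n (\<lambda>k. c *\<^sub>R v k) = \<bar>c\<bar> * wnorm n v"
  by (simp add: wnorm_def mult.left_commute infsum_cmult_right')

lemma wspace_scaleR: "v \<in> wspace n \<Longrightarrow> (\<lambda>k. c *\<^sub>R v k) \<in> wspace n"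
  by (auto simp: wspace_def mult.left_commute intro: summable_on_cmult_right)

lemma wspace_diff:
  assumes "v \<in> wspace n" "w \<in> wspace n"
  shows "(\<lambda>k. v k - w k) \<in> wspace n" "wnorm n (\<lambda>k. v k - w k) \<le> wnorm n v + wnorm n w"
  using wspace_add[OF assms(1) wspace_scaleR[OF assms(2), of "-1"]]
  by (simp_all add: wnorm_scaleR[of n "-1" w, simplified])

lemma wspace_zero: "(\<lambda>k. 0) \<in> wspace n"
  by (simp add: wspace_def)

lemma wspace_sum:
  "(\<And>i. i \<in> I \<Longrightarrow> v i \<in> wspace n) \<Longrightarrow> (\<lambda>k. \<Sum>i\<in>I. v i k) \<in> wspace n"
  by (induction I rule: infinite_finite_induct) (auto intro: wspace_add wspace_zero)

lemma norm_le_wnorm: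
  assumes "v \<in> wspace n"
  shows "euclid_norm k powr n * norm (v k) \<le> wnorm n v"
  using finite_sum_le_infsum[of "\<lambda>k. euclid_norm k powr n * norm (v k)" UNIV "{k}"] assms
  by (auto simp: wspace_def wnorm_def)

lemma coeff_le_wnorm:
  assumes "v \<in> wspace n" "0 \<le> n"
  shows "norm (v k) \<le> wnorm n v"
proof (cases "k = 0")
  case False
  have "norm (v k) = 1 * norm (v k)" by simp
  also have "\<dots> \<le> euclid_norm k powr n * norm (v k)"
    using euclid_norm_ge_1[OF False] assms by (intro mult_right_mono ge_one_powr_ge_zero) auto
  finally show ?thesis using norm_le_wnorm[OF assms(1), of k] by simp
qed (use assms wnorm_nonneg in \<open>auto simp: wspace_def\<close>)

lemma exp_decay_wspace:
  assumes "exp_decay \<sigma> C v" "0 < \<sigma>" "v 0 = 0"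
  shows "v \<in> wspace n"
    and "wnorm n v \<le> C * (\<Sum>\<^sub>\<infinity>k. euclid_norm k powr n * exp (- \<sigma> * euclid_norm k))"
proof -
  have le: "euclid_norm k powr n * norm (v k) \<le> C * (euclid_norm k powr n * exp (- \<sigma> * euclid_norm k))" for k
    using mult_left_mono[OF assms(1)[unfolded exp_decay_def, THEN spec, of k], of "euclid_norm k powr n"]
    by (simp add: mult_ac)
  have s: "(\<lambda>k. C * (euclid_norm k powr n * exp (- \<sigma> * euclid_norm k))) summable_on UNIV"
    by (intro summable_on_cmult_right summable_powr_exp assms)
  have s': "(\<lambda>k. euclid_norm k powr n * norm (v k)) summable_on UNIV"
    by (rule summable_on_comparison_test[OF s le]) auto
  show "v \<in> wspace n" using s' assms by (simp add: wspace_def)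
  show "wnorm n v \<le> C * (\<Sum>\<^sub>\<infinity>k. euclid_norm k powr n * exp (- \<sigma> * euclid_norm k))"
    unfolding wnorm_def infsum_cmult_right'[symmetric] by (intro infsum_mono s s' le)
qed

lemma A_space_wspace: "v \<in> A_space \<Longrightarrow> v \<in> wspace n"
  by (metis A_spaceE A_space_solenoidal exp_decay_wspace(1) solenoidalD(1))

text \<open>The way out of the topology: the Cauchy estimate bounds |v_k| by
  \<open>A_rho_norm \<rho> v\<close> times exp(- ln \<rho> |k|), and the weighted sum of these
  exponentials is the constant. Limits in \<open>A_topology\<close> thereby become limits in every
  \<open>wnorm n\<close>.\<close>

lemma A_seminorm_wnorm: "A_seminorm (wnorm n)"
  unfolding A_seminorm_def
proof (intro conjI ballI allI impI)
  fix \<rho> :: real assume \<rho>: "1 < \<rho>"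
  have "wnorm n v \<le> (\<Sum>\<^sub>\<infinity>k. euclid_norm k powr n * exp (- ln \<rho> * euclid_norm k)) * A_rho_norm \<rho> v"
    if v: "v \<in> A_rho \<rho>" for v
  proof -
    have "norm (v k) \<le> A_rho_norm \<rho> v * exp (- ln \<rho> * euclid_norm k)" for k
    proof -
      have "exp (ln \<rho> * euclid_norm k) * norm (v k) \<le> exp (ln \<rho> * l1_norm k) * norm (v k)"
        using \<rho> euclid_le_l1_norm[of k] by (intro mult_right_mono) auto
      also have "\<dots> \<le> A_rho_norm \<rho> v" by (rule Cauchy_estimate[OF v \<rho>])
      finally show ?thesis by (simp add: exp_minus field_simps)
    qed
    then have "exp_decay (ln \<rho>) (A_rho_norm \<rho> v) v" by (simp add: exp_decay_def)
    moreover have "v 0 = 0" using v by (simp add: A_rho_def solenoidal_def)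
    ultimately show ?thesis
      using exp_decay_wspace(2)[of "ln \<rho>" _ v n] \<rho> by (simp add: mult.commute)
  qed
  then show "\<exists>C. \<forall>v\<in>A_rho \<rho>. wnorm n v \<le> C * A_rho_norm \<rho> v" by blast
qed (auto simp: wnorm_scaleR intro: wspace_add A_space_wspace)

section \<open>Continuous seminorms and convergence in the inductive limit topology\<close>

lemma
  assumes "A_seminorm p" "v \<in> A_space"
  shows A_seminorm_add_le: "w \<in> A_space \<Longrightarrow> p (\<lambda>k. v k + w k) \<le> p v + p w"
    and A_seminorm_scaleR: "p (\<lambda>k. c *\<^sub>R v k) = \<bar>c\<bar> * p v"
  using assms by (auto simp: A_seminorm_def)

lemma limitin_A_space:
  assumes "limitin A_topology f l F"
  shows "l \<in> A_space" "\<forall>\<^sub>F x in F. f x \<in> A_space"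
proof -
  show "l \<in> A_space" using assms by (simp add: limitin_def topspace_A_topology)
  then show "\<forall>\<^sub>F x in F. f x \<in> A_space"
    using assms openin_topspace[of A_topology] unfolding limitin_def topspace_A_topology by blast
qed

text \<open>From subadditivity and homogeneity: 0 = p(v - v) \<le> p(v) + p(- v) = 2 p(v).\<close>

lemma A_seminorm_nonneg:
  assumes "A_seminorm p" "v \<in> A_space"
  shows "0 \<le> p v"
proof -
  have "p (\<lambda>k. 0 *\<^sub>R v k) = 0" "p (\<lambda>k. (-1) *\<^sub>R v k) = p v"
    using A_seminorm_scaleR[OF assms, of 0] A_seminorm_scaleR[OF assms, of "-1"] by auto
  moreover have "p (\<lambda>k. v k + (-1) *\<^sub>R v k) \<le> p v + p (\<lambda>k. (-1) *\<^sub>R v k)"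
    by (rule A_seminorm_add_le[OF assms A_space_scaleR[OF assms(2)]])
  ultimately show ?thesis by simp
qed

lemma limitin_A_seminorm:
  assumes lim: "limitin A_topology f l F" and p: "A_seminorm p"
  shows "((\<lambda>x. p (\<lambda>k. f x k - l k)) \<longlongrightarrow> 0) F"
proof (rule tendstoI)
  fix e :: real assume e: "0 < e"
  have l: "l \<in> A_space" using limitin_A_space(1)[OF lim] .
  let ?U = "{w \<in> A_space. p (\<lambda>k. w k - l k) < e}"
  have "openin A_topology ?U"
    unfolding A_topology_def
    by (rule topology_generated_by_Basis) (use p l e in blast)
  moreover have "p (\<lambda>k. l k - l k) = 0"
    using A_seminorm_scaleR[OF p l, of 0] by simp
  then have "l \<in> ?U" using l e by simp
  ultimately have "\<forall>\<^sub>F x in F. f x \<in> ?U"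
    using lim unfolding limitin_def by blast
  then show "\<forall>\<^sub>F x in F. dist (p (\<lambda>k. f x k - l k)) 0 < e"
  proof eventually_elim
    case (elim x)
    then show ?case using A_seminorm_nonneg[OF p A_space_diff[OF _ l], of "f x"] by (simp add: dist_real_def)
  qed
qed

lemma limitin_A_wnorm:
  "limitin A_topology f l F \<Longrightarrow> ((\<lambda>x. wnorm n (\<lambda>k. f x k - l k)) \<longlongrightarrow> 0) F"
  by (rule limitin_A_seminorm[OF _ A_seminorm_wnorm])

text \<open>The balls, with arbitrary centres, generate the topology as a subbase; induction over
  the generation of open sets reduces the claim to a single ball.\<close>

lemma limitin_A_seminormI:
  assumes l: "l \<in> A_space" and f: "\<forall>\<^sub>F x in F. f x \<in> A_space"
    and p: "\<And>p. A_seminorm p \<Longrightarrow> ((\<lambda>x. p (\<lambda>k. f x k - l k)) \<longlongrightarrow> 0) F"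
  shows "limitin A_topology f l F"
  unfolding limitin_def
proof (intro conjI allI impI)
  show "l \<in> topspace A_topology" using l by (simp add: topspace_A_topology)
  fix U assume "openin A_topology U \<and> l \<in> U"
  then have "generate_topology_on {{w \<in> A_space. p (\<lambda>k. w k - v k) < e} | p v e.
      A_seminorm p \<and> v \<in> A_space \<and> 0 < e} U" "l \<in> U"
    by (auto simp: A_topology_def openin_topology_generated_by_iff)
  then show "\<forall>\<^sub>F x in F. f x \<in> U"
  proof (induction rule: generate_topology_on.induct)
    case (Int a b)
    then show ?case by (auto intro: eventually_conj)
  next
    case (UN K)
    then obtain k where k: "k \<in> K" "l \<in> k" by blast
    then have "\<forall>\<^sub>F x in F. f x \<in> k" using UN by blast
    then show ?case by eventually_elim (use k in blast)
  next
    case (Basis s)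
    then obtain p v e where s: "s = {w \<in> A_space. p (\<lambda>k. w k - v k) < e}"
      and pv: "A_seminorm p" "v \<in> A_space" "0 < e" by blast
    \<comment> \<open>The ball is centred at \<open>v\<close>, not at \<open>l\<close>: the slack e
      - p(l - v) is the radius of a ball around \<open>l\<close> inside it.\<close>
    have "0 < e - p (\<lambda>k. l k - v k)" using Basis s by simp
    with p[OF pv(1)] have "\<forall>\<^sub>F x in F. dist (p (\<lambda>k. f x k - l k)) 0 < e - p (\<lambda>k. l k - v k)"
      by (rule tendstoD)
    then show ?case using f
    proof eventually_elim
      case (elim x)
      have "p (\<lambda>k. (f x k - l k) + (l k - v k)) \<le> p (\<lambda>k. f x k - l k) + p (\<lambda>k. l k - v k)"
        by (intro A_seminorm_add_le pv A_space_diff l elim)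
      then show ?case using elim by (simp add: s dist_real_def)
    qed
  qed simp
qed

text \<open>The way into the topology: a common width \<sigma> keeps all differences in one space
  \<open>A_rho \<rho>\<close>, on which every admissible seminorm is at most a constant times
  \<open>A_rho_norm \<rho>\<close>.\<close>

lemma limitin_A_decay:
  assumes l: "l \<in> A_space" and \<sigma>: "0 < \<sigma>"
    and f: "\<forall>\<^sub>F x in F. f x \<in> A_space \<and> exp_decay \<sigma> (\<epsilon> x) (\<lambda>k. f x k - l k)"
    and \<epsilon>: "(\<epsilon> \<longlongrightarrow> 0) F"
  shows "limitin A_topology f l F"
proof (rule limitin_A_seminormI[OF l])
  show "\<forall>\<^sub>F x in F. f x \<in> A_space" using f by eventually_elim simp
  fix p assume p: "A_seminorm p"
  define \<rho> where "\<rho> = exp (\<sigma> / 6)"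
  have \<rho>: "1 < \<rho>" "ln \<rho> < \<sigma> / 3" using \<sigma> by (auto simp: \<rho>_def)
  obtain C where C: "\<And>v. v \<in> A_rho \<rho> \<Longrightarrow> p v \<le> C * A_rho_norm \<rho> v"
    using p \<rho> unfolding A_seminorm_def by blast
  define S where "S = (\<Sum>\<^sub>\<infinity>k. exp (- (\<sigma> / 3 - ln \<rho>) * l1_norm k))"
  have "\<forall>\<^sub>F x in F. norm (p (\<lambda>k. f x k - l k)) \<le> norm (\<epsilon> x) * (\<bar>C\<bar> * S)"
    using f
  proof eventually_elim
    case (elim x)
    let ?d = "\<lambda>k. f x k - l k"
    have d: "?d \<in> A_space" using elim l by (intro A_space_diff) auto
    have e0: "0 \<le> \<epsilon> x" using elim exp_decay_nonneg by blast
    have le: "norm (?d k) \<le> \<epsilon> x * exp (- (\<sigma> / 3) * l1_norm k)" for k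
    proof -
      have "norm (?d k) \<le> \<epsilon> x * exp (- \<sigma> * euclid_norm k)"
        using elim by (simp add: exp_decay_def)
      also have "\<dots> \<le> \<epsilon> x * exp (- (\<sigma> / 3) * l1_norm k)"
        using e0 l1_le_euclid_norm[of k] \<sigma> by (intro mult_left_mono) (auto simp: field_simps)
      finally show ?thesis .
    qed
    have dA: "?d \<in> A_rho \<rho>"
      by (rule decay_imp_A_rho[OF A_space_solenoidal[OF d] \<rho> le])
    have nn: "0 \<le> A_rho_norm \<rho> ?d"
      using Cauchy_estimate[OF dA \<rho>(1), of 0] by (auto intro: order_trans[rotated])
    have "p ?d \<le> \<bar>C\<bar> * A_rho_norm \<rho> ?d"
      using C[OF dA] mult_right_mono[OF abs_ge_self nn, of C] by linarith
    also have "\<dots> \<le> \<bar>C\<bar> * (\<epsilon> x * S)"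
      unfolding S_def by (intro mult_left_mono A_rho_norm_le[OF \<rho> le]) auto
    finally have "p ?d \<le> \<epsilon> x * (\<bar>C\<bar> * S)" by (simp add: mult_ac)
    moreover have "0 \<le> p ?d" by (rule A_seminorm_nonneg[OF p d])
    ultimately show ?case using e0 by simp
  qed
  then show "((\<lambda>x. p (\<lambda>k. f x k - l k)) \<longlongrightarrow> 0) F"
    by (rule tendsto_0_le[OF \<epsilon>])
qed

subsection \<open>Bilinear maps and power series\<close>

text \<open>\<open>field3\<close> is a bare function type and estimates hold only on
  \<open>wspace n\<close>, so \<open>B\<close> is described by additivity and a bound there. The
  terms B(a_i, b_j) are absolutely summable over pairs; summed by rows they give B(v, w), by
  diagonals the Cauchy product.\<close>

lemma biadditive_Cauchy_product:
  fixes B :: "field3 \<Rightarrow> field3 \<Rightarrow> 'b::banach"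
  assumes add1: "\<And>v v' w. v \<in> wspace n \<Longrightarrow> v' \<in> wspace n \<Longrightarrow> w \<in> wspace n \<Longrightarrow>
      B (\<lambda>k. v k + v' k) w = B v w + B v' w"
    and add2: "\<And>v w w'. v \<in> wspace n \<Longrightarrow> w \<in> wspace n \<Longrightarrow> w' \<in> wspace n \<Longrightarrow>
      B v (\<lambda>k. w k + w' k) = B v w + B v w'"
    and bd: "\<And>v w. v \<in> wspace n \<Longrightarrow> w \<in> wspace n \<Longrightarrow> norm (B v w) \<le> C * wnorm n v * wnorm n w"
    and a: "\<And>j. a j \<in> wspace n" "\<And>j. b j \<in> wspace n" "v \<in> wspace n" "w \<in> wspace n"
    and sa: "summable (\<lambda>j. wnorm n (a j))" and sb: "summable (\<lambda>j. wnorm n (b j))"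
    and la: "(\<lambda>N. wnorm n (\<lambda>k. (\<Sum>j<N. a j k) - v k)) \<longlonglongrightarrow> 0"
    and lb: "(\<lambda>N. wnorm n (\<lambda>k. (\<Sum>j<N. b j k) - w k)) \<longlonglongrightarrow> 0"
  shows "(\<lambda>j. \<Sum>l\<le>j. B (a l) (b (j - l))) sums B v w"
proof -
  have z: "(\<lambda>k. 0) \<in> wspace n" by (simp add: wspace_def)
  have Bz1: "B (\<lambda>k. 0) w = 0" and Bz2: "B w (\<lambda>k. 0) = 0" if "w \<in> wspace n" for w
    using bd[OF z that] bd[OF that z] by (simp_all add: wnorm_def)
  have sum1: "B (\<lambda>k. \<Sum>j\<in>I. a j k) w = (\<Sum>j\<in>I. B (a j) w)" if "finite I" "w \<in> wspace n" for I w
    using that by (induction I) (simp_all add: Bz1 add1 wspace_sum a)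
  have sum2: "B u (\<lambda>k. \<Sum>j\<in>I. b j k) = (\<Sum>j\<in>I. B u (b j))" if "finite I" "u \<in> wspace n" for I u
    using that by (induction I) (simp_all add: Bz2 add2 wspace_sum a)
  have lim1: "(\<lambda>i. B (a i) w) sums B v w"
  proof -
    have "(\<lambda>N. B (\<lambda>k. \<Sum>j<N. a j k) w - B v w) \<longlonglongrightarrow> 0"
    proof (rule tendsto_0_le[OF la])
      have "norm (B (\<lambda>k. \<Sum>j<N. a j k) w - B v w) \<le> norm (wnorm n (\<lambda>k. (\<Sum>j<N. a j k) - v k)) * (C * wnorm n w)" for N
      proof -
        let ?d = "\<lambda>k. (\<Sum>j<N. a j k) - v k"
        have d: "?d \<in> wspace n" by (intro wspace_diff wspace_sum a)
        have "B (\<lambda>k. ?d k + v k) w = B ?d w + B v w" by (intro add1 d a)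
        then have "B (\<lambda>k. \<Sum>j<N. a j k) w - B v w = B ?d w" by simp
        then show ?thesis using bd[OF d a(4)] by (simp add: wnorm_nonneg mult_ac)
      qed
      then show "\<forall>\<^sub>F N in sequentially. norm (B (\<lambda>k. \<Sum>j<N. a j k) w - B v w)
          \<le> norm (wnorm n (\<lambda>k. (\<Sum>j<N. a j k) - v k)) * (C * wnorm n w)" by simp
    qed
    then show ?thesis by (simp add: sums_def sum1 a LIM_zero_iff)
  qed
  have lim2: "(\<lambda>j. B u (b j)) sums B u w" if u: "u \<in> wspace n" for u
  proof -
    have "(\<lambda>N. B u (\<lambda>k. \<Sum>j<N. b j k) - B u w) \<longlonglongrightarrow> 0"
    proof (rule tendsto_0_le[OF lb])
      have "norm (B u (\<lambda>k. \<Sum>j<N. b j k) - B u w) \<le> norm (wnorm n (\<lambda>k. (\<Sum>j<N. b j k) - w k)) * (C * wnorm n u)" for N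
      proof -
        let ?d = "\<lambda>k. (\<Sum>j<N. b j k) - w k"
        have d: "?d \<in> wspace n" by (intro wspace_diff wspace_sum a)
        have "B u (\<lambda>k. ?d k + w k) = B u ?d + B u w" by (intro add2 d a u)
        then have "B u (\<lambda>k. \<Sum>j<N. b j k) - B u w = B u ?d" by simp
        then show ?thesis using bd[OF u d] by (simp add: wnorm_nonneg mult_ac)
      qed
      then show "\<forall>\<^sub>F N in sequentially. norm (B u (\<lambda>k. \<Sum>j<N. b j k) - B u w)
          \<le> norm (wnorm n (\<lambda>k. (\<Sum>j<N. b j k) - w k)) * (C * wnorm n u)" by simp
    qed
    then show ?thesis by (simp add: sums_def sum2 u LIM_zero_iff)
  qed
  have sb': "(\<lambda>j. wnorm n (b j)) summable_on UNIV" and sa': "(\<lambda>j. wnorm n (a j)) summable_on UNIV"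
    using sa sb by (auto intro: summable_nonneg_imp_summable_on wnorm_nonneg)
  let ?F = "\<lambda>(i, j). B (a i) (b j)"
  have "(\<lambda>p. \<bar>C\<bar> * (wnorm n (a (fst p)) * wnorm n (b (snd p)))) summable_on UNIV \<times> UNIV"
    by (rule summable_on_SigmaI[where g = "\<lambda>i. \<bar>C\<bar> * (wnorm n (a i) * (\<Sum>\<^sub>\<infinity>j. wnorm n (b j)))"])
      (use sa' sb' in \<open>auto intro!: has_sum_cmult_right has_sum_infsum summable_on_cmult_left
        summable_on_cmult_right mult_nonneg_nonneg wnorm_nonneg\<close>)
  then have Fabs: "(\<lambda>p. norm (?F p)) summable_on UNIV \<times> UNIV"
  proof (rule Infinite_Sum.abs_summable_on_comparison_test')
    fix p :: "nat \<times> nat"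
    have "norm (?F p) \<le> C * (wnorm n (a (fst p)) * wnorm n (b (snd p)))"
      using bd[OF a(1,2), of "fst p" "snd p"] by (simp add: case_prod_unfold mult_ac)
    also have "\<dots> \<le> \<bar>C\<bar> * (wnorm n (a (fst p)) * wnorm n (b (snd p)))"
      by (intro mult_right_mono) (auto simp: wnorm_nonneg)
    finally show "norm (?F p) \<le> \<bar>C\<bar> * (wnorm n (a (fst p)) * wnorm n (b (snd p)))" .
  qed
  then have F: "?F summable_on UNIV \<times> UNIV" by (rule abs_summable_summable)
  have "((\<lambda>j. ?F (i, j)) has_sum B (a i) w) UNIV" for i
  proof -
    have "(\<lambda>j. ?F (i, j)) summable_on UNIV"
      using Fabs unfolding Infinite_Sum.abs_summable_on_Sigma_iff
      by (rule_tac abs_summable_summable) auto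
    then have "((\<lambda>j. ?F (i, j)) has_sum infsum (\<lambda>j. ?F (i, j)) UNIV) UNIV" by (rule has_sum_infsum)
    moreover have "infsum (\<lambda>j. ?F (i, j)) UNIV = B (a i) w"
      using sums_unique2[OF has_sum_imp_sums[OF calculation]] lim2[OF a(1), of i] by simp
    ultimately show ?thesis by simp
  qed
  then have "((\<lambda>i. B (a i) w) has_sum infsum ?F (UNIV \<times> UNIV)) UNIV"
    by (intro has_sum_SigmaD[OF has_sum_infsum[OF F]])
  from sums_unique2[OF has_sum_imp_sums[OF this] lim1]
  have "(?F has_sum B v w) (UNIV \<times> UNIV)" using has_sum_infsum[OF F] by simp
  also have "?this \<longleftrightarrow> ((\<lambda>(j, l). B (a l) (b (j - l))) has_sum B v w) (SIGMA j:UNIV. {..j})"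
    by (rule has_sum_reindex_bij_witness[where j = "\<lambda>(i, j). (i + j, i)" and i = "\<lambda>(j, l). (l, j - l)"]) auto
  finally have "((\<lambda>j. \<Sum>l\<le>j. B (a l) (b (j - l))) has_sum B v w) UNIV"
    by (rule has_sum_SigmaD) (auto intro: has_sum_finite)
  then show ?thesis by (rule has_sum_imp_sums)
qed

subsection \<open>The Euler nonlinearity\<close>

lemma euclid_pos: "k \<noteq> 0 \<Longrightarrow> 0 < euclid_norm k"
  using euclid_norm_ge_1[of k] by linarith

lemma wspace_mono:
  assumes "v \<in> wspace n" "m \<le> n"
  shows "v \<in> wspace m" "wnorm m v \<le> wnorm n v"
proof -
  have le: "euclid_norm k powr m * norm (v k) \<le> euclid_norm k powr n * norm (v k)" for k
    using assms euclid_norm_ge_1[of k] by (cases "k = 0") (auto intro!: mult_right_mono powr_mono)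
  have s: "(\<lambda>k. euclid_norm k powr n * norm (v k)) summable_on UNIV"
    using assms by (simp add: wspace_def)
  have s': "(\<lambda>k. euclid_norm k powr m * norm (v k)) summable_on UNIV"
    by (rule summable_on_comparison_test[OF s le]) auto
  then show "v \<in> wspace m" using assms by (simp add: wspace_def)
  show "wnorm m v \<le> wnorm n v"
    unfolding wnorm_def by (rule infsum_mono[OF s' s le])
qed

lemma wspace_summable_norm:
  assumes "v \<in> wspace n" "0 \<le> n"
  shows "(\<lambda>k. norm (v k)) summable_on UNIV" "(\<Sum>\<^sub>\<infinity>k. norm (v k)) \<le> wnorm n v"
proof -
  have eq: "euclid_norm k powr 0 * norm (v k) = norm (v k)" for k
    using assms by (cases "k = 0") (auto simp: wspace_def)
  show "(\<lambda>k. norm (v k)) summable_on UNIV"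
    using wspace_mono(1)[OF assms] by (simp only: wspace_def mem_Collect_eq eq)
  show "(\<Sum>\<^sub>\<infinity>k. norm (v k)) \<le> wnorm n v"
    using wspace_mono(2)[OF assms] unfolding wnorm_def eq .
qed

lemma wspace_summable_deriv:
  assumes "v \<in> wspace n" "1 \<le> n"
  shows "(\<lambda>k. euclid_norm k * norm (v k)) summable_on UNIV"
    "(\<Sum>\<^sub>\<infinity>k. euclid_norm k * norm (v k)) \<le> wnorm n v"
proof -
  have eq: "euclid_norm k powr 1 = euclid_norm k" for k by simp
  show "(\<lambda>k. euclid_norm k * norm (v k)) summable_on UNIV"
    using wspace_mono(1)[OF assms] unfolding wspace_def eq by simp
  show "(\<Sum>\<^sub>\<infinity>k. euclid_norm k * norm (v k)) \<le> wnorm n v"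
    using wspace_mono(2)[OF assms] unfolding wnorm_def eq .
qed

section \<open>Products and convolutions over the lattice\<close>

lemma has_sum_product:
  fixes a :: "'a \<Rightarrow> real" and b :: "'b \<Rightarrow> real"
  assumes a: "a summable_on UNIV" "\<And>h. 0 \<le> a h" and b: "b summable_on UNIV" "\<And>h. 0 \<le> b h"
  shows "((\<lambda>(h, l). a h * b l) has_sum infsum a UNIV * infsum b UNIV) (UNIV \<times> UNIV)"
proof (rule has_sum_SigmaI)
  show "((\<lambda>h. a h * infsum b UNIV) has_sum infsum a UNIV * infsum b UNIV) UNIV"
    by (intro has_sum_cmult_left has_sum_infsum a)
  show "((\<lambda>l. case (h, l) of (h, l) \<Rightarrow> a h * b l) has_sum a h * infsum b UNIV) UNIV" for h
    by (simp add: has_sum_cmult_right has_sum_infsum b)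
  then show "(\<lambda>(h, l). a h * b l) summable_on UNIV \<times> UNIV"
    by (rule summable_on_SigmaI) (auto intro: summable_on_cmult_left a b mult_nonneg_nonneg)
qed

lemma convolution:
  fixes a b :: "int^3 \<Rightarrow> real"
  assumes a: "a summable_on UNIV" "\<And>h. 0 \<le> a h" and b: "b summable_on UNIV" "\<And>h. 0 \<le> b h"
  shows "(\<lambda>h. a h * b (k - h)) summable_on UNIV"
    and "((\<lambda>k. \<Sum>\<^sub>\<infinity>h. a h * b (k - h)) has_sum infsum a UNIV * infsum b UNIV) UNIV"
proof -
  have "((\<lambda>(h, l). a h * b l) has_sum infsum a UNIV * infsum b UNIV) (UNIV \<times> UNIV) \<longleftrightarrow>
      ((\<lambda>(k, h). a h * b (k - h)) has_sum infsum a UNIV * infsum b UNIV) (UNIV \<times> UNIV)"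
    by (rule has_sum_reindex_bij_witness[where j = "\<lambda>(h, l). (h + l, h)" and i = "\<lambda>(k, h). (h, k - h)"]) auto
  with has_sum_product[OF a b]
  have *: "((\<lambda>(k, h). a h * b (k - h)) has_sum infsum a UNIV * infsum b UNIV) (UNIV \<times> UNIV)" by simp
  show s: "(\<lambda>h. a h * b (k - h)) summable_on UNIV" for k
    using summable_on_SigmaD1[OF has_sum_imp_summable[OF *], of k] by simp
  show "((\<lambda>k. \<Sum>\<^sub>\<infinity>h. a h * b (k - h)) has_sum infsum a UNIV * infsum b UNIV) UNIV"
    by (rule has_sum_SigmaD[OF *]) (simp add: has_sum_infsum s)
qed

definition euler_term :: "field3 \<Rightarrow> field3 \<Rightarrow> int^3 \<Rightarrow> int^3 \<Rightarrow> complex^3"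
  where "euler_term v w k h = cdot (v h) (cvec (k - h)) *s Leray k (w (k - h))"

lemma euler_P_eq: "euler_P v w k = (- \<i>) *s (\<Sum>\<^sub>\<infinity>h. euler_term v w k h)"
  by (simp add: euler_P_def euler_term_def)

lemma norm_euler_term_le:
  "norm (euler_term v w k h) \<le> 2 * (norm (v h) * (euclid_norm (k - h) * norm (w (k - h))))"
proof -
  have "norm (euler_term v w k h) \<le> (norm (v h) * norm (cvec (k - h))) * (2 * norm (w (k - h)))"
    unfolding euler_term_def norm_cmult by (intro mult_mono norm_cdot_le norm_Leray_le) auto
  then show ?thesis by (simp add: norm_cvec mult_ac)
qed

lemma euler_term_summable:
  assumes v: "(\<lambda>k. norm (v k)) summable_on UNIV"
    and w: "(\<lambda>k. euclid_norm k * norm (w k)) summable_on UNIV"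
  shows "(\<lambda>h. norm (euler_term v w k h)) summable_on UNIV" "euler_term v w k summable_on UNIV"
    and norm_euler_P_le: "norm (euler_P v w k)
      \<le> 2 * (\<Sum>\<^sub>\<infinity>h. norm (v h) * (euclid_norm (k - h) * norm (w (k - h))))"
proof -
  have s: "(\<lambda>h. 2 * (norm (v h) * (euclid_norm (k - h) * norm (w (k - h))))) summable_on UNIV"
    by (intro summable_on_cmult_right convolution(1)[OF v _ w]) auto
  show *: "(\<lambda>h. norm (euler_term v w k h)) summable_on UNIV"
    by (rule Infinite_Sum.abs_summable_on_comparison_test'[OF s]) (rule norm_euler_term_le)
  then show "euler_term v w k summable_on UNIV" by (rule abs_summable_summable)
  have "norm (euler_P v w k) = norm (\<Sum>\<^sub>\<infinity>h. euler_term v w k h)"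
    by (simp add: euler_P_eq norm_cmult)
  also have "\<dots> \<le> (\<Sum>\<^sub>\<infinity>h. norm (euler_term v w k h))"
    by (rule norm_infsum_bound[OF *])
  also have "\<dots> \<le> (\<Sum>\<^sub>\<infinity>h. 2 * (norm (v h) * (euclid_norm (k - h) * norm (w (k - h)))))"
    by (rule infsum_mono[OF * s norm_euler_term_le])
  finally show "norm (euler_P v w k)
      \<le> 2 * (\<Sum>\<^sub>\<infinity>h. norm (v h) * (euclid_norm (k - h) * norm (w (k - h))))"
    by (simp add: infsum_cmult_right')
qed

text \<open>A single coefficient of a convolution of nonnegative families is at most its total mass,
  which is the product of the two masses; the factor 2 is that of
  \<open>norm_Leray_le\<close>.\<close>

lemma norm_euler_P_le_wnorm:
  assumes v: "v \<in> wspace n" and w: "w \<in> wspace n" and n: "1 \<le> n"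
  shows "norm (euler_P v w k) \<le> 2 * wnorm n v * wnorm n w"
proof -
  note sv = wspace_summable_norm[OF v] and sw = wspace_summable_deriv[OF w n]
  have conv: "((\<lambda>k. \<Sum>\<^sub>\<infinity>h. norm (v h) * (euclid_norm (k - h) * norm (w (k - h))))
      has_sum (\<Sum>\<^sub>\<infinity>k. norm (v k)) * (\<Sum>\<^sub>\<infinity>k. euclid_norm k * norm (w k))) UNIV"
    by (rule convolution(2)) (use sv sw n in auto)
  have "norm (euler_P v w k) \<le> 2 * (\<Sum>\<^sub>\<infinity>h. norm (v h) * (euclid_norm (k - h) * norm (w (k - h))))"
    using sv(1) sw(1) n by (intro norm_euler_P_le) auto
  also have "(\<Sum>\<^sub>\<infinity>h. norm (v h) * (euclid_norm (k - h) * norm (w (k - h))))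
      \<le> (\<Sum>\<^sub>\<infinity>k. norm (v k)) * (\<Sum>\<^sub>\<infinity>k. euclid_norm k * norm (w k))"
    using finite_sum_le_has_sum[OF conv, of "{k}"] by (simp add: infsum_nonneg)
  also have "\<dots> \<le> wnorm n v * wnorm n w"
    using sv(2) sw(2) n by (intro mult_mono infsum_nonneg wnorm_nonneg) auto
  finally show ?thesis by simp
qed

lemma
  assumes v: "v \<in> wspace n" and w: "w \<in> wspace n" and x: "x \<in> wspace n" and n: "1 \<le> n"
  shows euler_P_add_left: "euler_P (\<lambda>k. v k + x k) w k = euler_P v w k + euler_P x w k"
    and euler_P_add_right: "euler_P v (\<lambda>k. w k + x k) k = euler_P v w k + euler_P v x k"
proof -
  have sv: "(\<lambda>k. norm (v k)) summable_on UNIV" and sx: "(\<lambda>k. norm (x k)) summable_on UNIV"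
    using v x n by (auto intro: wspace_summable_norm(1))
  have sw: "(\<lambda>k. euclid_norm k * norm (w k)) summable_on UNIV"
    and sx': "(\<lambda>k. euclid_norm k * norm (x k)) summable_on UNIV"
    using w x n by (auto intro: wspace_summable_deriv(1))
  have "euler_term (\<lambda>k. v k + x k) w k = (\<lambda>h. euler_term v w k h + euler_term x w k h)"
    by (simp add: euler_term_def cdot.add_left cmult.add_left fun_eq_iff)
  then show "euler_P (\<lambda>k. v k + x k) w k = euler_P v w k + euler_P x w k"
    using euler_term_summable(2)[OF sv sw] euler_term_summable(2)[OF sx sw]
    by (simp add: euler_P_eq infsum_add cmult.add_right)
  have "euler_term v (\<lambda>k. w k + x k) k = (\<lambda>h. euler_term v w k h + euler_term v x k h)"
    by (simp add: euler_term_def Leray_add cmult.add_right fun_eq_iff)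
  then show "euler_P v (\<lambda>k. w k + x k) k = euler_P v w k + euler_P v x k"
    using euler_term_summable(2)[OF sv sw] euler_term_summable(2)[OF sv sx']
    by (simp add: euler_P_eq infsum_add cmult.add_right)
qed

lemma euler_P_scaleR: "euler_P (\<lambda>k. c *\<^sub>R v k) (\<lambda>k. d *\<^sub>R w k) k = (c * d) *\<^sub>R euler_P v w k"
proof -
  have "euler_term (\<lambda>k. c *\<^sub>R v k) (\<lambda>k. d *\<^sub>R w k) k = (\<lambda>h. (c * d) *\<^sub>R euler_term v w k h)"
    by (simp add: euler_term_def cdot.scaleR_left Leray_scaleR cmult.scaleR_left cmult.scaleR_right
        fun_eq_iff mult.commute)
  then show ?thesis
    by (simp add: euler_P_eq infsum_scaleR_right cmult.scaleR_right del: scaleR_scaleR)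
qed

subsection \<open>Exponentially weighted norms\<close>

text \<open>For s \<ge> 0 the weight is submultiplicative along k = h + (k - h), by the triangle
  inequality, which makes this norm suited to convolutions.\<close>

definition enorm :: "real \<Rightarrow> field3 \<Rightarrow> real"
  where "enorm s v = (\<Sum>\<^sub>\<infinity>k. exp (s * euclid_norm k) * norm (v k))"

definition espace :: "real \<Rightarrow> field3 set"
  where "espace s = {v. (\<lambda>k. exp (s * euclid_norm k) * norm (v k)) summable_on UNIV}"

lemma enorm_nonneg: "0 \<le> enorm s v"
  unfolding enorm_def by (intro infsum_nonneg) auto

lemma espace_mono:
  assumes "v \<in> espace s" "r \<le> s"
  shows "v \<in> espace r" "enorm r v \<le> enorm s v"
proof -
  have le: "exp (r * euclid_norm k) * norm (v k) \<le> exp (s * euclid_norm k) * norm (v k)" for k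
    using assms by (intro mult_right_mono) (auto intro: mult_right_mono)
  have s: "(\<lambda>k. exp (s * euclid_norm k) * norm (v k)) summable_on UNIV"
    using assms by (simp add: espace_def)
  have s': "(\<lambda>k. exp (r * euclid_norm k) * norm (v k)) summable_on UNIV"
    by (rule summable_on_comparison_test[OF s le]) auto
  then show "v \<in> espace r" by (simp add: espace_def)
  show "enorm r v \<le> enorm s v"
    unfolding enorm_def by (rule infsum_mono[OF s' s le])
qed

lemma espace_add:
  assumes "v \<in> espace s" "w \<in> espace s"
  shows "(\<lambda>k. v k + w k) \<in> espace s" "enorm s (\<lambda>k. v k + w k) \<le> enorm s v + enorm s w"
proof -
  let ?e = "\<lambda>k. exp (s * euclid_norm k)"
  have s: "(\<lambda>k. ?e k * norm (v k) + ?e k * norm (w k)) summable_on UNIV"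
    using assms by (intro summable_on_add) (auto simp: espace_def)
  have le: "?e k * norm (v k + w k) \<le> ?e k * norm (v k) + ?e k * norm (w k)" for k
    unfolding distrib_left[symmetric] by (intro mult_left_mono norm_triangle_ineq) auto
  have s': "(\<lambda>k. ?e k * norm (v k + w k)) summable_on UNIV"
    by (rule summable_on_comparison_test[OF s le]) auto
  then show "(\<lambda>k. v k + w k) \<in> espace s" by (simp add: espace_def)
  have "enorm s (\<lambda>k. v k + w k) \<le> (\<Sum>\<^sub>\<infinity>k. ?e k * norm (v k) + ?e k * norm (w k))"
    unfolding enorm_def by (intro infsum_mono s s' le)
  also have "\<dots> = enorm s v + enorm s w"
    unfolding enorm_def using assms by (intro infsum_add) (auto simp: espace_def)
  finally show "enorm s (\<lambda>k. v k + w k) \<le> enorm s v + enorm s w" .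
qed

lemma espace_scaleR:
  assumes "v \<in> espace s"
  shows "(\<lambda>k. c *\<^sub>R v k) \<in> espace s" "enorm s (\<lambda>k. c *\<^sub>R v k) = \<bar>c\<bar> * enorm s v"
  using assms by (auto simp: espace_def enorm_def mult.left_commute infsum_cmult_right'
      intro: summable_on_cmult_right)

lemma espace_sum:
  assumes "finite I" "\<And>i. i \<in> I \<Longrightarrow> v i \<in> espace s"
  shows "(\<lambda>k. \<Sum>i\<in>I. v i k) \<in> espace s \<and> enorm s (\<lambda>k. \<Sum>i\<in>I. v i k) \<le> (\<Sum>i\<in>I. enorm s (v i))"
  using assms
proof (induction I)
  case (insert i I)
  then show ?case
    using espace_add[of "v i" s "\<lambda>k. \<Sum>i\<in>I. v i k"] by fastforce
qed (simp add: espace_def enorm_def)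

lemma exp_decay_espace:
  assumes "exp_decay \<sigma> C v" "s < \<sigma>"
  shows "v \<in> espace s" "enorm s v \<le> C * (\<Sum>\<^sub>\<infinity>k. exp (- (\<sigma> - s) * euclid_norm k))"
proof -
  have le: "exp (s * euclid_norm k) * norm (v k) \<le> C * exp (- (\<sigma> - s) * euclid_norm k)" for k
  proof -
    have "exp (s * euclid_norm k) * norm (v k) \<le> exp (s * euclid_norm k) * (C * exp (- \<sigma> * euclid_norm k))"
      using assms by (intro mult_left_mono) (auto simp: exp_decay_def)
    then show ?thesis by (simp add: algebra_simps flip: exp_add)
  qed
  have s: "(\<lambda>k. C * exp (- (\<sigma> - s) * euclid_norm k)) summable_on UNIV"
    using assms by (intro summable_on_cmult_right summable_exp_decay) auto
  have s': "(\<lambda>k. exp (s * euclid_norm k) * norm (v k)) summable_on UNIV"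
    by (rule summable_on_comparison_test[OF s le]) auto
  then show "v \<in> espace s" by (simp add: espace_def)
  show "enorm s v \<le> C * (\<Sum>\<^sub>\<infinity>k. exp (- (\<sigma> - s) * euclid_norm k))"
    unfolding enorm_def infsum_cmult_right'[symmetric] by (rule infsum_mono[OF s' s le])
qed

lemma espace_exp_decay:
  assumes "v \<in> espace s"
  shows "exp_decay s (enorm s v) v"
  unfolding exp_decay_def
proof
  fix k
  have "exp (s * euclid_norm k) * norm (v k) \<le> enorm s v"
    using finite_sum_le_infsum[of "\<lambda>k. exp (s * euclid_norm k) * norm (v k)" UNIV "{k}"] assms
    by (simp add: espace_def enorm_def)
  then show "norm (v k) \<le> enorm s v * exp (- s * euclid_norm k)"
    by (simp add: exp_minus field_simps)
qed

text \<open>One derivative costs 1 / (s' - s), because x \<le> exp((s' - s) x) / (s' - s). It falls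
  on \<open>w\<close> only, so \<open>v\<close> is measured at the final width.\<close>

lemma enorm_euler_P_le:
  assumes v: "v \<in> espace s" and w: "w \<in> espace s'" and s: "0 \<le> s" "s < s'"
  shows "euler_P v w \<in> espace s" "enorm s (euler_P v w) \<le> 2 / (s' - s) * enorm s v * enorm s' w"
proof -
  let ?e = "\<lambda>k. exp (s * euclid_norm k)"
  let ?a = "\<lambda>k. ?e k * norm (v k)" and ?b = "\<lambda>k. ?e k * (euclid_norm k * norm (w k))"
  have a: "?a summable_on UNIV" using v by (simp add: espace_def)
  have bs: "(\<lambda>k. 1 / (s' - s) * (exp (s' * euclid_norm k) * norm (w k))) summable_on UNIV"
    using w by (intro summable_on_cmult_right) (simp add: espace_def)
  have ble: "?b k \<le> 1 / (s' - s) * (exp (s' * euclid_norm k) * norm (w k))" for k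
  proof -
    have "(s' - s) * euclid_norm k \<le> exp ((s' - s) * euclid_norm k)"
      using exp_ge_add_one_self[of "(s' - s) * euclid_norm k"] by linarith
    then have "euclid_norm k \<le> 1 / (s' - s) * exp ((s' - s) * euclid_norm k)"
      using s by (simp add: field_simps)
    then have "?b k \<le> ?e k * ((1 / (s' - s) * exp ((s' - s) * euclid_norm k)) * norm (w k))"
      by (intro mult_left_mono mult_right_mono) auto
    also have "\<dots> = 1 / (s' - s) * ((?e k * exp ((s' - s) * euclid_norm k)) * norm (w k))"
      by simp
    also have "?e k * exp ((s' - s) * euclid_norm k) = exp (s' * euclid_norm k)"
      by (simp add: algebra_simps flip: exp_add)
    finally show ?thesis .
  qed
  have b: "?b summable_on UNIV"
    by (rule summable_on_comparison_test[OF bs ble]) auto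
  have "infsum ?b UNIV \<le> 1 / (s' - s) * enorm s' w"
    unfolding enorm_def infsum_cmult_right'[symmetric] by (rule infsum_mono[OF b bs ble])
  then have B: "infsum ?a UNIV * infsum ?b UNIV \<le> enorm s v * (1 / (s' - s) * enorm s' w)"
    unfolding enorm_def by (intro mult_left_mono infsum_nonneg) auto
  have sv: "(\<lambda>k. norm (v k)) summable_on UNIV"
    using espace_mono(1)[OF v s(1)] by (simp add: espace_def)
  have sw: "(\<lambda>k. euclid_norm k * norm (w k)) summable_on UNIV"
  proof (rule summable_on_comparison_test[OF b])
    fix k
    have "1 * (euclid_norm k * norm (w k)) \<le> ?b k"
      using s by (intro mult_right_mono) auto
    then show "euclid_norm k * norm (w k) \<le> ?b k" by simp
  qed auto
  have a0: "0 \<le> ?a k" and b0: "0 \<le> ?b k" for k by auto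
  note conv = convolution[OF a a0 b b0]
  have le: "?e k * norm (euler_P v w k) \<le> 2 * (\<Sum>\<^sub>\<infinity>h. ?a h * ?b (k - h))" for k
  proof -
    have "?e k * norm (euler_P v w k)
        \<le> ?e k * (2 * (\<Sum>\<^sub>\<infinity>h. norm (v h) * (euclid_norm (k - h) * norm (w (k - h)))))"
      by (intro mult_left_mono norm_euler_P_le sv sw) auto
    also have "\<dots> = 2 * (\<Sum>\<^sub>\<infinity>h. ?e k * (norm (v h) * (euclid_norm (k - h) * norm (w (k - h)))))"
      unfolding infsum_cmult_right' by simp
    also have "\<dots> \<le> 2 * (\<Sum>\<^sub>\<infinity>h. ?a h * ?b (k - h))"
    proof (intro mult_left_mono infsum_mono conv(1))
      show "(\<lambda>h. ?e k * (norm (v h) * (euclid_norm (k - h) * norm (w (k - h))))) summable_on UNIV"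
        by (intro summable_on_cmult_right convolution(1) sv sw) auto
      fix h
      have "?e k \<le> ?e h * ?e (k - h)"
        using euclid_norm_add_le[of h "k - h"] s mult_left_mono[of "euclid_norm k" "euclid_norm h + euclid_norm (k - h)" s]
        by (simp add: distrib_left flip: exp_add)
      then have "?e k * (norm (v h) * (euclid_norm (k - h) * norm (w (k - h))))
          \<le> (?e h * ?e (k - h)) * (norm (v h) * (euclid_norm (k - h) * norm (w (k - h))))"
        by (intro mult_right_mono) auto
      then show "?e k * (norm (v h) * (euclid_norm (k - h) * norm (w (k - h)))) \<le> ?a h * ?b (k - h)"
        by (simp add: mult_ac)
    qed auto
    finally show ?thesis .
  qed
  have cs: "(\<lambda>k. 2 * (\<Sum>\<^sub>\<infinity>h. ?a h * ?b (k - h))) summable_on UNIV"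
    using has_sum_imp_summable[OF conv(2)] by (rule summable_on_cmult_right)
  have ps: "(\<lambda>k. ?e k * norm (euler_P v w k)) summable_on UNIV"
    by (rule summable_on_comparison_test[OF cs le]) auto
  then show "euler_P v w \<in> espace s" by (simp add: espace_def)
  have "enorm s (euler_P v w) \<le> 2 * (infsum ?a UNIV * infsum ?b UNIV)"
    using infsum_mono[OF ps cs le] infsumI[OF conv(2)] by (simp add: enorm_def infsum_cmult_right')
  with B show "enorm s (euler_P v w) \<le> 2 / (s' - s) * enorm s v * enorm s' w"
    by (simp add: mult_ac)
qed

lemma euler_P_A_space:
  assumes v: "v \<in> A_space" and w: "w \<in> A_space"
  shows "euler_P v w \<in> A_space"
proof -
  obtain \<sigma> C where dv: "0 < \<sigma>" "exp_decay \<sigma> C v" using A_spaceE[OF v] .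
  obtain \<sigma>' C' where dw: "0 < \<sigma>'" "exp_decay \<sigma>' C' w" using A_spaceE[OF w] .
  define s' where "s' = min \<sigma> \<sigma>' / 2"
  define s where "s = s' / 2"
  have s: "0 < s" "s < s'" "s < \<sigma>" "s' < \<sigma>'" using dv dw by (auto simp: s_def s'_def)
  have ve: "v \<in> espace s" using exp_decay_espace(1)[OF dv(2) s(3)] .
  have we: "w \<in> espace s'" using exp_decay_espace(1)[OF dw(2) s(4)] .
  have d: "exp_decay s (enorm s (euler_P v w)) (euler_P v w)"
    using s by (intro espace_exp_decay enorm_euler_P_le(1)[OF ve we]) auto
  note sv = solenoidalD[OF A_space_solenoidal[OF v]] and sw = solenoidalD[OF A_space_solenoidal[OF w]]
  have ts: "euler_term v w k summable_on UNIV" for k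
    using wspace_summable_norm(1)[OF A_space_wspace[OF v, of 1]]
      wspace_summable_deriv(1)[OF A_space_wspace[OF w, of 1]]
    by (intro euler_term_summable(2)) auto
  have "euler_P v w \<in> solenoidal"
  proof (rule solenoidalI[OF d s(1)])
    have "euler_term v w 0 h = 0" for h
      using sv(2)[of h] by (simp add: euler_term_def cvec_minus cdot.minus_right cdot_commute)
    then show "euler_P v w 0 = 0" by (simp add: euler_P_eq)
    show "cdot (cvec k) (euler_P v w k) = 0" for k
    proof (cases "k = 0")
      case False
      have "cdot (cvec k) (\<Sum>\<^sub>\<infinity>h. euler_term v w k h) = (\<Sum>\<^sub>\<infinity>h. cdot (cvec k) (euler_term v w k h))"
        by (rule infsumI[symmetric], rule has_sum_bounded_linear[OF cdot.bounded_linear_right])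
          (rule has_sum_infsum[OF ts])
      also have "\<dots> = 0"
        using False by (simp add: euler_term_def cdot_cmult_right cdot_Leray)
      finally show ?thesis unfolding euler_P_eq cdot_cmult_right by simp
    qed (simp add: cdot.zero_left)
    show "euler_P v w (- k) = vcnj (euler_P v w k)" for k
    proof -
      \<comment> \<open>The sign comes from the wave vector k - h; conjugating the prefactor - \<i>
        supplies a second one.\<close>
      have t: "euler_term v w (- k) (- h) = - vcnj (euler_term v w k h)" for h
      proof -
        have "- k - - h = - (k - h)" by simp
        then show ?thesis
          by (simp only: euler_term_def sv(3) sw(3) cvec_minus Leray_uminus_vcnj vcnj_cmult cnj_cdot
              cdot.minus_right cmult.minus_left vcnj_cvec)
      qed
      have "(\<Sum>\<^sub>\<infinity>h. euler_term v w (- k) h) = (\<Sum>\<^sub>\<infinity>h. euler_term v w (- k) (- h))"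
        by (rule infsum_reindex_bij_witness[where i = uminus and j = uminus]) auto
      also have "\<dots> = - (\<Sum>\<^sub>\<infinity>h. vcnj (euler_term v w k h))"
        by (simp add: t infsum_uminus)
      also have "(\<Sum>\<^sub>\<infinity>h. vcnj (euler_term v w k h)) = vcnj (\<Sum>\<^sub>\<infinity>h. euler_term v w k h)"
        by (rule infsumI, rule has_sum_bounded_linear[OF bounded_linear_vcnj])
          (rule has_sum_infsum[OF ts])
      finally show ?thesis
        unfolding euler_P_eq vcnj_cmult by (simp add: cmult.minus_left cmult.minus_right)
    qed
  qed
  then show ?thesis by (rule A_spaceI[OF _ d s(1)])
qed

lemma euler_coeff_0 [simp]: "euler_coeff v 0 = v"
  by (simp add: euler_coeff.simps)

lemma euler_coeff_Suc:
  "euler_coeff v (Suc j) = (\<lambda>k. (1 / real (Suc j)) *\<^sub>R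
    (\<Sum>l\<le>j. euler_P (euler_coeff v l) (euler_coeff v (j - l)) k))"
  by (subst euler_coeff.simps) (simp add: lessThan_Suc_atMost)

lemma euler_coeff_A_space:
  assumes "v \<in> A_space"
  shows "euler_coeff v j \<in> A_space"
proof (induction j rule: less_induct)
  case (less j)
  show ?case
  proof (cases j)
    case (Suc i)
    then show ?thesis
      using less by (auto simp: euler_coeff_Suc intro!: A_space_scaleR A_space_sum euler_P_A_space)
  qed (simp add: assms)
qed

subsection \<open>The Cauchy--Kovalevskaya estimate\<close>

text \<open>Majorant of the Taylor coefficients in time. At order j, \<open>ck_step\<close> costs 6
  (m + 2) with m + 2 \<le> 2 j, and the factor 1 / j of the recursion removes the j, which leaves
  12. The generating function solves y = c + 12 x y^2.\<close>

fun ck_coeff :: "real \<Rightarrow> nat \<Rightarrow> real"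
  where "ck_coeff c j = (if j = 0 then c else 12 * (\<Sum>l<j. ck_coeff c l * ck_coeff c (j - l - 1)))"

declare ck_coeff.simps [simp del]

lemma ck_coeff_0: "ck_coeff c 0 = c"
  by (simp add: ck_coeff.simps)

lemma ck_coeff_Suc: "ck_coeff c (Suc j) = 12 * (\<Sum>l\<le>j. ck_coeff c l * ck_coeff c (j - l))"
  by (subst ck_coeff.simps) (simp add: lessThan_Suc_atMost)

lemma ck_coeff_nonneg:
  assumes "0 \<le> c"
  shows "0 \<le> ck_coeff c j"
proof (induction j rule: less_induct)
  case (less j)
  then show ?case
    using assms by (cases j) (auto simp: ck_coeff_0 ck_coeff_Suc intro!: sum_nonneg mult_nonneg_nonneg)
qed

text \<open>The partial sums \<open>y N\<close> of the majorant series at \<open>x = 1 / (48 c)\<close> satisfy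
  \<open>y (N + 1) \<le> c + 12 x (y N)\<^sup>2\<close>, whence \<open>y N \<le> 2 c\<close>.\<close>

lemma ck_coeff_le:
  assumes "0 < c"
  shows "ck_coeff c j \<le> 2 * c * (48 * c) ^ j"
proof -
  define x where "x = 1 / (48 * c)"
  have x: "0 < x" using assms by (simp add: x_def)
  define a where "a i = ck_coeff c i * x ^ i" for i
  have a0: "0 \<le> a i" for i using ck_coeff_nonneg[of c i] assms x by (simp add: a_def)
  have aS: "a (Suc i) = 12 * x * (\<Sum>l\<le>i. a l * a (i - l))" for i
  proof -
    have "x ^ i * (ck_coeff c l * ck_coeff c (i - l)) = a l * a (i - l)" if "l \<le> i" for l
      using that by (simp add: a_def flip: power_add)
    then have "x ^ i * (\<Sum>l\<le>i. ck_coeff c l * ck_coeff c (i - l)) = (\<Sum>l\<le>i. a l * a (i - l))"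
      unfolding sum_distrib_left by (intro sum.cong refl) auto
    then show ?thesis by (simp add: a_def ck_coeff_Suc mult_ac)
  qed
  have "(\<Sum>i\<le>N. a i) \<le> 2 * c" for N
  proof (induction N)
    case 0
    then show ?case using assms by (simp add: a_def ck_coeff_0)
  next
    case (Suc N)
    have "(\<Sum>i\<le>N. \<Sum>l\<le>i. a l * a (i - l)) \<le> (\<Sum>i\<le>N. a i) * (\<Sum>i\<le>N. a i)"
    proof -
      have "(\<Sum>i\<le>N. \<Sum>l\<le>i. a l * a (i - l)) = (\<Sum>(i, l)\<in>(SIGMA i:{..N}. {..i}). a l * a (i - l))"
        by (simp add: sum.Sigma)
      also have "\<dots> = (\<Sum>(p, q)\<in>(\<lambda>(i, l). (l, i - l)) ` (SIGMA i:{..N}. {..i}). a p * a q)"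
        by (subst sum.reindex) (auto simp: inj_on_def case_prod_unfold)
      also have "\<dots> \<le> (\<Sum>(p, q)\<in>{..N} \<times> {..N}. a p * a q)"
        by (intro sum_mono2) (auto intro: mult_nonneg_nonneg a0)
      also have "\<dots> = (\<Sum>i\<le>N. a i) * (\<Sum>i\<le>N. a i)"
        by (simp add: sum_product sum.cartesian_product)
      finally show ?thesis .
    qed
    also have "\<dots> \<le> (2 * c) * (2 * c)"
      using Suc a0 assms by (intro mult_mono sum_nonneg) auto
    finally have *: "(\<Sum>i\<le>N. \<Sum>l\<le>i. a l * a (i - l)) \<le> 4 * c\<^sup>2" by (simp add: power2_eq_square)
    have "(\<Sum>i\<le>Suc N. a i) = a 0 + (\<Sum>i\<le>N. a (Suc i))"
      by (rule sum.atMost_Suc_shift)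
    also have "\<dots> = c + 12 * x * (\<Sum>i\<le>N. \<Sum>l\<le>i. a l * a (i - l))"
      by (simp add: aS sum_distrib_left a_def[of 0] ck_coeff_0)
    also have "\<dots> \<le> c + 12 * x * (4 * c\<^sup>2)"
      using * x by (intro add_left_mono mult_left_mono) auto
    also have "\<dots> = 2 * c"
      using assms by (simp add: x_def power2_eq_square)
    finally show ?case .
  qed
  then have "a j \<le> 2 * c"
    using member_le_sum[of j "{..j}" a] a0 by (meson atMost_iff finite_atMost order_refl order_trans)
  then show ?thesis
    using assms by (simp add: a_def x_def power_divide field_simps)
qed

text \<open>Compares the powers of the two widths in \<open>ck_step\<close>: the base is 1 + 1 / (m
  + 1) \<le> exp(1 / (m + 1)), so the power stays below exp 1 uniformly in m.\<close>

lemma one_plus_inverse_power_le: "((real m + 2) / (real m + 1)) ^ m \<le> 3"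
proof -
  have "(real m + 2) / (real m + 1) \<le> exp (1 / (real m + 1))"
    using exp_ge_add_one_self[of "1 / (real m + 1)"] by (simp add: field_simps)
  then have "((real m + 2) / (real m + 1)) ^ m \<le> exp (1 / (real m + 1)) ^ m"
    by (intro power_mono) auto
  also have "\<dots> = exp (real m / (real m + 1))"
    by (simp flip: exp_of_nat_mult)
  also have "\<dots> \<le> exp 1" by simp
  also have "\<dots> \<le> 3" by (rule exp_le)
  finally show ?thesis .
qed

text \<open>The loss of the width \<open>d\<close> in one derivative is distributed so that \<open>w\<close>, the factor with \<open>m\<close>
  earlier losses, is used at the width \<open>d (m + 1) / (m + 2)\<close>.\<close>

lemma ck_step:
  assumes v: "\<And>d. 0 < d \<Longrightarrow> d \<le> \<rho> \<Longrightarrow> v \<in> espace (\<rho> - d) \<and> enorm (\<rho> - d) v \<le> a / d ^ l"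
    and w: "\<And>d. 0 < d \<Longrightarrow> d \<le> \<rho> \<Longrightarrow> w \<in> espace (\<rho> - d) \<and> enorm (\<rho> - d) w \<le> b / d ^ m"
    and d: "0 < d" "d \<le> \<rho>" and ab: "0 \<le> a" "0 \<le> b"
  shows "euler_P v w \<in> espace (\<rho> - d)"
    and "enorm (\<rho> - d) (euler_P v w) \<le> 6 * (real m + 2) * (a * b) / d ^ Suc (l + m)"
proof -
  define d' where "d' = d * ((real m + 1) / (real m + 2))"
  have q: "0 < (real m + 1) / (real m + 2)" "(real m + 1) / (real m + 2) < 1" by (auto simp: field_simps)
  have d': "0 < d'" "d' < d" using mult_strict_left_mono[OF q(2) d(1)] q d by (auto simp: d'_def)
  have dd: "d - d' = d / (real m + 2)" by (simp add: d'_def field_simps)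
  have ww: "w \<in> espace (\<rho> - d')" "enorm (\<rho> - d') w \<le> b / d' ^ m" using w[of d'] d' d by auto
  have vv: "v \<in> espace (\<rho> - d)" "enorm (\<rho> - d) v \<le> a / d ^ l" using v d by auto
  note P = enorm_euler_P_le[OF vv(1) ww(1)]
  show "euler_P v w \<in> espace (\<rho> - d)" using P(1) d d' by auto
  have "b / d' ^ m = b / d ^ m * ((real m + 2) / (real m + 1)) ^ m"
    by (simp add: d'_def power_mult_distrib power_divide)
  also have "\<dots> \<le> b / d ^ m * 3"
    using ab d by (intro mult_left_mono one_plus_inverse_power_le) auto
  finally have w3: "enorm (\<rho> - d') w \<le> 3 * b / d ^ m" using ww(2) by (simp add: mult.commute)
  have "enorm (\<rho> - d) (euler_P v w) \<le> 2 / (d - d') * enorm (\<rho> - d) v * enorm (\<rho> - d') w"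
    using P(2) d d' by (simp add: algebra_simps)
  also have "\<dots> \<le> 2 / (d - d') * (a / d ^ l) * (3 * b / d ^ m)"
    using d d' ab by (intro mult_mono w3 vv order_refl enorm_nonneg mult_nonneg_nonneg) auto
  also have "\<dots> = 6 * (real m + 2) * (a * b) / d ^ Suc (l + m)"
    unfolding dd by (simp add: power_add field_simps)
  finally show "enorm (\<rho> - d) (euler_P v w) \<le> 6 * (real m + 2) * (a * b) / d ^ Suc (l + m)" .
qed

lemma euler_coeff_enorm_le:
  assumes v: "v \<in> espace \<rho>" "enorm \<rho> v \<le> c" and c: "0 \<le> c" and d: "0 < d" "d \<le> \<rho>"
  shows "euler_coeff v j \<in> espace (\<rho> - d) \<and> enorm (\<rho> - d) (euler_coeff v j) \<le> ck_coeff c j / d ^ j"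
  using d
\<comment> \<open>The loss \<open>d\<close> must stay arbitrary: \<open>ck_step\<close> uses the
  second factor at a smaller loss than the one aimed at.\<close>
proof (induction j arbitrary: d rule: less_induct)
  case (less j)
  show ?case
  proof (cases j)
    case 0
    then show ?thesis
      using espace_mono[OF v(1), of "\<rho> - d"] v less.prems by (simp add: ck_coeff_0)
  next
    case (Suc i)
    let ?u = "euler_coeff v" and ?C = "ck_coeff c"
    have step: "euler_P (?u l) (?u (i - l)) \<in> espace (\<rho> - d) \<and>
        enorm (\<rho> - d) (euler_P (?u l) (?u (i - l))) \<le> 12 * real j * (?C l * ?C (i - l)) / d ^ j"
      if l: "l \<le> i" for l
    proof -
      note P = ck_step[of \<rho> "?u l" "?C l" l "?u (i - l)" "?C (i - l)" "i - l" d]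
      have 1: "euler_P (?u l) (?u (i - l)) \<in> espace (\<rho> - d)"
        by (rule P(1)) (use less l Suc c in \<open>auto intro: ck_coeff_nonneg\<close>)
      have "enorm (\<rho> - d) (euler_P (?u l) (?u (i - l)))
          \<le> 6 * (real (i - l) + 2) * (?C l * ?C (i - l)) / d ^ Suc (l + (i - l))"
        by (rule P(2)) (use less l Suc c in \<open>auto intro: ck_coeff_nonneg\<close>)
      also have "\<dots> \<le> 6 * (2 * real j) * (?C l * ?C (i - l)) / d ^ Suc (l + (i - l))"
        using less.prems Suc c l
        by (intro divide_right_mono mult_right_mono mult_left_mono mult_nonneg_nonneg ck_coeff_nonneg) auto
      finally show ?thesis using 1 l Suc by simp
    qed
    have S: "(\<lambda>k. \<Sum>l\<le>i. euler_P (?u l) (?u (i - l)) k) \<in> espace (\<rho> - d)"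
      "enorm (\<rho> - d) (\<lambda>k. \<Sum>l\<le>i. euler_P (?u l) (?u (i - l)) k)
        \<le> (\<Sum>l\<le>i. enorm (\<rho> - d) (euler_P (?u l) (?u (i - l))))"
      using espace_sum[of "{..i}" "\<lambda>l. euler_P (?u l) (?u (i - l))" "\<rho> - d"] step by auto
    have "(\<Sum>l\<le>i. enorm (\<rho> - d) (euler_P (?u l) (?u (i - l))))
        \<le> (\<Sum>l\<le>i. 12 * real j * (?C l * ?C (i - l)) / d ^ j)"
      using step by (intro sum_mono) auto
    also have "\<dots> = real j * (?C j / d ^ j)"
      by (simp add: Suc ck_coeff_Suc sum_distrib_left sum_divide_distrib algebra_simps)
    finally have "(1 / real j) * enorm (\<rho> - d) (\<lambda>k. \<Sum>l\<le>i. euler_P (?u l) (?u (i - l)) k) \<le> ?C j / d ^ j"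
      using S(2) Suc by (simp add: field_simps del: of_nat_Suc)
    then show ?thesis
      using espace_scaleR[OF S(1), of "1 / real j"] by (simp add: Suc euler_coeff_Suc del: of_nat_Suc)
  qed
qed

text \<open>Half of the width is given away once, d = \<rho> / 2, which turns the growth rate 48 c /
  d of the majorant into 96 c / \<rho>.\<close>

lemma euler_coeff_decay:
  assumes v: "v \<in> espace \<rho>" "enorm \<rho> v \<le> c" and c: "0 < c" and \<rho>: "0 < \<rho>"
  shows "exp_decay (\<rho> / 2) (2 * c * (96 * c / \<rho>) ^ j) (euler_coeff v j)"
proof -
  have "euler_coeff v j \<in> espace (\<rho> - \<rho> / 2)"
    "enorm (\<rho> - \<rho> / 2) (euler_coeff v j) \<le> ck_coeff c j / (\<rho> / 2) ^ j"
    using euler_coeff_enorm_le[OF v, of "\<rho> / 2" j] c \<rho> by auto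
  then have "exp_decay (\<rho> / 2) (ck_coeff c j / (\<rho> / 2) ^ j) (euler_coeff v j)"
    using exp_decay_mono[OF espace_exp_decay] by fastforce
  moreover have "ck_coeff c j / (\<rho> / 2) ^ j \<le> 2 * c * (48 * c) ^ j / (\<rho> / 2) ^ j"
    using ck_coeff_le[OF c, of j] \<rho> by (intro divide_right_mono) auto
  moreover have "2 * c * (48 * c) ^ j / (\<rho> / 2) ^ j = 2 * c * (96 * c / \<rho>) ^ j"
  proof -
    have "(48 * c) ^ j / (\<rho> / 2) ^ j = (96 * c / \<rho>) ^ j"
      unfolding power_divide[symmetric] by simp
    then show ?thesis by (simp only: times_divide_eq_right[symmetric])
  qed
  ultimately show ?thesis by (auto intro: exp_decay_mono)
qed

subsection \<open>Power series of a real variable\<close>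

text \<open>If \<open>c m\<close> is the first nonzero coefficient, the sum is s^m g(s) with g(s)
  \<rightarrow> c m as s \<rightarrow> 0, so it has no zeros s \<noteq> 0 near 0.\<close>

lemma powser_accumulating_zeros:
  fixes c :: "nat \<Rightarrow> complex"
  assumes \<delta>: "0 < \<delta>" and f: "\<And>s::real. \<bar>s\<bar> < \<delta> \<Longrightarrow> (\<lambda>j. c j * of_real s ^ j) sums f s"
    and zeros: "\<And>\<epsilon>. 0 < \<epsilon> \<Longrightarrow> \<exists>s. s \<noteq> 0 \<and> \<bar>s\<bar> < \<epsilon> \<and> f s = 0"
  shows "c j = 0"
proof (rule ccontr)
  assume "c j \<noteq> 0"
  define m where "m = (LEAST j. c j \<noteq> 0)"
  have m: "c m \<noteq> 0" unfolding m_def by (rule LeastI) fact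
  have less: "c i = 0" if "i < m" for i using that not_less_Least unfolding m_def by blast
  define g where "g z = (\<Sum>j. c (j + m) * z ^ j)" for z
  have sum_c: "summable (\<lambda>j. c j * z ^ j)" if z: "norm z < \<delta>" for z
  proof -
    obtain r where r: "norm z < r" "r < \<delta>" using dense[OF z] by blast
    have r0: "0 < r" by (rule le_less_trans[OF norm_ge_zero r(1)])
    then have "summable (\<lambda>j. c j * of_real r ^ j)" using f[of r] r by (auto dest: sums_summable)
    then show ?thesis by (rule powser_inside) (use r r0 in auto)
  qed
  have g: "(\<lambda>j. c (j + m) * z ^ j) sums g z" if z: "norm z < \<delta>" for z
  proof (cases "z = 0")
    case True
    have "summable (\<lambda>j. c (j + m) * 0 ^ j)"
      by (rule summable_finite[of "{0}"]) (auto simp: power_0_left)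
    then show ?thesis unfolding g_def True by (rule summable_sums)
  next
    case False
    have "summable (\<lambda>j. c (j + m) * z ^ (j + m))"
      using sum_c[OF z] by (rule summable_ignore_initial_segment)
    then have "summable (\<lambda>j. z ^ m * (c (j + m) * z ^ j))" by (simp add: power_add mult_ac)
    then have "summable (\<lambda>j. c (j + m) * z ^ j)" using False by (simp add: summable_cmult_iff)
    then show ?thesis unfolding g_def by (rule summable_sums)
  qed
  have "(g \<longlongrightarrow> c (0 + m)) (at 0)"
    by (rule powser_limit_0[OF \<delta> g])
  then have "\<forall>\<^sub>F z in at 0. g z \<noteq> 0"
    using m by (intro tendsto_imp_eventually_ne) auto
  then obtain \<epsilon> where \<epsilon>: "0 < \<epsilon>" "\<And>z. z \<noteq> 0 \<Longrightarrow> norm z < \<epsilon> \<Longrightarrow> g z \<noteq> 0"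
    by (auto simp: eventually_at)
  obtain s where s: "s \<noteq> 0" "\<bar>s\<bar> < min \<epsilon> \<delta>" "f s = 0" using zeros[of "min \<epsilon> \<delta>"] \<epsilon> \<delta> by auto
  have "(\<lambda>j. of_real s ^ m * (c (j + m) * of_real s ^ j)) sums (of_real s ^ m * g (of_real s))"
    using s by (intro sums_mult g) auto
  then have "(\<lambda>j. c (j + m) * of_real s ^ (j + m)) sums (of_real s ^ m * g (of_real s))"
    by (simp add: power_add mult_ac)
  then have "(\<lambda>j. c j * of_real s ^ j) sums (of_real s ^ m * g (of_real s))"
    by (subst (asm) sums_iff_shift) (simp add: less)
  with f[of s] s have "of_real s ^ m * g (of_real s) = 0"
    by (metis min_less_iff_conj sums_unique2)
  then show False using \<epsilon>(2)[of "of_real s"] s by simp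
qed

lemma powser_unique_real:
  fixes c d :: "nat \<Rightarrow> complex"
  assumes \<delta>: "0 < \<delta>" and c: "\<And>s::real. \<bar>s\<bar> < \<delta> \<Longrightarrow> (\<lambda>j. c j * of_real s ^ j) sums f s"
    and d: "\<And>s::real. \<bar>s\<bar> < \<delta> \<Longrightarrow> (\<lambda>j. d j * of_real s ^ j) sums f s"
  shows "c j = d j"
proof -
  have "(\<lambda>j. (c j - d j) * of_real s ^ j) sums 0" if "\<bar>s\<bar> < \<delta>" for s :: real
    using sums_diff[OF c[OF that] d[OF that]] by (simp add: left_diff_distrib)
  then have "c j - d j = 0"
  proof (rule powser_accumulating_zeros[OF \<delta>])
    show "\<exists>s. s \<noteq> 0 \<and> \<bar>s\<bar> < \<epsilon> \<and> (0::complex) = 0" if "0 < \<epsilon>" for \<epsilon> :: real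
      using that by (intro exI[of _ "\<epsilon> / 2"]) auto
  qed
  then show ?thesis by simp
qed

definition analytic_at :: "(real \<Rightarrow> complex) \<Rightarrow> real \<Rightarrow> bool"
  where "analytic_at f t \<longleftrightarrow>
    (\<exists>\<delta>>0. \<exists>c. \<forall>s. \<bar>s\<bar> < \<delta> \<longrightarrow> (\<lambda>j. c j * of_real s ^ j) sums f (t + s))"

lemma analytic_at_diff:
  assumes "analytic_at f t" "analytic_at g t"
  shows "analytic_at (\<lambda>t. f t - g t) t"
proof -
  from assms obtain \<delta> c \<delta>' d where "0 < \<delta>" "0 < \<delta>'"
    and "\<And>s. \<bar>s\<bar> < \<delta> \<Longrightarrow> (\<lambda>j. c j * of_real s ^ j) sums f (t + s)"
    and "\<And>s. \<bar>s\<bar> < \<delta>' \<Longrightarrow> (\<lambda>j. d j * of_real s ^ j) sums g (t + s)"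
    unfolding analytic_at_def by blast
  then have "0 < min \<delta> \<delta>' \<and>
      (\<forall>s. \<bar>s\<bar> < min \<delta> \<delta>' \<longrightarrow> (\<lambda>j. (c j - d j) * of_real s ^ j) sums (f (t + s) - g (t + s)))"
    by (auto simp: left_diff_distrib intro: sums_diff)
  then show ?thesis
    unfolding analytic_at_def by (intro exI[of _ "min \<delta> \<delta>'"] exI[of _ "\<lambda>j. c j - d j"]) auto
qed

text \<open>The set of points around which f - g vanishes identically is open. It is closed in
  \<open>I\<close>, because at a limit point of it the zeros accumulate and force every Taylor
  coefficient to be 0.\<close>

lemma identity_theorem_real:
  assumes I: "open I" "connected I" and t1: "t1 \<in> I"
    and f: "\<And>t. t \<in> I \<Longrightarrow> analytic_at f t" and g: "\<And>t. t \<in> I \<Longrightarrow> analytic_at g t"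
    and \<epsilon>: "0 < \<epsilon>" "\<And>s. \<bar>s\<bar> < \<epsilon> \<Longrightarrow> f (t1 + s) = g (t1 + s)"
    and t: "t \<in> I"
  shows "f t = g t"
proof -
  define h where "h t = f t - g t" for t
  have h: "analytic_at h t" if "t \<in> I" for t
    unfolding h_def by (intro analytic_at_diff f g that)
  define Z where "Z = {t \<in> I. \<exists>\<epsilon>>0. \<forall>s. \<bar>s - t\<bar> < \<epsilon> \<longrightarrow> h s = 0}"
  have "t1 \<in> Z"
    using \<epsilon>(2)[of "_ - t1"] \<epsilon>(1) t1 by (auto simp: Z_def h_def intro!: exI[of _ \<epsilon>])
  have "open Z"
    unfolding open_dist
  proof
    fix x assume x: "x \<in> Z"
    then obtain \<epsilon> where e: "0 < \<epsilon>" "\<And>s. \<bar>s - x\<bar> < \<epsilon> \<Longrightarrow> h s = 0" by (auto simp: Z_def)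
    obtain \<epsilon>' where e': "0 < \<epsilon>'" "\<And>y. dist y x < \<epsilon>' \<Longrightarrow> y \<in> I"
      using I(1) x unfolding open_dist Z_def by blast
    have "y \<in> Z" if y: "dist y x < min \<epsilon> \<epsilon>'" for y
    proof -
      have "h s = 0" if "\<bar>s - y\<bar> < \<epsilon> - dist y x" for s
        using that by (intro e) (auto simp: dist_real_def)
      then show ?thesis using y e' by (auto simp: Z_def intro!: exI[of _ "\<epsilon> - dist y x"])
    qed
    then show "\<exists>e>0. \<forall>y. dist y x < e \<longrightarrow> y \<in> Z" using e e' by (intro exI[of _ "min \<epsilon> \<epsilon>'"]) auto
  qed
  moreover have "x \<in> Z" if x: "x \<in> I" "x islimpt Z" for x
  proof -
    obtain \<delta> c where \<delta>: "0 < \<delta>" and c: "\<And>s. \<bar>s\<bar> < \<delta> \<Longrightarrow> (\<lambda>j. c j * of_real s ^ j) sums h (x + s)"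
      using h[OF x(1)] unfolding analytic_at_def by blast
    have "c j = 0" for j
    proof (rule powser_accumulating_zeros[OF \<delta> c])
      fix \<epsilon> :: real assume "0 < \<epsilon>"
      then obtain y where y: "y \<in> Z" "y \<noteq> x" "dist y x < \<epsilon>" using x(2) unfolding islimpt_approachable by blast
      then have "h y = 0" by (auto simp: Z_def)
      then show "\<exists>s. s \<noteq> 0 \<and> \<bar>s\<bar> < \<epsilon> \<and> h (x + s) = 0"
        using y by (intro exI[of _ "y - x"]) (auto simp: dist_real_def)
    qed auto
    then have "h (x + s) = 0" if "\<bar>s\<bar> < \<delta>" for s
      using sums_unique2[OF c[OF that]] \<open>\<And>j. c j = 0\<close> by simp
    from this[of "_ - x"] show ?thesis using x \<delta> by (auto simp: Z_def intro!: exI[of _ \<delta>])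
  qed
  then have "closedin (top_of_set I) Z"
    by (auto simp: closedin_limpt Z_def)
  moreover have "Z \<subseteq> I" by (auto simp: Z_def)
  ultimately have "openin (top_of_set I) Z" "closedin (top_of_set I) Z"
    by (simp_all add: openin_open_eq[OF I(1)])
  with I(2) \<open>t1 \<in> Z\<close> have "Z = I" unfolding connected_clopen by blast
  then show ?thesis using t by (force simp: Z_def h_def)
qed

section \<open>Geometric tails and re-expansion about another point\<close>

lemma geometric_sum_tail:
  fixes f :: "nat \<Rightarrow> 'a::banach"
  assumes le: "\<And>i. norm (f i) \<le> M * q ^ i" and q: "0 \<le> q" "q < 1" and f: "f sums S"
  shows "norm ((\<Sum>i<N. f i) - S) \<le> M * q ^ N / (1 - q)"
proof -
  have "(\<lambda>i. f (i + N)) sums (S - (\<Sum>i<N. f i))"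
    using f by (simp add: sums_iff_shift)
  moreover have "(\<lambda>i. M * q ^ N * q ^ i) sums (M * q ^ N * (1 / (1 - q)))"
    using q by (intro sums_mult geometric_sums) simp
  ultimately have "norm (S - (\<Sum>i<N. f i)) \<le> M * q ^ N * (1 / (1 - q))"
    by (rule norm_sums_le) (use le[of "_ + N"] in \<open>simp add: power_add mult_ac\<close>)
  then show ?thesis by (simp add: norm_minus_commute)
qed

text \<open>Expanding (t + s)^m binomially gives a double series dominated by a geometric one, since
  |t| + |s| \<le> \<delta> - \<epsilon>; summed by powers of \<open>s\<close> instead of by
  \<open>m\<close> it is the expansion about t. As \<epsilon> is half the distance from |t| to
  \<delta>, the domination holds up to |s| = \<epsilon>.\<close>

lemma powser_reexpand:
  fixes c :: "nat \<Rightarrow> 'a::banach"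
  assumes c: "\<And>j. norm (c j) \<le> M * (1 / \<delta>) ^ j" and t: "\<bar>t\<bar> < \<delta>"
    and \<epsilon>: "\<epsilon> = (\<delta> - \<bar>t\<bar>) / 2"
    and b: "\<And>i. b i = (\<Sum>j. (real ((i + j) choose i) * t ^ j) *\<^sub>R c (i + j))"
  shows "(\<lambda>j. (real ((i + j) choose i) * t ^ j) *\<^sub>R c (i + j)) sums b i"
    and "norm (b i) \<le> M * (\<delta> / \<epsilon>) * (1 / \<epsilon>) ^ i"
    and "\<bar>s\<bar> < \<epsilon> \<Longrightarrow> (\<lambda>i. s ^ i *\<^sub>R b i) sums (\<Sum>m. (t + s) ^ m *\<^sub>R c m)"
proof -
  have M0: "0 \<le> M" using c[of 0] by (auto intro: order_trans[OF norm_ge_zero])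
  have \<delta>: "0 < \<delta>" "0 < \<epsilon>" using t by (auto simp: \<epsilon>)
  \<comment> \<open>\<open>X\<close> and \<open>Y\<close> hold the same terms: row \<open>m\<close>
    of \<open>X\<close> sums to (t + s)^m c_m, and row \<open>i\<close> of \<open>Y\<close> to s^i
    b_i.\<close>
  define X where "X s m i = (real (m choose i) * t ^ (m - i) * s ^ i) *\<^sub>R c m" for s m i
  define Y where "Y s i j = s ^ i *\<^sub>R ((real ((i + j) choose i) * t ^ j) *\<^sub>R c (i + j))" for s i j
  have bij: "bij_betw (\<lambda>(m, i). (i, m - i)) (SIGMA m:UNIV. {..m}) (UNIV \<times> (UNIV :: nat set))"
    by (rule bij_betwI[where g = "\<lambda>(i, j). (i + j, i)"]) auto
  have XY: "((\<lambda>(m, i). norm (X s m i)) has_sum S) (SIGMA m:UNIV. {..m}) \<longleftrightarrow>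
      ((\<lambda>(i, j). norm (Y s i j)) has_sum S) (UNIV \<times> UNIV)" for s S
    by (subst has_sum_reindex_bij_betw[OF bij, symmetric], rule has_sum_cong)
      (auto simp: X_def Y_def mult.commute)
  have XY': "((\<lambda>(m, i). X s m i) has_sum S) (SIGMA m:UNIV. {..m}) \<longleftrightarrow>
      ((\<lambda>(i, j). Y s i j) has_sum S) (UNIV \<times> UNIV)" for s S
    by (subst has_sum_reindex_bij_betw[OF bij, symmetric], rule has_sum_cong)
      (auto simp: X_def Y_def mult.commute)
  have sumX: "(\<Sum>i\<le>m. X s m i) = (t + s) ^ m *\<^sub>R c m" for s m
    unfolding X_def scaleR_sum_left[symmetric] by (simp add: binomial_ring add.commute[of t] mult_ac)
  have sumN: "(\<Sum>i\<le>m. norm (X s m i)) = (\<bar>t\<bar> + \<bar>s\<bar>) ^ m * norm (c m)" for s m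
    unfolding X_def norm_scaleR sum_distrib_right[symmetric]
    by (simp add: binomial_ring add.commute[of "\<bar>t\<bar>"] abs_mult power_abs mult_ac)
  have q: "(\<bar>t\<bar> + \<bar>s\<bar>) / \<delta> \<le> 1 - \<epsilon> / \<delta>" if "\<bar>s\<bar> \<le> \<epsilon>" for s
  proof -
    have "\<bar>t\<bar> + \<bar>s\<bar> \<le> \<delta> - \<epsilon>" using that by (simp add: \<epsilon> field_simps)
    then have "(\<bar>t\<bar> + \<bar>s\<bar>) / \<delta> \<le> (\<delta> - \<epsilon>) / \<delta>" using \<delta> by (intro divide_right_mono) auto
    then show ?thesis using \<delta> by (simp add: diff_divide_distrib)
  qed
  have leN: "(\<bar>t\<bar> + \<bar>s\<bar>) ^ m * norm (c m) \<le> M * (1 - \<epsilon> / \<delta>) ^ m" if "\<bar>s\<bar> \<le> \<epsilon>" for s m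
  proof -
    have "(\<bar>t\<bar> + \<bar>s\<bar>) ^ m * norm (c m) \<le> (\<bar>t\<bar> + \<bar>s\<bar>) ^ m * (M * (1 / \<delta>) ^ m)"
      by (intro mult_left_mono c) auto
    also have "\<dots> = M * ((\<bar>t\<bar> + \<bar>s\<bar>) / \<delta>) ^ m" by (simp add: power_divide)
    also have "\<dots> \<le> M * (1 - \<epsilon> / \<delta>) ^ m"
      using \<delta> by (intro mult_left_mono power_mono q that M0) auto
    finally show ?thesis .
  qed
  have e1: "0 \<le> 1 - \<epsilon> / \<delta>" "1 - \<epsilon> / \<delta> < 1" using \<delta> t by (auto simp: \<epsilon> field_simps)
  have geo: "((\<lambda>m. M * (1 - \<epsilon> / \<delta>) ^ m) has_sum M * (\<delta> / \<epsilon>)) UNIV"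
  proof -
    have "(\<lambda>m. M * (1 - \<epsilon> / \<delta>) ^ m) sums (M * (1 / (1 - (1 - \<epsilon> / \<delta>))))"
      using e1 by (intro sums_mult geometric_sums) auto
    then show ?thesis using e1 M0 by (intro sums_nonneg_imp_has_sum) auto
  qed
  have absX: "(\<lambda>(m, i). norm (X s m i)) summable_on (SIGMA m:UNIV. {..m})"
    and boundX: "(\<Sum>\<^sub>\<infinity>(m, i)\<in>(SIGMA m:UNIV. {..m}). norm (X s m i)) \<le> M * (\<delta> / \<epsilon>)"
    if s: "\<bar>s\<bar> \<le> \<epsilon>" for s
  proof -
    have sm: "(\<lambda>m. (\<bar>t\<bar> + \<bar>s\<bar>) ^ m * norm (c m)) summable_on UNIV"
      by (rule summable_on_comparison_test[OF has_sum_imp_summable[OF geo] leN[OF s]]) auto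
    have in_row: "((\<lambda>i. case (m, i) of (m, i) \<Rightarrow> norm (X s m i)) has_sum (\<bar>t\<bar> + \<bar>s\<bar>) ^ m * norm (c m)) {..m}" for m
      using sumN[of s m] by (auto intro: has_sum_finiteI)
    show *: "(\<lambda>(m, i). norm (X s m i)) summable_on (SIGMA m:UNIV. {..m})"
      by (rule summable_on_SigmaI[OF in_row sm]) auto
    have "((\<lambda>m. (\<bar>t\<bar> + \<bar>s\<bar>) ^ m * norm (c m)) has_sum
        (\<Sum>\<^sub>\<infinity>(m, i)\<in>(SIGMA m:UNIV. {..m}). norm (X s m i))) UNIV"
      by (rule has_sum_SigmaD[OF has_sum_infsum[OF *] in_row])
    then show "(\<Sum>\<^sub>\<infinity>(m, i)\<in>(SIGMA m:UNIV. {..m}). norm (X s m i)) \<le> M * (\<delta> / \<epsilon>)"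
      by (rule has_sum_mono[OF _ geo]) (use leN[OF s] in auto)
  qed
  have absY: "((\<lambda>(i, j). norm (Y s i j)) has_sum
      (\<Sum>\<^sub>\<infinity>(m, i)\<in>(SIGMA m:UNIV. {..m}). norm (X s m i))) (UNIV \<times> UNIV)" if "\<bar>s\<bar> \<le> \<epsilon>" for s
    using has_sum_infsum[OF absX[OF that]] unfolding XY .
  have Yinv: "inverse (s ^ i) *\<^sub>R Y s i j = (real ((i + j) choose i) * t ^ j) *\<^sub>R c (i + j)"
    if "s \<noteq> 0" for s i j
    using that by (simp add: Y_def)
  have rowY: "(\<lambda>j. norm (Y s i j)) summable_on UNIV" if "\<bar>s\<bar> \<le> \<epsilon>" for s i
    using summable_on_SigmaD1[OF has_sum_imp_summable[OF absY[OF that]], of i] by simp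
  have rowY': "(Y s i has_sum s ^ i *\<^sub>R b i) UNIV" if s: "\<bar>s\<bar> \<le> \<epsilon>" "s \<noteq> 0" for s i
  proof -
    have "summable (\<lambda>j. norm (Y s i j))" using rowY[OF s(1)] by (rule summable_on_imp_summable)
    then have "summable (\<lambda>j. norm (inverse (s ^ i) *\<^sub>R Y s i j))"
      by (simp only: norm_scaleR) (rule summable_mult)
    then have "summable (\<lambda>j. (real ((i + j) choose i) * t ^ j) *\<^sub>R c (i + j))"
      unfolding Yinv[OF s(2)] by (rule summable_norm_cancel)
    then have "Y s i sums (s ^ i *\<^sub>R b i)"
      unfolding Y_def b by (intro sums_scaleR_right summable_sums)
    moreover have "Y s i summable_on UNIV"
      by (rule abs_summable_summable[OF rowY[OF s(1)]])
    ultimately show ?thesis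
      by (metis has_sum_imp_sums has_sum_infsum sums_unique2)
  qed
  \<comment> \<open>At s = 0 the rows of \<open>Y\<close> say little about \<open>b\<close>, so
    convergence is read off at s = \<epsilon>, where the double series is still absolutely
    summable.\<close>
  show sums_b: "(\<lambda>j. (real ((i + j) choose i) * t ^ j) *\<^sub>R c (i + j)) sums b i" for i
  proof -
    have "(\<lambda>j. inverse (\<epsilon> ^ i) *\<^sub>R Y \<epsilon> i j) sums (inverse (\<epsilon> ^ i) *\<^sub>R (\<epsilon> ^ i *\<^sub>R b i))"
      using \<delta> by (intro sums_scaleR_right has_sum_imp_sums rowY') auto
    then show ?thesis using \<delta> by (simp add: Yinv)
  qed
  show "norm (b i) \<le> M * (\<delta> / \<epsilon>) * (1 / \<epsilon>) ^ i"
  proof -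
    have e: "\<bar>\<epsilon>\<bar> \<le> \<epsilon>" using \<delta> by simp
    have "norm (\<epsilon> ^ i *\<^sub>R b i) \<le> (\<Sum>\<^sub>\<infinity>j. norm (Y \<epsilon> i j))"
      by (rule norm_infsum_le[OF rowY'[OF e] has_sum_infsum[OF rowY[OF e]]]) (use \<delta> in auto)
    also have "\<dots> \<le> (\<Sum>\<^sub>\<infinity>(m, i)\<in>(SIGMA m:UNIV. {..m}). norm (X \<epsilon> m i))"
    proof -
      have "((\<lambda>i. \<Sum>\<^sub>\<infinity>j. norm (Y \<epsilon> i j)) has_sum
          (\<Sum>\<^sub>\<infinity>(m, i)\<in>(SIGMA m:UNIV. {..m}). norm (X \<epsilon> m i))) UNIV"
        by (rule has_sum_SigmaD[OF absY[OF e]]) (simp add: has_sum_infsum rowY[OF e])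
      from finite_sum_le_has_sum[OF this, of "{i}"] show ?thesis by (simp add: infsum_nonneg)
    qed
    also have "\<dots> \<le> M * (\<delta> / \<epsilon>)" by (rule boundX[OF e])
    finally show ?thesis using \<delta> by (simp add: power_divide field_simps)
  qed
  show "(\<lambda>i. s ^ i *\<^sub>R b i) sums (\<Sum>m. (t + s) ^ m *\<^sub>R c m)" if s: "\<bar>s\<bar> < \<epsilon>"
  proof (cases "s = 0")
    case True
    have "(\<lambda>i. 0 ^ i *\<^sub>R b i) sums (0 ^ 0 *\<^sub>R b 0)"
      by (rule sums_finite[of "{0}", simplified]) (auto simp: power_0_left)
    then have "(\<lambda>i. 0 ^ i *\<^sub>R b i) sums b 0" by simp
    then show ?thesis using True b[of 0] by simp
  next
    case False
    have e: "\<bar>s\<bar> \<le> \<epsilon>" using s by simp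
    have sX: "(\<lambda>(m, i). X s m i) summable_on (SIGMA m:UNIV. {..m})"
      using absX[OF e] by (rule_tac abs_summable_summable) (simp add: case_prod_unfold)
    have S: "((\<lambda>(i, j). Y s i j) has_sum (\<Sum>\<^sub>\<infinity>(m, i)\<in>(SIGMA m:UNIV. {..m}). X s m i)) (UNIV \<times> UNIV)"
      using has_sum_infsum[OF sX] unfolding XY' .
    have "((\<lambda>m. (t + s) ^ m *\<^sub>R c m) has_sum (\<Sum>\<^sub>\<infinity>(m, i)\<in>(SIGMA m:UNIV. {..m}). X s m i)) UNIV"
      by (rule has_sum_SigmaD[OF has_sum_infsum[OF sX]]) (auto intro: has_sum_finiteI simp: sumX)
    then have "(\<Sum>m. (t + s) ^ m *\<^sub>R c m) = (\<Sum>\<^sub>\<infinity>(m, i)\<in>(SIGMA m:UNIV. {..m}). X s m i)"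
      by (metis has_sum_imp_sums sums_unique)
    moreover have "((\<lambda>i. s ^ i *\<^sub>R b i) has_sum (\<Sum>\<^sub>\<infinity>(m, i)\<in>(SIGMA m:UNIV. {..m}). X s m i)) UNIV"
      by (rule has_sum_SigmaD[OF S]) (simp add: rowY'[OF e False])
    ultimately show ?thesis by (simp add: has_sum_imp_sums)
  qed
qed

subsection \<open>The Sobolev inner product\<close>

lemma powr_double: "euclid_norm k powr (2 * n) = euclid_norm k powr n * euclid_norm k powr n"
  by (simp flip: powr_add)

lemma H_term_summable:
  assumes v: "v \<in> wspace n" and w: "w \<in> wspace n"
  shows "(\<lambda>k. norm (complex_of_real (euclid_norm k powr (2 * n)) * cdot (vcnj (v k)) (w k))) summable_on UNIV"
    and "(\<Sum>\<^sub>\<infinity>k. norm (complex_of_real (euclid_norm k powr (2 * n)) * cdot (vcnj (v k)) (w k)))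
      \<le> wnorm n v * wnorm n w"
proof -
  have le: "norm (complex_of_real (euclid_norm k powr (2 * n)) * cdot (vcnj (v k)) (w k))
      \<le> (euclid_norm k powr n * norm (v k)) * wnorm n w" for k
  proof -
    have "norm (complex_of_real (euclid_norm k powr (2 * n)) * cdot (vcnj (v k)) (w k))
        \<le> euclid_norm k powr (2 * n) * (norm (v k) * norm (w k))"
      unfolding norm_mult using norm_cdot_le[of "vcnj (v k)" "w k"] by (intro mult_mono) auto
    also have "\<dots> = (euclid_norm k powr n * norm (v k)) * (euclid_norm k powr n * norm (w k))"
      by (simp add: powr_double)
    also have "\<dots> \<le> (euclid_norm k powr n * norm (v k)) * wnorm n w"
      by (intro mult_left_mono norm_le_wnorm w) auto
    finally show ?thesis .
  qed
  have s: "(\<lambda>k. (euclid_norm k powr n * norm (v k)) * wnorm n w) summable_on UNIV"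
    using v by (intro summable_on_cmult_left) (simp add: wspace_def)
  show s': "(\<lambda>k. norm (complex_of_real (euclid_norm k powr (2 * n)) * cdot (vcnj (v k)) (w k))) summable_on UNIV"
    by (rule Infinite_Sum.abs_summable_on_comparison_test'[OF s]) (rule le)
  show "(\<Sum>\<^sub>\<infinity>k. norm (complex_of_real (euclid_norm k powr (2 * n)) * cdot (vcnj (v k)) (w k)))
      \<le> wnorm n v * wnorm n w"
    unfolding wnorm_def[of n v] infsum_cmult_left'[symmetric] by (rule infsum_mono[OF s' s le])
qed

lemma abs_H_inner_le:
  assumes "v \<in> wspace n" "w \<in> wspace n"
  shows "\<bar>H_inner n v w\<bar> \<le> wnorm n v * wnorm n w"
  unfolding H_inner_def
  by (rule order_trans[OF abs_Re_le_cmod order_trans[OF norm_infsum_bound]]) (use H_term_summable[OF assms] in auto)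

lemma
  assumes v: "v \<in> wspace n" and w: "w \<in> wspace n" and x: "x \<in> wspace n"
  shows H_inner_add_left: "H_inner n (\<lambda>k. v k + x k) w = H_inner n v w + H_inner n x w"
    and H_inner_add_right: "H_inner n v (\<lambda>k. w k + x k) = H_inner n v w + H_inner n v x"
proof -
  note s = H_term_summable(1)[THEN abs_summable_summable]
  have "vcnj (v k + x k) = vcnj (v k) + vcnj (x k)" for k
    by (simp add: linear_add[OF bounded_linear.linear[OF bounded_linear_vcnj]])
  then show "H_inner n (\<lambda>k. v k + x k) w = H_inner n v w + H_inner n x w"
    using infsum_add[OF s[OF v w] s[OF x w]] by (simp add: H_inner_def cdot.add_left distrib_left)
  show "H_inner n v (\<lambda>k. w k + x k) = H_inner n v w + H_inner n v x"
    using infsum_add[OF s[OF v w] s[OF v x]] by (simp add: H_inner_def cdot.add_right distrib_left)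
qed

lemma H_inner_scaleR: "H_inner n (\<lambda>k. c *\<^sub>R v k) (\<lambda>k. d *\<^sub>R w k) = c * d * H_inner n v w"
proof -
  have "complex_of_real (euclid_norm k powr (2 * n)) * cdot (vcnj (c *\<^sub>R v k)) (d *\<^sub>R w k)
      = complex_of_real (c * d) * (complex_of_real (euclid_norm k powr (2 * n)) * cdot (vcnj (v k)) (w k))" for k
    by (simp add: linear_cmul[OF bounded_linear.linear[OF bounded_linear_vcnj]] cdot.scaleR_left
        cdot.scaleR_right) (simp add: scaleR_conv_of_real)
  then show ?thesis
    unfolding H_inner_def by (simp only: infsum_cmult_right') simp
qed

lemma H_inner_self: "H_inner n v v = (\<Sum>\<^sub>\<infinity>k. euclid_norm k powr (2 * n) * (norm (v k))\<^sup>2)"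
proof -
  have "(\<Sum>\<^sub>\<infinity>k. complex_of_real (euclid_norm k powr (2 * n)) * cdot (vcnj (v k)) (v k))
      = (\<Sum>\<^sub>\<infinity>k. complex_of_real (euclid_norm k powr (2 * n) * (norm (v k))\<^sup>2))"
    by (simp add: cdot_vcnj_self)
  also have "\<dots> = of_real (\<Sum>\<^sub>\<infinity>k. euclid_norm k powr (2 * n) * (norm (v k))\<^sup>2)"
    by (rule infsum_bounded_linear_strong[OF summable_on_bounded_linear_iff])
      (auto intro: bounded_linear_of_real bounded_linear_Re)
  finally show ?thesis by (simp add: H_inner_def)
qed

lemma H_inner_self_nonneg: "0 \<le> H_inner n v v"
  unfolding H_inner_self by (intro infsum_nonneg) auto

lemma H_norm_power2: "(H_norm n v)\<^sup>2 = H_inner n v v"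
  by (simp add: H_norm_def H_inner_self_nonneg)

lemma wspace_summable_sq:
  assumes "v \<in> wspace n"
  shows "(\<lambda>k. euclid_norm k powr (2 * n) * (norm (v k))\<^sup>2) summable_on UNIV"
proof -
  have "norm (complex_of_real (euclid_norm k powr (2 * n)) * cdot (vcnj (v k)) (v k))
      = euclid_norm k powr (2 * n) * (norm (v k))\<^sup>2" for k
    by (simp add: cdot_vcnj_self norm_mult norm_power)
  then show ?thesis using H_term_summable(1)[OF assms assms] by simp
qed

subsection \<open>Convergent power series of analytic fields\<close>

definition A_series :: "(real \<Rightarrow> field3) \<Rightarrow> real \<Rightarrow> real \<Rightarrow> (nat \<Rightarrow> field3) \<Rightarrow> bool"
  where "A_series u t \<delta> a \<longleftrightarrow> 0 < \<delta> \<and> (\<forall>j. a j \<in> A_space) \<and>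
    (\<forall>s. \<bar>s\<bar> < \<delta> \<longrightarrow> limitin A_topology (\<lambda>N k. \<Sum>j<N. s ^ j *\<^sub>R a j k) (u (t + s)) sequentially)"

context
  fixes u t \<delta> a
  assumes A: "A_series u t \<delta> a"
begin

lemma A_series_pos: "0 < \<delta>" using A by (simp add: A_series_def)

lemma A_series_coeff: "a j \<in> A_space" using A by (simp add: A_series_def)

lemma A_series_limit:
  "\<bar>s\<bar> < \<delta> \<Longrightarrow> limitin A_topology (\<lambda>N k. \<Sum>j<N. s ^ j *\<^sub>R a j k) (u (t + s)) sequentially"
  using A by (simp add: A_series_def)

lemma A_series_A_space: "\<bar>s\<bar> < \<delta> \<Longrightarrow> u (t + s) \<in> A_space"
  using limitin_A_space(1) A_series_limit by blast

lemma A_series_wnorm_limit: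
  "\<bar>s\<bar> < \<delta> \<Longrightarrow> (\<lambda>N. wnorm n (\<lambda>k. (\<Sum>j<N. s ^ j *\<^sub>R a j k) - u (t + s) k)) \<longlonglongrightarrow> 0"
  using limitin_A_wnorm[OF A_series_limit] .

text \<open>A limit in the topology only says that partial sums converge. At a radius r slightly
  larger than |s|, differences of consecutive partial sums bound r^N \<open>wnorm n (a N)\<close>,
  and the factor (|s| / r)^N then yields absolute convergence.\<close>

lemma A_series_summable:
  assumes s: "\<bar>s\<bar> < \<delta>"
  shows "summable (\<lambda>j. wnorm n (\<lambda>k. s ^ j *\<^sub>R a j k))"
proof -
  obtain r where r: "\<bar>s\<bar> < r" "r < \<delta>" using dense[OF s] by blast
  then have r0: "0 < r" "\<bar>r\<bar> < \<delta>" by auto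
  define D where "D N = (\<lambda>k. (\<Sum>j<N. r ^ j *\<^sub>R a j k) - u (t + r) k)" for N
  have DA: "D N \<in> wspace n" for N
    unfolding D_def using A_series_A_space[OF r0(2)]
    by (intro A_space_wspace A_space_diff A_space_sum A_space_scaleR A_series_coeff)
  have "(\<lambda>N. wnorm n (D N)) \<longlonglongrightarrow> 0"
    using A_series_wnorm_limit[OF r0(2)] by (simp add: D_def)
  then have "Bseq (\<lambda>N. wnorm n (D N))" by (intro convergent_imp_Bseq convergentI)
  then obtain M where M: "\<And>N. wnorm n (D N) \<le> M"
    unfolding Bseq_def by (auto simp: wnorm_nonneg)
  have le: "r ^ N * wnorm n (a N) \<le> 2 * M" for N
  proof -
    have "(\<lambda>k. D (Suc N) k - D N k) = (\<lambda>k. r ^ N *\<^sub>R a N k)" by (simp add: D_def)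
    then have "r ^ N * wnorm n (a N) = wnorm n (\<lambda>k. D (Suc N) k - D N k)"
      using r0 by (simp add: wnorm_scaleR)
    also have "\<dots> \<le> wnorm n (D (Suc N)) + wnorm n (D N)" by (rule wspace_diff(2)[OF DA DA])
    also have "\<dots> \<le> 2 * M" using M[of N] M[of "Suc N"] by simp
    finally show ?thesis .
  qed
  have q: "norm (\<bar>s\<bar> / r) < 1" using r r0 by simp
  show ?thesis
  proof (rule summable_comparison_test')
    show "summable (\<lambda>j. 2 * M * (\<bar>s\<bar> / r) ^ j)"
      using q by (intro summable_mult summable_geometric) auto
    show "norm (wnorm n (\<lambda>k. s ^ j *\<^sub>R a j k)) \<le> 2 * M * (\<bar>s\<bar> / r) ^ j" for j
    proof -
      have "norm (wnorm n (\<lambda>k. s ^ j *\<^sub>R a j k)) = (\<bar>s\<bar> / r) ^ j * (r ^ j * wnorm n (a j))"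
        using r0 by (simp add: wnorm_scaleR wnorm_nonneg power_abs power_divide)
      also have "\<dots> \<le> (\<bar>s\<bar> / r) ^ j * (2 * M)"
        using r0 by (intro mult_left_mono le) auto
      finally show ?thesis by (simp add: mult.commute)
    qed
  qed
qed

lemma A_series_sums:
  assumes s: "\<bar>s\<bar> < \<delta>"
  shows "(\<lambda>j. s ^ j *\<^sub>R a j k) sums u (t + s) k"
proof -
  have "(\<lambda>N. (\<Sum>j<N. s ^ j *\<^sub>R a j k) - u (t + s) k) \<longlonglongrightarrow> 0"
  proof (rule tendsto_0_le[OF A_series_wnorm_limit[OF s, of 0]])
    have "norm ((\<Sum>j<N. s ^ j *\<^sub>R a j k) - u (t + s) k)
        \<le> norm (wnorm 0 (\<lambda>k. (\<Sum>j<N. s ^ j *\<^sub>R a j k) - u (t + s) k)) * 1" for N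
      using coeff_le_wnorm[OF A_space_wspace[of "\<lambda>k. (\<Sum>j<N. s ^ j *\<^sub>R a j k) - u (t + s) k"], of 0 k]
      by (simp add: wnorm_nonneg A_space_diff A_space_sum A_space_scaleR A_series_coeff A_series_A_space[OF s])
    then show "\<forall>\<^sub>F N in sequentially. norm ((\<Sum>j<N. s ^ j *\<^sub>R a j k) - u (t + s) k)
        \<le> norm (wnorm 0 (\<lambda>k. (\<Sum>j<N. s ^ j *\<^sub>R a j k) - u (t + s) k)) * 1" by simp
  qed
  then show ?thesis by (simp add: sums_def LIM_zero_iff)
qed

lemma A_series_component_sums:
  assumes s: "\<bar>s\<bar> < \<delta>"
  shows "(\<lambda>j. a j k $ i * of_real s ^ j) sums (u (t + s) k $ i)"
  using bounded_linear.sums[OF bounded_linear_vec_nth A_series_sums[OF s, of k], of i]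
  by (simp only: vector_scaleR_component) (simp add: scaleR_conv_of_real mult.commute)

lemma A_series_analytic_at: "analytic_at (\<lambda>t. u t k $ i) t"
  unfolding analytic_at_def
  using A_series_pos A_series_component_sums[of _ k i] by (intro exI[of _ \<delta>] conjI exI allI impI)

lemma A_series_0: "a 0 = u t"
proof
  fix k
  have "(\<lambda>j. 0 ^ j *\<^sub>R a j k) sums (\<Sum>j\<in>{0}. 0 ^ j *\<^sub>R a j k)"
    by (rule sums_finite) (auto simp: power_0_left)
  then show "a 0 k = u t k"
    using A_series_sums[of 0 k] A_series_pos sums_unique2 by fastforce
qed

lemma A_series_biadditive:
  fixes B :: "field3 \<Rightarrow> field3 \<Rightarrow> 'b::banach"
  assumes "\<And>v v' w. v \<in> wspace n \<Longrightarrow> v' \<in> wspace n \<Longrightarrow> w \<in> wspace n \<Longrightarrow>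
      B (\<lambda>k. v k + v' k) w = B v w + B v' w"
    and "\<And>v w w'. v \<in> wspace n \<Longrightarrow> w \<in> wspace n \<Longrightarrow> w' \<in> wspace n \<Longrightarrow>
      B v (\<lambda>k. w k + w' k) = B v w + B v w'"
    and "\<And>v w. v \<in> wspace n \<Longrightarrow> w \<in> wspace n \<Longrightarrow> norm (B v w) \<le> C * wnorm n v * wnorm n w"
    and scale: "\<And>c d v w. B (\<lambda>k. c *\<^sub>R v k) (\<lambda>k. d *\<^sub>R w k) = (c * d) *\<^sub>R B v w"
    and s: "\<bar>s\<bar> < \<delta>"
  shows "(\<lambda>j. s ^ j *\<^sub>R (\<Sum>l\<le>j. B (a l) (a (j - l)))) sums B (u (t + s)) (u (t + s))"
proof -
  have "(\<lambda>j. \<Sum>l\<le>j. B (\<lambda>k. s ^ l *\<^sub>R a l k) (\<lambda>k. s ^ (j - l) *\<^sub>R a (j - l) k))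
      sums B (u (t + s)) (u (t + s))"
    by (rule biadditive_Cauchy_product[where n = n and C = C, OF assms(1-3)])
      (use s in \<open>auto intro: A_space_wspace A_space_scaleR A_series_coeff A_series_A_space
        A_series_summable A_series_wnorm_limit\<close>)
  then show ?thesis by (simp add: scale scaleR_sum_right flip: power_add)
qed

lemma A_series_euler_P:
  "\<bar>s\<bar> < \<delta> \<Longrightarrow> (\<lambda>j. s ^ j *\<^sub>R (\<Sum>l\<le>j. euler_P (a l) (a (j - l)) k)) sums euler_P (u (t + s)) (u (t + s)) k"
  by (rule A_series_biadditive[where B = "\<lambda>v w. euler_P v w k" and n = 1 and C = 2])
    (auto simp: euler_P_add_left euler_P_add_right norm_euler_P_le_wnorm euler_P_scaleR)

lemma A_series_H_inner:
  "\<bar>s\<bar> < \<delta> \<Longrightarrow> (\<lambda>j. s ^ j *\<^sub>R (\<Sum>l\<le>j. H_inner n (a l) (a (j - l)))) sums H_inner n (u (t + s)) (u (t + s))"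
  by (rule A_series_biadditive[where B = "H_inner n" and n = n and C = 1])
    (auto simp: H_inner_add_left H_inner_add_right abs_H_inner_le H_inner_scaleR)

end

definition euler_derivative :: "(real \<Rightarrow> field3) \<Rightarrow> real \<Rightarrow> bool"
  where "euler_derivative u t \<longleftrightarrow>
    limitin A_topology (\<lambda>h k. (1 / h) *\<^sub>R (u (t + h) k - u t k)) (euler_P (u t) (u t)) (at 0)"

lemma euler_derivative_coeff:
  assumes "euler_derivative u t"
  shows "((\<lambda>t. u t k) has_vector_derivative euler_P (u t) (u t) k) (at t)"
proof -
  let ?d = "\<lambda>h k. (1 / h) *\<^sub>R (u (t + h) k - u t k) - euler_P (u t) (u t) k"
  have lim: "limitin A_topology (\<lambda>h k. (1 / h) *\<^sub>R (u (t + h) k - u t k)) (euler_P (u t) (u t)) (at 0)"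
    using assms by (simp add: euler_derivative_def)
  have "((\<lambda>h. ?d h k) \<longlongrightarrow> 0) (at 0)"
  proof (rule tendsto_0_le[OF limitin_A_wnorm[OF lim, of 0]])
    show "\<forall>\<^sub>F h in at 0. norm (?d h k) \<le> norm (wnorm 0 (?d h)) * 1"
      using limitin_A_space(2)[OF lim]
    proof eventually_elim
      case (elim h)
      then have "?d h \<in> A_space" using limitin_A_space(1)[OF lim] by (intro A_space_diff) auto
      then show ?case using coeff_le_wnorm[OF A_space_wspace, of "?d h" 0 k] by (simp add: wnorm_nonneg)
    qed
  qed
  then have "((\<lambda>h. norm (?d h k)) \<longlongrightarrow> 0) (at 0)"
    by (rule tendsto_norm_zero)
  moreover have "\<forall>\<^sub>F h in at 0. norm (?d h k)
      = norm (u (t + h) k - u t k - h *\<^sub>R euler_P (u t) (u t) k) / norm h"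
    unfolding eventually_at
  proof (intro exI[of _ 1] conjI ballI impI)
    fix h :: real assume h: "h \<noteq> 0 \<and> dist h 0 < 1"
    then have "u (t + h) k - u t k - h *\<^sub>R euler_P (u t) (u t) k = h *\<^sub>R ?d h k"
      by (simp add: scaleR_diff_right)
    then show "norm (?d h k) = norm (u (t + h) k - u t k - h *\<^sub>R euler_P (u t) (u t) k) / norm h"
      using h by simp
  qed simp
  ultimately have "((\<lambda>h. norm (u (t + h) k - u t k - h *\<^sub>R euler_P (u t) (u t) k) / norm h) \<longlongrightarrow> 0) (at 0)"
    by (rule Lim_transform_eventually)
  then show ?thesis
    unfolding has_vector_derivative_def has_derivative_at by (simp add: bounded_linear_scaleR_left)
qed

text \<open>The coefficients of du/dt are computed twice: termwise differentiation gives (j + 1)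
  a_(j+1), the Cauchy product of the nonlinearity gives the sum in the recursion. Uniqueness of
  power series identifies them.\<close>

lemma A_series_derivative_coeff:
  assumes A: "A_series u t \<delta> a" and d: "\<And>s. \<bar>s\<bar> < \<delta> \<Longrightarrow> euler_derivative u (t + s)"
  shows "a = euler_coeff (u t)"
proof -
  have rec: "real (Suc j) *\<^sub>R a (Suc j) k = (\<Sum>l\<le>j. euler_P (a l) (a (j - l)) k)" for j k
  proof -
    have "of_nat (Suc j) * a (Suc j) k $ i = (\<Sum>l\<le>j. euler_P (a l) (a (j - l)) k) $ i" for i
    proof -
      define c where "c j = a j k $ i" for j
      have c: "(\<lambda>j. c j * of_real s ^ j) sums (u (t + s) k $ i)" if "\<bar>s\<bar> < \<delta>" for s
        unfolding c_def by (rule A_series_component_sums[OF A that])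
      have dc: "(\<lambda>j. diffs c j * of_real s ^ j) sums (euler_P (u (t + s)) (u (t + s)) k $ i)"
        if s: "\<bar>s\<bar> < \<delta>" for s :: real
      proof -
        obtain r where r: "\<bar>s\<bar> < r" "r < \<delta>" using dense[OF s] by blast
        have sr: "summable (\<lambda>j. c j * of_real r ^ j)" using c[of r] r by (auto dest: sums_summable)
        have "summable (\<lambda>j. c j * z ^ j)" if "norm z < r" for z :: complex
          by (rule powser_inside[OF sr]) (use that in auto)
        then have sd: "summable (\<lambda>j. diffs c j * of_real s ^ j)"
          by (rule termdiff_converges[of "of_real s" r, rotated]) (use r in auto)
        \<comment> \<open>Termwise differentiation takes place in the complex variable, as the
          components of the coefficients are complex, and is then restricted to the real
          line.\<close>
        have "((\<lambda>z. \<Sum>j. c j * z ^ j) has_field_derivative (\<Sum>j. diffs c j * of_real s ^ j)) (at (of_real s))"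
          by (rule termdiffs_strong[OF sr]) (use r in auto)
        then have "((\<lambda>s. \<Sum>j. c j * of_real s ^ j) has_vector_derivative (\<Sum>j. diffs c j * of_real s ^ j)) (at s)"
          by (rule has_vector_derivative_real_field)
        then have "((\<lambda>s. u (t + s) k $ i) has_vector_derivative (\<Sum>j. diffs c j * of_real s ^ j)) (at s)"
        proof (rule has_vector_derivative_transform_within[where d = "\<delta> - \<bar>s\<bar>"])
          fix s' :: real assume "dist s' s < \<delta> - \<bar>s\<bar>"
          then have "\<bar>s'\<bar> < \<delta>" by (simp add: dist_real_def)
          from sums_unique[OF c[OF this]] show "(\<Sum>j. c j * of_real s' ^ j) = u (t + s') k $ i" by simp
        qed (use s in auto)
        moreover have "((\<lambda>s. u (t + s) k $ i) has_vector_derivative euler_P (u (t + s)) (u (t + s)) k $ i) (at s)"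
        proof -
          have "((\<lambda>s. t + s) has_vector_derivative 1) (at s)"
            by (auto intro!: derivative_eq_intros)
          from vector_diff_chain_at[OF this euler_derivative_coeff[OF d[OF s], of k]]
          have "((\<lambda>s. u (t + s) k) has_vector_derivative euler_P (u (t + s)) (u (t + s)) k) (at s)"
            by (simp add: o_def)
          from bounded_linear.has_vector_derivative[OF bounded_linear_vec_nth this]
          show ?thesis .
        qed
        ultimately have "(\<Sum>j. diffs c j * of_real s ^ j) = euler_P (u (t + s)) (u (t + s)) k $ i"
          by (rule vector_derivative_unique_at)
        then show ?thesis using summable_sums[OF sd] by simp
      qed
      have "(\<lambda>j. (\<Sum>l\<le>j. euler_P (a l) (a (j - l)) k) $ i * of_real s ^ j)
          sums (euler_P (u (t + s)) (u (t + s)) k $ i)" if s: "\<bar>s\<bar> < \<delta>" for s :: real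
        using bounded_linear.sums[OF bounded_linear_vec_nth A_series_euler_P[OF A s, of k], of i]
        by (simp only: vector_scaleR_component) (simp add: scaleR_conv_of_real mult.commute)
      from powser_unique_real[OF A_series_pos[OF A] dc this]
      have "diffs c j = (\<Sum>l\<le>j. euler_P (a l) (a (j - l)) k) $ i" by blast
      then show ?thesis by (simp add: diffs_def c_def)
    qed
    then show ?thesis by (simp add: vec_eq_iff scaleR_conv_of_real[where 'a = complex])
  qed
  have "a j = euler_coeff (u t) j" for j
  proof (induction j rule: less_induct)
    case (less j)
    show ?case
    proof (cases j)
      case (Suc i)
      have "a j k = euler_coeff (u t) j k" for k
      proof -
        have "a (Suc i) k = (1 / real (Suc i)) *\<^sub>R (real (Suc i) *\<^sub>R a (Suc i) k)"
          by (simp del: of_nat_Suc)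
        also have "\<dots> = (1 / real (Suc i)) *\<^sub>R (\<Sum>l\<le>i. euler_P (a l) (a (i - l)) k)"
          by (simp only: rec)
        also have "(\<Sum>l\<le>i. euler_P (a l) (a (i - l)) k)
            = (\<Sum>l\<le>i. euler_P (euler_coeff (u t) l) (euler_coeff (u t) (i - l)) k)"
          using less Suc by (intro sum.cong refl) auto
        finally show ?thesis by (simp only: Suc euler_coeff_Suc)
      qed
      then show ?thesis by blast
    qed (simp add: A_series_0[OF A])
  qed
  then show ?thesis by blast
qed

subsection \<open>Local solutions\<close>

text \<open>Zero mean, zero divergence and reality are closed real-linear conditions on coefficients
  and survive coefficientwise limits; decay does not, so it is assumed of the sum.\<close>

lemma A_space_sums:
  assumes f: "\<And>j. f j \<in> solenoidal" and v: "\<And>k. (\<lambda>j. f j k) sums v k"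
    and d: "exp_decay \<sigma> C v" "0 < \<sigma>"
  shows "v \<in> A_space"
proof (rule A_spaceI[OF solenoidalI[OF d] d])
  note s = solenoidalD[OF f]
  show "v 0 = 0" using v[of 0] by (simp add: s sums_unique2[OF _ sums_zero])
  show "cdot (cvec k) (v k) = 0" for k
    using bounded_linear.sums[OF cdot.bounded_linear_right v[of k], of "cvec k"]
    by (simp add: s sums_unique2[OF _ sums_zero])
  show "v (- k) = vcnj (v k)" for k
    using bounded_linear.sums[OF bounded_linear_vcnj v[of k]] v[of "- k"]
    by (simp add: s sums_unique2)
qed

text \<open>With geometric bounds on the decay constants, the remainder after \<open>N\<close> terms
  decays in \<open>k\<close> at the same width \<sigma>, with a constant of order (|s| /
  \<epsilon>)^N. This is the form that \<open>limitin_A_decay\<close> needs.\<close>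

lemma
  assumes \<epsilon>: "0 < \<epsilon>" and \<sigma>: "0 < \<sigma>" and aA: "\<And>i. a i \<in> A_space"
    and a: "\<And>i. exp_decay \<sigma> (C * (1 / \<epsilon>) ^ i) (a i)"
    and u: "\<And>s k. \<bar>s\<bar> < \<epsilon> \<Longrightarrow> (\<lambda>i. s ^ i *\<^sub>R a i k) sums u (t + s) k"
  shows A_series_decayI: "A_series u t \<epsilon> a"
    and euler_derivative_decayI: "a 1 = euler_P (u t) (u t) \<Longrightarrow> euler_derivative u t"
proof -
  have C: "0 \<le> C" using exp_decay_nonneg[OF a[of 0]] by simp
  have tail: "exp_decay \<sigma> (C * (\<bar>s\<bar> / \<epsilon>) ^ N / (1 - \<bar>s\<bar> / \<epsilon>)) (\<lambda>k. (\<Sum>i<N. s ^ i *\<^sub>R a i k) - u (t + s) k)"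
    if s: "\<bar>s\<bar> < \<epsilon>" for s N
    unfolding exp_decay_def
  proof
    fix k
    have "norm (s ^ i *\<^sub>R a i k) \<le> (C * exp (- \<sigma> * euclid_norm k)) * (\<bar>s\<bar> / \<epsilon>) ^ i" for i
    proof -
      have "norm (s ^ i *\<^sub>R a i k) \<le> \<bar>s\<bar> ^ i * (C * (1 / \<epsilon>) ^ i * exp (- \<sigma> * euclid_norm k))"
        using a[of i] unfolding norm_scaleR power_abs by (intro mult_left_mono) (auto simp: exp_decay_def)
      then show ?thesis by (simp add: power_divide mult_ac)
    qed
    from geometric_sum_tail[OF this _ _ u[OF s], of N] s \<epsilon>
    show "norm ((\<Sum>i<N. s ^ i *\<^sub>R a i k) - u (t + s) k)
        \<le> C * (\<bar>s\<bar> / \<epsilon>) ^ N / (1 - \<bar>s\<bar> / \<epsilon>) * exp (- \<sigma> * euclid_norm k)"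
      by (simp add: mult_ac)
  qed
  have uA: "u (t + s) \<in> A_space" if s: "\<bar>s\<bar> < \<epsilon>" for s
  proof (rule A_space_sums[OF _ u[OF s]])
    show "(\<lambda>k. s ^ j *\<^sub>R a j k) \<in> solenoidal" for j
      by (intro A_space_solenoidal A_space_scaleR aA)
    show "exp_decay \<sigma> (C * (\<bar>s\<bar> / \<epsilon>) ^ 0 / (1 - \<bar>s\<bar> / \<epsilon>)) (u (t + s))"
      using tail[OF s, of 0] by (simp add: exp_decay_def)
  qed (rule \<sigma>)
  have pA: "(\<lambda>k. \<Sum>i<N. s ^ i *\<^sub>R a i k) \<in> A_space" for s N
    by (intro A_space_sum A_space_scaleR aA)
  show "A_series u t \<epsilon> a"
    unfolding A_series_def
  proof (intro conjI allI impI \<epsilon> aA)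
    fix s :: real assume s: "\<bar>s\<bar> < \<epsilon>"
    then have q: "0 \<le> \<bar>s\<bar> / \<epsilon>" "\<bar>s\<bar> / \<epsilon> < 1" by auto
    have "(\<lambda>N. C / (1 - \<bar>s\<bar> / \<epsilon>) * (\<bar>s\<bar> / \<epsilon>) ^ N) \<longlonglongrightarrow> C / (1 - \<bar>s\<bar> / \<epsilon>) * 0"
      using q by (intro tendsto_mult_left LIMSEQ_power_zero) auto
    then have "(\<lambda>N. C * (\<bar>s\<bar> / \<epsilon>) ^ N / (1 - \<bar>s\<bar> / \<epsilon>)) \<longlonglongrightarrow> 0" by simp
    then show "limitin A_topology (\<lambda>N k. \<Sum>j<N. s ^ j *\<^sub>R a j k) (u (t + s)) sequentially"
      by (intro limitin_A_decay[OF uA[OF s] \<sigma>]) (use tail[OF s] pA in auto)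
  qed
  show "euler_derivative u t" if a1: "a 1 = euler_P (u t) (u t)"
    unfolding euler_derivative_def a1[symmetric]
  proof (rule limitin_A_decay[OF aA \<sigma>])
    have ut: "u t \<in> A_space" using uA[of 0] \<epsilon> by simp
    have a0: "a 0 k = u t k" for k
      using tail[of 0 1] \<epsilon> by (simp add: exp_decay_def)
    show "\<forall>\<^sub>F h in at 0. (\<lambda>k. (1 / h) *\<^sub>R (u (t + h) k - u t k)) \<in> A_space \<and>
        exp_decay \<sigma> (2 * C / \<epsilon>\<^sup>2 * \<bar>h\<bar>) (\<lambda>k. (1 / h) *\<^sub>R (u (t + h) k - u t k) - a 1 k)"
      unfolding eventually_at
    proof (intro exI[of _ "\<epsilon> / 2"] conjI ballI impI)
      fix h :: real assume "h \<noteq> 0 \<and> dist h 0 < \<epsilon> / 2"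
      then have h: "h \<noteq> 0" "\<bar>h\<bar> < \<epsilon> / 2" "\<bar>h\<bar> < \<epsilon>" by (auto simp: dist_real_def)
      show "(\<lambda>k. (1 / h) *\<^sub>R (u (t + h) k - u t k)) \<in> A_space"
        by (intro A_space_scaleR A_space_diff uA h ut)
      \<comment> \<open>The error of the difference quotient is the remainder after two terms
        divided by h; for |h| < \<epsilon> / 2 the denominator 1 - |h| / \<epsilon> is at least 1 /
        2, whence the factor 2.\<close>
      show "exp_decay \<sigma> (2 * C / \<epsilon>\<^sup>2 * \<bar>h\<bar>) (\<lambda>k. (1 / h) *\<^sub>R (u (t + h) k - u t k) - a 1 k)"
        unfolding exp_decay_def
      proof
        fix k
        let ?E = "exp (- \<sigma> * euclid_norm k)"
        have "norm ((\<Sum>i<2. h ^ i *\<^sub>R a i k) - u (t + h) k)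
            \<le> C * (\<bar>h\<bar> / \<epsilon>) ^ 2 / (1 - \<bar>h\<bar> / \<epsilon>) * ?E"
          using tail[OF h(3), of 2] by (simp add: exp_decay_def)
        also have "\<dots> \<le> C * (\<bar>h\<bar> / \<epsilon>) ^ 2 / (1 / 2) * ?E"
          using h \<epsilon> C by (intro mult_right_mono divide_left_mono) (auto simp: field_simps)
        also have "(\<Sum>i<2. h ^ i *\<^sub>R a i k) - u (t + h) k
            = (- h) *\<^sub>R ((1 / h) *\<^sub>R (u (t + h) k - u t k) - a 1 k)"
          using h(1) by (simp add: numeral_2_eq_2 a0 scaleR_diff_right)
        finally have "\<bar>h\<bar> * norm ((1 / h) *\<^sub>R (u (t + h) k - u t k) - a 1 k)
            \<le> \<bar>h\<bar> * (2 * C / \<epsilon>\<^sup>2 * \<bar>h\<bar> * ?E)"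
          by (simp add: power_divide power2_eq_square mult_ac)
        then show "norm ((1 / h) *\<^sub>R (u (t + h) k - u t k) - a 1 k) \<le> 2 * C / \<epsilon>\<^sup>2 * \<bar>h\<bar> * ?E"
          by (rule mult_left_le_imp_le) (use h(1) in simp)
      qed
    qed (use \<epsilon> in auto)
    show "((\<lambda>h. 2 * C / \<epsilon>\<^sup>2 * \<bar>h\<bar>) \<longlongrightarrow> 0) (at 0)"
      by (rule tendsto_mult_right_zero, rule tendsto_rabs_zero) (rule tendsto_ident_at)
  qed
qed

definition local_solution :: "(real \<Rightarrow> field3) \<Rightarrow> real \<Rightarrow> bool"
  where "local_solution u t \<longleftrightarrow> (\<exists>\<delta> a. A_series u t \<delta> a) \<and> euler_derivative u t"

text \<open>\<rho> / (96 c) is where the geometric bound of \<open>euler_coeff_decay\<close>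
  converges. To verify the equation at t, the series is re-expanded there: the new first coefficient
  is the sum of (j + 1) t^j u_(j+1), which the recursion turns into the Cauchy product for the
  nonlinearity at t.\<close>

theorem Cauchy_Kovalevskaya:
  assumes v: "v \<in> solenoidal" "v \<in> espace \<rho>" "enorm \<rho> v \<le> c" and pos: "0 < c" "0 < \<rho>"
  obtains w where "w 0 = v" "\<And>t. \<bar>t\<bar> < \<rho> / (96 * c) \<Longrightarrow> local_solution w t"
proof -
  define \<delta> where "\<delta> = \<rho> / (96 * c)"
  define u where "u = euler_coeff v"
  define w where "w t = (\<lambda>k. \<Sum>j. t ^ j *\<^sub>R u j k)" for t
  have \<delta>: "0 < \<delta>" using pos by (simp add: \<delta>_def)
  have \<sigma>: "0 < \<rho> / 2" using pos by simp
  have vA: "v \<in> A_space" by (rule A_spaceI[OF v(1) espace_exp_decay[OF v(2)] pos(2)])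
  have uA: "u j \<in> A_space" for j unfolding u_def by (rule euler_coeff_A_space[OF vA])
  have u: "exp_decay (\<rho> / 2) (2 * c * (1 / \<delta>) ^ j) (u j)" for j
    using euler_coeff_decay[OF v(2,3) pos, of j] by (simp add: u_def \<delta>_def)
  have u': "norm (u j k) \<le> (2 * c * exp (- (\<rho> / 2) * euclid_norm k)) * (1 / \<delta>) ^ j" for j k
    using u[of j, unfolded exp_decay_def, THEN spec, of k] by (simp only: mult_ac)
  have ser: "A_series w 0 \<delta> u"
  proof (rule A_series_decayI[OF \<delta> \<sigma> uA u])
    fix s k assume s: "\<bar>s\<bar> < \<delta>"
    have "summable (\<lambda>j. s ^ j *\<^sub>R u j k)"
    proof (rule summable_comparison_test')
      show "summable (\<lambda>j. (2 * c * exp (- (\<rho> / 2) * euclid_norm k)) * (\<bar>s\<bar> / \<delta>) ^ j)"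
        using s \<delta> by (intro summable_mult summable_geometric) auto
      show "norm (s ^ j *\<^sub>R u j k) \<le> (2 * c * exp (- (\<rho> / 2) * euclid_norm k)) * (\<bar>s\<bar> / \<delta>) ^ j" for j
        using mult_left_mono[OF u'[of j k], of "\<bar>s\<bar> ^ j"] by (simp add: power_abs power_divide mult_ac)
    qed
    then show "(\<lambda>i. s ^ i *\<^sub>R u i k) sums w (0 + s) k"
      by (simp add: w_def summable_sums)
  qed
  have w0: "w 0 = v" using A_series_0[OF ser] by (simp add: u_def)
  have "local_solution w t" if t: "\<bar>t\<bar> < \<delta>" for t
  proof -
    define \<epsilon> where "\<epsilon> = (\<delta> - \<bar>t\<bar>) / 2"
    define b where "b i k = (\<Sum>j. (real ((i + j) choose i) * t ^ j) *\<^sub>R u (i + j) k)" for i k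
    note re = powser_reexpand[OF u' t \<epsilon>_def b_def]
    have \<epsilon>: "0 < \<epsilon>" using t by (simp add: \<epsilon>_def)
    have bd: "exp_decay (\<rho> / 2) (2 * c * (\<delta> / \<epsilon>) * (1 / \<epsilon>) ^ i) (b i)" for i
      unfolding exp_decay_def using re(2)[of i] by (simp add: mult_ac)
    have bA: "b i \<in> A_space" for i
    proof (rule A_space_sums[OF _ re(1) bd \<sigma>])
      show "(\<lambda>k. (real (i + j choose i) * t ^ j) *\<^sub>R u (i + j) k) \<in> solenoidal" for j
        by (intro A_space_solenoidal A_space_scaleR uA)
    qed
    have bs: "(\<lambda>i. s ^ i *\<^sub>R b i k) sums w (t + s) k" if "\<bar>s\<bar> < \<epsilon>" for s k
      unfolding w_def by (rule re(3)[OF that])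
    have "b 1 k = euler_P (w t) (w t) k" for k
    proof (rule sums_unique2)
      show "(\<lambda>j. (real ((1 + j) choose 1) * t ^ j) *\<^sub>R u (1 + j) k) sums b 1 k" by (rule re(1))
      have "(\<lambda>j. t ^ j *\<^sub>R (\<Sum>l\<le>j. euler_P (u l) (u (j - l)) k)) sums euler_P (w t) (w t) k"
        using A_series_euler_P[OF ser t, of k] by simp
      moreover have "t ^ j *\<^sub>R (\<Sum>l\<le>j. euler_P (u l) (u (j - l)) k)
          = (real ((1 + j) choose 1) * t ^ j) *\<^sub>R u (1 + j) k" for j
        by (simp add: u_def euler_coeff_Suc del: of_nat_Suc)
      ultimately show "(\<lambda>j. (real ((1 + j) choose 1) * t ^ j) *\<^sub>R u (1 + j) k) sums euler_P (w t) (w t) k"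
        by simp
    qed
    then have "b 1 = euler_P (w t) (w t)" by blast
    then show ?thesis
      unfolding local_solution_def
      using A_series_decayI[OF \<epsilon> \<sigma> bA bd bs] euler_derivative_decayI[OF \<epsilon> \<sigma> bA bd bs] by blast
  qed
  then show thesis using that[of w] w0 by (simp add: \<delta>_def)
qed

section \<open>Locality, Taylor coefficients and uniqueness of local solutions\<close>

lemma A_series_mono: "A_series u t \<delta> a \<Longrightarrow> 0 < \<delta>' \<Longrightarrow> \<delta>' \<le> \<delta> \<Longrightarrow> A_series u t \<delta>' a"
  by (auto simp: A_series_def)

text \<open>Being a solution at a time depends only on the germ. Different base points t and t' also
  cover translation in time, as the equation is autonomous.\<close>

lemma local_solution_cong:
  assumes u: "local_solution u t" and \<epsilon>: "0 < \<epsilon>" and eq: "\<And>s. \<bar>s\<bar> < \<epsilon> \<Longrightarrow> u' (t' + s) = u (t + s)"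
  shows "local_solution u' t'"
proof -
  obtain \<delta> a where A: "A_series u t \<delta> a" and d: "euler_derivative u t"
    using u by (auto simp: local_solution_def)
  have "A_series u t (min \<delta> \<epsilon>) a"
    using A_series_pos[OF A] \<epsilon> by (intro A_series_mono[OF A]) auto
  then have "A_series u' t' (min \<delta> \<epsilon>) a" by (simp add: A_series_def eq)
  moreover have "euler_derivative u' t'"
    unfolding euler_derivative_def limitin_def
  proof (intro conjI allI impI)
    have ut: "u' t' = u t" using eq[of 0] \<epsilon> by simp
    show "euler_P (u' t') (u' t') \<in> topspace A_topology"
      using d by (simp add: euler_derivative_def limitin_def ut)
    fix U assume "openin A_topology U \<and> euler_P (u' t') (u' t') \<in> U"
    then have ev: "\<forall>\<^sub>F h in at 0. (\<lambda>k. (1 / h) *\<^sub>R (u (t + h) k - u t k)) \<in> U"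
      using d by (simp add: euler_derivative_def limitin_def ut)
    have "\<forall>\<^sub>F h in at (0::real). \<bar>h\<bar> < \<epsilon>"
      unfolding eventually_at using \<epsilon> by (intro exI[of _ \<epsilon>]) (auto simp: dist_real_def)
    with ev show "\<forall>\<^sub>F h in at 0. (\<lambda>k. (1 / h) *\<^sub>R (u' (t' + h) k - u' t' k)) \<in> U"
      by eventually_elim (simp add: eq ut)
  qed
  ultimately show ?thesis by (auto simp: local_solution_def)
qed

text \<open>The equation is used on a neighbourhood of t; at t alone it would fix only the first two
  coefficients.\<close>

lemma local_solution_Taylor:
  assumes \<epsilon>: "0 < \<epsilon>" and u: "\<And>s. \<bar>s\<bar> < \<epsilon> \<Longrightarrow> local_solution u (t + s)"
  obtains \<delta> where "A_series u t \<delta> (euler_coeff (u t))"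
proof -
  obtain \<delta> a where A: "A_series u t \<delta> a"
    using u[of 0] \<epsilon> by (auto simp: local_solution_def)
  have A': "A_series u t (min \<delta> \<epsilon>) a"
    using A_series_pos[OF A] \<epsilon> by (intro A_series_mono[OF A]) auto
  have "a = euler_coeff (u t)"
    by (rule A_series_derivative_coeff[OF A']) (use u in \<open>auto simp: local_solution_def\<close>)
  then show thesis using A' that by blast
qed

text \<open>Near t0 both are the sum of the same recursively generated series; the identity theorem,
  applied to each component of each Fourier coefficient, spreads the equality over
  \<open>I\<close>.\<close>

lemma local_solution_unique:
  assumes I: "open I" "connected I" and t0: "t0 \<in> I"
    and u: "\<And>t. t \<in> I \<Longrightarrow> local_solution u t" and w: "\<And>t. t \<in> I \<Longrightarrow> local_solution w t"
    and eq: "u t0 = w t0" and t: "t \<in> I"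
  shows "u t = w t"
proof -
  obtain \<epsilon> where \<epsilon>: "0 < \<epsilon>" "\<And>s. \<bar>s\<bar> < \<epsilon> \<Longrightarrow> t0 + s \<in> I"
  proof -
    obtain e where "0 < e" "\<And>y. dist y t0 < e \<Longrightarrow> y \<in> I"
      using I(1) t0 unfolding open_dist by blast
    then show ?thesis using that[of e] by (auto simp: dist_real_def)
  qed
  obtain \<delta> where \<delta>: "A_series u t0 \<delta> (euler_coeff (u t0))"
    using local_solution_Taylor[OF \<epsilon>(1), of u t0] u \<epsilon>(2) by blast
  obtain \<delta>' where \<delta>': "A_series w t0 \<delta>' (euler_coeff (w t0))"
    using local_solution_Taylor[OF \<epsilon>(1), of w t0] w \<epsilon>(2) by blast
  have near: "u (t0 + s) k = w (t0 + s) k" if "\<bar>s\<bar> < min \<delta> \<delta>'" for s k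
    using A_series_sums[OF \<delta>, of s k] A_series_sums[OF \<delta>', of s k] that
    unfolding eq by (auto dest: sums_unique2)
  have "u t k $ i = w t k $ i" for k i
  proof (rule identity_theorem_real[OF I t0 _ _ _ _ t, of "\<lambda>t. u t k $ i" "\<lambda>t. w t k $ i"])
    show "analytic_at (\<lambda>t. u t k $ i) t" "analytic_at (\<lambda>t. w t k $ i) t" if "t \<in> I" for t
      using u[OF that] w[OF that] by (auto simp: local_solution_def intro: A_series_analytic_at)
    show "0 < min \<delta> \<delta>'" using A_series_pos[OF \<delta>] A_series_pos[OF \<delta>'] by simp
  qed (simp add: near)
  then show ?thesis by (simp add: fun_eq_iff vec_eq_iff)
qed

subsection \<open>Continuation\<close>

lemma open_time_interval: "open (time_interval S T)"
proof -
  have "time_interval S T = ereal -` {- S<..<T}" by (auto simp: time_interval_def)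
  then show ?thesis by (simp add: open_ereal_vimage)
qed

lemma connected_time_interval: "connected (time_interval S T)"
proof -
  have "is_interval (time_interval S T)"
    unfolding is_interval_1 time_interval_def
    by (auto intro: less_le_trans) (metis ereal_less_eq(3) le_less_trans)
  then show ?thesis by (simp add: is_interval_connected_1)
qed

text \<open>The interval is open, so a series required only for times inside it becomes, after
  shrinking \<delta>, a series on a full neighbourhood.\<close>

lemma A_solution_iff:
  "A_solution u0 S T u \<longleftrightarrow>
    0 < S \<and> 0 < T \<and> (\<forall>t\<in>time_interval S T. local_solution u t) \<and> u 0 = u0"
proof
  assume sol: "A_solution u0 S T u"
  have "local_solution u t" if t: "t \<in> time_interval S T" for t
  proof -
    obtain e where e: "0 < e" "\<And>y. dist y t < e \<Longrightarrow> y \<in> time_interval S T"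
      using open_time_interval[of S T] t unfolding open_dist by blast
    obtain \<delta> a where \<delta>: "0 < \<delta>" "\<And>j. a j \<in> A_space"
      and lim: "\<And>x. x \<in> time_interval S T \<Longrightarrow> \<bar>x - t\<bar> < \<delta> \<Longrightarrow>
        limitin A_topology (\<lambda>N k. \<Sum>j<N. (x - t) ^ j *\<^sub>R a j k) (u x) sequentially"
      using sol t unfolding A_solution_def A_real_analytic_on_def by blast
    have "limitin A_topology (\<lambda>N k. \<Sum>j<N. s ^ j *\<^sub>R a j k) (u (t + s)) sequentially"
      if "\<bar>s\<bar> < min \<delta> e" for s
      using lim[of "t + s"] e(2)[of "t + s"] that by (simp add: dist_real_def)
    then have "A_series u t (min \<delta> e) a" using \<delta> e by (simp add: A_series_def)
    then show ?thesis using sol t unfolding local_solution_def euler_derivative_def A_solution_def by blast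
  qed
  then show "0 < S \<and> 0 < T \<and> (\<forall>t\<in>time_interval S T. local_solution u t) \<and> u 0 = u0"
    using sol by (simp add: A_solution_def)
next
  assume *: "0 < S \<and> 0 < T \<and> (\<forall>t\<in>time_interval S T. local_solution u t) \<and> u 0 = u0"
  have "u t \<in> A_space" if "t \<in> time_interval S T" for t
  proof -
    obtain \<delta> a where "A_series u t \<delta> a" using * \<open>t \<in> _\<close> by (auto simp: local_solution_def)
    then show ?thesis using A_series_A_space[of u t \<delta> a 0] A_series_pos by fastforce
  qed
  moreover have "\<exists>\<delta>>0. \<exists>a. (\<forall>j. a j \<in> A_space) \<and> (\<forall>t\<in>time_interval S T. \<bar>t - t0\<bar> < \<delta> \<longrightarrow>
        limitin A_topology (\<lambda>N k. \<Sum>j<N. (t - t0) ^ j *\<^sub>R a j k) (u t) sequentially)"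
    if "t0 \<in> time_interval S T" for t0
  proof -
    have "local_solution u t0" using * that by blast
    then obtain \<delta> a where A: "A_series u t0 \<delta> a" by (auto simp: local_solution_def)
    have "limitin A_topology (\<lambda>N k. \<Sum>j<N. (t - t0) ^ j *\<^sub>R a j k) (u t) sequentially"
      if "\<bar>t - t0\<bar> < \<delta>" for t
      using A_series_limit[OF A that] by simp
    then show ?thesis using A_series_pos[OF A] A_series_coeff[OF A] by blast
  qed
  then have "A_real_analytic_on (time_interval S T) u" unfolding A_real_analytic_on_def by blast
  ultimately show "A_solution u0 S T u"
    using * by (simp add: A_solution_def local_solution_def euler_derivative_def)
qed

lemma A_solution_extend:
  assumes sol: "A_solution u0 S (ereal T) u"
    and b: "\<And>t. 0 \<le> t \<Longrightarrow> t < T \<Longrightarrow> u t \<in> espace \<rho> \<and> enorm \<rho> (u t) \<le> c" and pos: "0 < c" "0 < \<rho>"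
  shows "\<exists>T' u'. ereal T < T' \<and> A_solution u0 S T' u' \<and> (\<forall>t\<in>time_interval S (ereal T). u' t = u t)"
proof -
  let ?I = "time_interval S (ereal T)"
  have ST: "0 < S" "0 < T" and ls: "\<And>t. t \<in> ?I \<Longrightarrow> local_solution u t" and u0: "u 0 = u0"
    using sol unfolding A_solution_iff by auto
  define \<delta> where "\<delta> = \<rho> / (96 * c)"
  have \<delta>: "0 < \<delta>" using pos by (simp add: \<delta>_def)
  \<comment> \<open>The restart is at most half the guaranteed time \<delta> before T, so the new
    piece reaches beyond T; the maximum with 0 keeps it where the bounds hold.\<close>
  define t0 where "t0 = max 0 (T - \<delta> / 2)"
  have t0: "0 \<le> t0" "t0 < T" "T < t0 + \<delta>" using ST \<delta> by (auto simp: t0_def)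
  have pos_in: "t \<in> ?I" if "0 \<le> t" "t < T" for t
  proof -
    have "- S < 0" using ST(1) by (simp add: ereal_uminus_less_reorder)
    also have "0 \<le> ereal t" using that by simp
    finally show ?thesis using that by (simp add: time_interval_def)
  qed
  have t0I: "t0 \<in> ?I" using pos_in t0 by simp
  obtain \<delta>0 a0 where "A_series u t0 \<delta>0 a0" using ls[OF t0I] by (auto simp: local_solution_def)
  then have "u t0 \<in> A_space" using A_series_A_space[of u t0 \<delta>0 a0 0] A_series_pos by fastforce
  then obtain w where w: "w 0 = u t0" "\<And>t. \<bar>t\<bar> < \<delta> \<Longrightarrow> local_solution w t"
    using Cauchy_Kovalevskaya[of "u t0" \<rho> c] b[OF t0(1,2)] pos A_space_solenoidal unfolding \<delta>_def by blast
  define W where "W t = w (t - t0)" for t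
  have W: "local_solution W t" if "\<bar>t - t0\<bar> < \<delta>" for t
    by (rule local_solution_cong[OF w(2)[OF that], of 1]) (simp_all add: W_def algebra_simps)
  let ?J = "?I \<inter> {t0 - \<delta><..<t0 + \<delta>}"
  have J: "open ?J" "connected ?J"
  proof -
    show "open ?J" by (intro open_Int open_time_interval open_greaterThanLessThan)
    have "is_interval ?I" using connected_time_interval by (simp add: is_interval_connected_1)
    then have "is_interval ?J" by (intro is_interval_Int) (simp_all add: is_interval_oo)
    then show "connected ?J" by (simp add: is_interval_connected_1)
  qed
  have uW: "u t = W t" if "t \<in> ?J" for t
    by (rule local_solution_unique[OF J _ _ _ _ that, of t0])
      (use t0I \<delta> ls W in \<open>auto simp: W_def[of t0] w abs_less_iff\<close>)
  define u' where "u' t = (if t < T then u t else W t)" for t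
  have "local_solution u' t" if t: "t \<in> time_interval S (ereal (t0 + \<delta>))" for t
  proof (cases "t < T")
    case True
    then have tI: "t \<in> ?I" using t by (simp add: time_interval_def)
    show ?thesis
      by (rule local_solution_cong[OF ls[OF tI], of "T - t"]) (use True in \<open>auto simp: u'_def\<close>)
  next
    case False
    have tt: "t < t0 + \<delta>" using t by (simp add: time_interval_def)
    show ?thesis
    \<comment> \<open>For t \<ge> T the point t + s may still fall below T; the restriction |s| < t
      - t0 keeps it in the overlap, where the two pieces agree.\<close>
    proof (rule local_solution_cong[of W t "min (t - t0) (t0 + \<delta> - t)"])
      show "local_solution W t" using False tt t0 by (intro W) auto
      show "0 < min (t - t0) (t0 + \<delta> - t)" using False tt t0 by auto
      show "u' (t + s) = W (t + s)" if s: "\<bar>s\<bar> < min (t - t0) (t0 + \<delta> - t)" for s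
      proof (cases "t + s < T")
        case True
        have "0 \<le> t + s" "t0 - \<delta> < t + s" "t + s < t0 + \<delta>" using s t0(1) \<delta> by auto
        then have "t + s \<in> ?J" using True pos_in by auto
        then show ?thesis using uW True by (simp add: u'_def)
      qed (simp add: u'_def)
    qed
  qed
  then have "A_solution u0 S (ereal (t0 + \<delta>)) u'"
    unfolding A_solution_iff using ST t0 \<delta> u0 by (auto simp: u'_def)
  moreover have "\<forall>t\<in>?I. u' t = u t" by (auto simp: u'_def time_interval_def)
  moreover have "ereal T < ereal (t0 + \<delta>)" using t0 by simp
  ultimately show ?thesis by blast
qed

subsection \<open>Inequalities for sums over the lattice\<close>

lemma Cauchy_Schwarz_infsum:
  fixes x y :: "'a \<Rightarrow> real"
  assumes x: "(\<lambda>i. (x i)\<^sup>2) summable_on UNIV" "\<And>i. 0 \<le> x i"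
    and y: "(\<lambda>i. (y i)\<^sup>2) summable_on UNIV" "\<And>i. 0 \<le> y i"
  shows "(\<lambda>i. x i * y i) summable_on UNIV"
    and "(\<Sum>\<^sub>\<infinity>i. x i * y i) \<le> sqrt (\<Sum>\<^sub>\<infinity>i. (x i)\<^sup>2) * sqrt (\<Sum>\<^sub>\<infinity>i. (y i)\<^sup>2)"
proof -
  have le: "sum (\<lambda>i. x i * y i) F \<le> sqrt (\<Sum>\<^sub>\<infinity>i. (x i)\<^sup>2) * sqrt (\<Sum>\<^sub>\<infinity>i. (y i)\<^sup>2)" if F: "finite F" for F
  proof -
    have "sum (\<lambda>i. x i * y i) F = sum (\<lambda>i. \<bar>x i\<bar> * \<bar>y i\<bar>) F" using x(2) y(2) by simp
    also have "\<dots> \<le> L2_set x F * L2_set y F" by (rule L2_set_mult_ineq)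
    also have "\<dots> \<le> sqrt (\<Sum>\<^sub>\<infinity>i. (x i)\<^sup>2) * sqrt (\<Sum>\<^sub>\<infinity>i. (y i)\<^sup>2)"
      unfolding L2_set_def using F
      by (intro mult_mono real_sqrt_le_mono finite_sum_le_infsum x y)
        (auto intro: infsum_nonneg sum_nonneg)
    finally show ?thesis .
  qed
  show s: "(\<lambda>i. x i * y i) summable_on UNIV"
    by (rule nonneg_bdd_above_summable_on) (use le x y in \<open>auto intro!: bdd_aboveI2 mult_nonneg_nonneg\<close>)
  show "(\<Sum>\<^sub>\<infinity>i. x i * y i) \<le> sqrt (\<Sum>\<^sub>\<infinity>i. (x i)\<^sup>2) * sqrt (\<Sum>\<^sub>\<infinity>i. (y i)\<^sup>2)"
    by (rule infsum_le_finite_sums[OF s]) (use le in auto)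
qed

text \<open>For fixed \<open>h\<close>, Cauchy-Schwarz bounds the sum over \<open>l\<close> by a
  constant, since a shift of \<open>z\<close> preserves its square sum; then \<open>x\<close> is
  summed.\<close>

lemma Young_lattice:
  fixes x y z :: "int^3 \<Rightarrow> real"
  assumes x: "x summable_on UNIV" "\<And>i. 0 \<le> x i"
    and y: "(\<lambda>i. (y i)\<^sup>2) summable_on UNIV" "\<And>i. 0 \<le> y i"
    and z: "(\<lambda>i. (z i)\<^sup>2) summable_on UNIV" "\<And>i. 0 \<le> z i"
  shows "(\<lambda>(h, l). x h * y l * z (h + l)) summable_on UNIV \<times> UNIV"
    and "(\<Sum>\<^sub>\<infinity>(h, l)\<in>UNIV \<times> UNIV. x h * y l * z (h + l))
      \<le> (\<Sum>\<^sub>\<infinity>i. x i) * (sqrt (\<Sum>\<^sub>\<infinity>i. (y i)\<^sup>2) * sqrt (\<Sum>\<^sub>\<infinity>i. (z i)\<^sup>2))"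
proof -
  let ?c = "sqrt (\<Sum>\<^sub>\<infinity>i. (y i)\<^sup>2) * sqrt (\<Sum>\<^sub>\<infinity>i. (z i)\<^sup>2)"
  have bij: "bij_betw (\<lambda>l. h + l) UNIV (UNIV :: (int^3) set)" for h
    by (rule bij_betwI[where g = "\<lambda>l. l - h"]) auto
  have zh: "(\<lambda>l. (z (h + l))\<^sup>2) summable_on UNIV" "(\<Sum>\<^sub>\<infinity>l. (z (h + l))\<^sup>2) = (\<Sum>\<^sub>\<infinity>l. (z l)\<^sup>2)" for h
    using z(1) summable_on_reindex_bij_betw[OF bij, of "\<lambda>l. (z l)\<^sup>2" h]
      infsum_reindex_bij_betw[OF bij, of "\<lambda>l. (z l)\<^sup>2" h] by auto
  note CS = Cauchy_Schwarz_infsum[OF y zh(1) z(2)]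
  have row: "((\<lambda>l. case (h, l) of (h, l) \<Rightarrow> x h * y l * z (h + l)) has_sum
      x h * (\<Sum>\<^sub>\<infinity>l. y l * z (h + l))) UNIV" for h
    unfolding prod.case mult.assoc by (intro has_sum_cmult_right has_sum_infsum CS)
  have le: "x h * (\<Sum>\<^sub>\<infinity>l. y l * z (h + l)) \<le> x h * ?c" for h
    using CS(2)[of h] x(2) zh(2) by (intro mult_left_mono) auto
  have nn: "0 \<le> x h * (\<Sum>\<^sub>\<infinity>l. y l * z (h + l))" for h
    using x y z by (intro mult_nonneg_nonneg infsum_nonneg) auto
  have sc: "(\<lambda>h. x h * ?c) summable_on UNIV" by (intro summable_on_cmult_left x)
  have s: "(\<lambda>h. x h * (\<Sum>\<^sub>\<infinity>l. y l * z (h + l))) summable_on UNIV"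
    by (rule summable_on_comparison_test[OF sc le nn])
  show t: "(\<lambda>(h, l). x h * y l * z (h + l)) summable_on UNIV \<times> UNIV"
    by (rule summable_on_SigmaI[OF row s]) (use x y z in auto)
  have "((\<lambda>h. x h * (\<Sum>\<^sub>\<infinity>l. y l * z (h + l))) has_sum
      (\<Sum>\<^sub>\<infinity>(h, l)\<in>UNIV \<times> UNIV. x h * y l * z (h + l))) UNIV"
    by (rule has_sum_SigmaD[OF has_sum_infsum[OF t] row])
  then have "(\<Sum>\<^sub>\<infinity>(h, l)\<in>UNIV \<times> UNIV. x h * y l * z (h + l)) = (\<Sum>\<^sub>\<infinity>h. x h * (\<Sum>\<^sub>\<infinity>l. y l * z (h + l)))"
    by (simp add: infsumI)
  also have "\<dots> \<le> (\<Sum>\<^sub>\<infinity>h. x h * ?c)"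
    by (rule infsum_mono[OF s sc le])
  finally show "(\<Sum>\<^sub>\<infinity>(h, l)\<in>UNIV \<times> UNIV. x h * y l * z (h + l)) \<le> (\<Sum>\<^sub>\<infinity>i. x i) * ?c"
    by (simp add: infsum_cmult_left')
qed

lemma Young_lattice':
  fixes x y z :: "int^3 \<Rightarrow> real"
  assumes x: "(\<lambda>i. (x i)\<^sup>2) summable_on UNIV" "\<And>i. 0 \<le> x i"
    and y: "y summable_on UNIV" "\<And>i. 0 \<le> y i"
    and z: "(\<lambda>i. (z i)\<^sup>2) summable_on UNIV" "\<And>i. 0 \<le> z i"
  shows "(\<lambda>(h, l). x h * y l * z (h + l)) summable_on UNIV \<times> UNIV"
    and "(\<Sum>\<^sub>\<infinity>(h, l)\<in>UNIV \<times> UNIV. x h * y l * z (h + l))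
      \<le> (\<Sum>\<^sub>\<infinity>i. y i) * (sqrt (\<Sum>\<^sub>\<infinity>i. (x i)\<^sup>2) * sqrt (\<Sum>\<^sub>\<infinity>i. (z i)\<^sup>2))"
proof -
  have bij: "bij_betw prod.swap (UNIV \<times> UNIV) (UNIV \<times> (UNIV :: (int^3) set))"
    by (rule bij_betwI[where g = prod.swap]) auto
  have eq: "(\<lambda>p. case prod.swap p of (h, l) \<Rightarrow> x h * y l * z (h + l)) = (\<lambda>(h, l). y h * x l * z (h + l))"
    by (auto simp: fun_eq_iff mult_ac add.commute)
  note Y = Young_lattice[OF y x z]
  show "(\<lambda>(h, l). x h * y l * z (h + l)) summable_on UNIV \<times> UNIV"
    using Y(1) summable_on_reindex_bij_betw[OF bij, of "\<lambda>(h, l). x h * y l * z (h + l)"] by (simp only: eq)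
  show "(\<Sum>\<^sub>\<infinity>(h, l)\<in>UNIV \<times> UNIV. x h * y l * z (h + l))
      \<le> (\<Sum>\<^sub>\<infinity>i. y i) * (sqrt (\<Sum>\<^sub>\<infinity>i. (x i)\<^sup>2) * sqrt (\<Sum>\<^sub>\<infinity>i. (z i)\<^sup>2))"
    using Y(2) infsum_reindex_bij_betw[OF bij, of "\<lambda>(h, l). x h * y l * z (h + l)"] by (simp only: eq)
qed

subsection \<open>The weights\<close>

lemma powr_diff_le:
  fixes x y n :: real
  assumes "1 \<le> n" "0 < x" "0 < y" "x \<le> m" "y \<le> m"
  shows "\<bar>x powr n - y powr n\<bar> \<le> n * m powr (n - 1) * \<bar>x - y\<bar>"
proof -
  have *: "y powr n - x powr n \<le> n * m powr (n - 1) * (y - x)" if "0 < x" "x < y" "y \<le> m" for x y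
  proof -
    have "\<exists>z. x < z \<and> z < y \<and> y powr n - x powr n = (y - x) * (n * z powr (n - 1))"
      using that by (intro MVT2) (auto intro!: derivative_eq_intros)
    then obtain z where z: "x < z" "z < y" "y powr n - x powr n = (y - x) * (n * z powr (n - 1))" by blast
    have "(y - x) * (n * z powr (n - 1)) \<le> (y - x) * (n * m powr (n - 1))"
      using z that assms(1) by (intro mult_left_mono powr_mono2) auto
    then show ?thesis using z(3) by (simp add: mult_ac)
  qed
  consider "x < y" | "x = y" | "y < x" by linarith
  then show ?thesis
  proof cases
    case 1
    then have "x powr n \<le> y powr n" using assms by (intro powr_mono2) auto
    then show ?thesis using *[of x y] 1 assms by simp
  next
    case 3
    then have "y powr n \<le> x powr n" using assms by (intro powr_mono2) auto
    then show ?thesis using *[of y x] 3 assms by simp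
  qed simp
qed

lemma powr_add_le:
  fixes x y p :: real
  assumes "0 \<le> p" "0 \<le> x" "0 \<le> y"
  shows "(x + y) powr p \<le> 2 powr p * (x powr p + y powr p)"
proof -
  have "(x + y) powr p \<le> (2 * max x y) powr p" using assms by (intro powr_mono2) auto
  also have "\<dots> = 2 powr p * max x y powr p" using assms by (simp add: powr_mult)
  also have "max x y powr p \<le> x powr p + y powr p" by (auto simp: max_def)
  finally show ?thesis by simp
qed

lemma exp_diff_le:
  fixes x y m :: real
  assumes "x \<le> m" "y \<le> m"
  shows "\<bar>exp x - exp y\<bar> \<le> \<bar>x - y\<bar> * exp m"
proof -
  have *: "exp y - exp x \<le> (y - x) * exp m" if "x \<le> y" "y \<le> m" for x y
  proof -
    have "1 - exp (x - y) \<le> y - x" using exp_ge_add_one_self[of "x - y"] by linarith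
    then have "exp y * (1 - exp (x - y)) \<le> exp m * (y - x)"
      using that by (intro mult_mono) auto
    then show ?thesis by (simp add: right_diff_distrib mult.commute flip: exp_add)
  qed
  show ?thesis
    using *[of x y] *[of y x] assms by (cases "x \<le> y") (auto simp: abs_if)
qed

text \<open>\<open>H\<close>, \<open>L\<close>, \<open>K\<close> are the lengths of the wave vectors \<open>h\<close>, \<open>l\<close> and \<open>k = h + l\<close>.  The truncation
  \<open>min _ N\<close> keeps all the energies finite; the bounds do not depend on \<open>N\<close>.\<close>

lemma weight_diff_le:
  fixes H L K N n \<phi> :: real
  assumes n: "1 \<le> n" and pos: "1 \<le> H" "1 \<le> L" "1 \<le> K" "0 < N" "0 \<le> \<phi>" and tri: "\<bar>K - L\<bar> \<le> H" "H \<le> K + L"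
  defines "g \<equiv> \<lambda>x. min x N"
  defines "e \<equiv> \<lambda>x. exp (\<phi> * g x)"
  shows "L * \<bar>K powr n * e K - L powr n * e L\<bar>
    \<le> n * 2 powr n * (H * (L powr n * e L) + H powr n * (L * e L))
      + 2 powr n * \<phi> *
        ((H powr n * e H * sqrt (g H)) * (L * e L) * sqrt (g K) + (H powr n * e H * sqrt (g H)) * (L * e L * sqrt (g L))
        + (H * e H) * (L powr n * e L * sqrt (g L)) * sqrt (g K)
        + 2 * ((H * e H * sqrt (g H)) * (L powr n * e L * sqrt (g L)))
        + (H * e H * sqrt (g H)) * (L powr n * e L) * sqrt (g K))"
proof -
  have g0: "0 \<le> g H" "0 \<le> g L" "0 \<le> g K" using pos by (auto simp: g_def)
  have gH: "g H \<le> H" by (simp add: g_def)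
  have gd: "\<bar>g K - g L\<bar> \<le> g H" using tri pos by (auto simp: g_def min_def abs_if split: if_splits)
  have gH2: "g H \<le> g K + g L" using tri pos by (auto simp: g_def min_def split: if_splits)
  have sq: "sqrt (g L) \<le> sqrt (g K) + sqrt (g H)" "sqrt (g H) \<le> sqrt (g K) + sqrt (g L)"
    using gd gH2 g0 by (auto intro!: order_trans[OF real_sqrt_le_mono sqrt_add_le_add_sqrt])
  have Lg: "L * \<bar>g K - g L\<bar> \<le> g L * g H + H * g H"
  proof (cases "L \<le> N")
    case True
    then have "L * \<bar>g K - g L\<bar> \<le> L * g H" using pos gd by (intro mult_left_mono) auto
    also have "\<dots> = g L * g H" using True by (simp add: g_def)
    also have "\<dots> \<le> g L * g H + H * g H" using g0 pos by simp
    finally show ?thesis .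
  next
    case False
    show ?thesis
    proof (cases "N \<le> K")
      case True
      then have "g K - g L = 0" using False by (simp add: g_def)
      then show ?thesis using g0 pos by simp
    next
      \<comment> \<open>Here K < N < L: g L = N may be much smaller than L, but L \<le> K + H < g L
        + H.\<close>
      case K: False
      have "L * \<bar>g K - g L\<bar> \<le> (g L + H) * g H"
        using K False tri pos gd g0 by (intro mult_mono) (auto simp: g_def)
      then show ?thesis by (simp add: distrib_right)
    qed
  qed
  \<comment> \<open>The dissipation supplies half a power of \<open>g\<close> for each of two
    factors. The products g L g H and H g H are therefore split into square roots spread over two of
    the three wave vectors.\<close>
  have a1: "g L * g H \<le> H * sqrt (g L) * sqrt (g K) + H * sqrt (g L) * sqrt (g H)"
  proof -
    have "g L * g H = sqrt (g L) * sqrt (g L) * g H" using g0 by simp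
    also have "\<dots> \<le> sqrt (g L) * (sqrt (g K) + sqrt (g H)) * H"
      using g0 gH sq by (intro mult_mono mult_nonneg_nonneg) auto
    finally show ?thesis by (simp add: algebra_simps)
  qed
  have a2: "H * g H \<le> H * sqrt (g H) * sqrt (g K) + H * sqrt (g H) * sqrt (g L)"
  proof -
    have "H * g H = H * (sqrt (g H) * sqrt (g H))" using g0 by simp
    also have "\<dots> \<le> H * (sqrt (g H) * (sqrt (g K) + sqrt (g L)))"
      using g0 sq pos by (intro mult_left_mono) auto
    finally show ?thesis by (simp add: algebra_simps)
  qed
  have Lg2: "L * \<bar>g K - g L\<bar> \<le> H * sqrt (g L) * sqrt (g K) + H * sqrt (g L) * sqrt (g H)
      + (H * sqrt (g H) * sqrt (g K) + H * sqrt (g H) * sqrt (g L))"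
    using Lg a1 a2 by linarith
  \<comment> \<open>Used when \<open>h\<close> carries the full power n: then \<open>L\<close> stays
    as a plain derivative on the other factor, and only g H has to be split.\<close>
  have a3: "L * \<bar>g K - g L\<bar> \<le> L * (sqrt (g H) * (sqrt (g K) + sqrt (g L)))"
  proof -
    have "\<bar>g K - g L\<bar> \<le> sqrt (g H) * sqrt (g H)" using gd g0 by simp
    also have "\<dots> \<le> sqrt (g H) * (sqrt (g K) + sqrt (g L))" using g0 sq by (intro mult_left_mono) auto
    finally show ?thesis using pos by (intro mult_left_mono) auto
  qed
  have b1: "L * \<bar>K powr n - L powr n\<bar> \<le> n * 2 powr n * (H * L powr n + H powr n * L)"
  proof -
    have "\<bar>K powr n - L powr n\<bar> \<le> n * (L + H) powr (n - 1) * \<bar>K - L\<bar>"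
      using pos tri n by (intro powr_diff_le) auto
    also have "\<dots> \<le> n * (2 powr (n - 1) * (L powr (n - 1) + H powr (n - 1))) * H"
      using pos tri n by (intro mult_mono powr_add_le mult_nonneg_nonneg) auto
    also have "\<dots> \<le> n * (2 powr n * (L powr (n - 1) + H powr (n - 1))) * H"
      using pos n by (intro mult_right_mono mult_left_mono powr_mono) auto
    finally have "L * \<bar>K powr n - L powr n\<bar> \<le> L * (n * (2 powr n * (L powr (n - 1) + H powr (n - 1))) * H)"
      using pos by (intro mult_left_mono) auto
    also have "\<dots> = n * 2 powr n * (H * (L * L powr (n - 1)) + (H * H powr (n - 1)) * L)"
      by (simp add: algebra_simps)
    finally show ?thesis using pos by (simp add: powr_mult_base)
  qed
  have b2: "K powr n \<le> 2 powr n * (H powr n + L powr n)"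
  proof -
    have "K powr n \<le> (H + L) powr n" using pos tri n by (intro powr_mono2) auto
    also have "\<dots> \<le> 2 powr n * (H powr n + L powr n)" using pos n by (intro powr_add_le) auto
    finally show ?thesis .
  qed
  have e0: "0 \<le> e x" for x by (simp add: e_def)
  have b3: "\<bar>e K - e L\<bar> \<le> \<phi> * \<bar>g K - g L\<bar> * (e H * e L)"
  proof -
    have "\<bar>e K - e L\<bar> \<le> \<bar>\<phi> * g K - \<phi> * g L\<bar> * exp (\<phi> * (g H + g L))"
      unfolding e_def using gd g0 pos by (intro exp_diff_le mult_left_mono) auto
    also have "\<bar>\<phi> * g K - \<phi> * g L\<bar> = \<phi> * \<bar>g K - g L\<bar>"
      using pos by (simp add: abs_mult flip: right_diff_distrib)
    finally show ?thesis by (simp add: e_def distrib_left exp_add)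
  qed
  have "L * \<bar>K powr n * e K - L powr n * e L\<bar> = L * \<bar>(K powr n - L powr n) * e L + K powr n * (e K - e L)\<bar>"
    by (simp add: algebra_simps)
  also have "\<dots> \<le> L * (\<bar>K powr n - L powr n\<bar> * e L + K powr n * \<bar>e K - e L\<bar>)"
    using pos e0 by (intro mult_left_mono order_trans[OF abs_triangle_ineq]) (auto simp: abs_mult)
  also have "\<dots> = (L * \<bar>K powr n - L powr n\<bar>) * e L + K powr n * (L * \<bar>e K - e L\<bar>)"
    by (simp add: algebra_simps)
  also have "\<dots> \<le> (n * 2 powr n * (H * L powr n + H powr n * L)) * e L
      + (2 powr n * (H powr n + L powr n)) * (L * (\<phi> * \<bar>g K - g L\<bar> * (e H * e L)))"
    by (rule add_mono[OF mult_right_mono[OF b1 e0] mult_mono[OF b2 mult_left_mono[OF b3]]])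
      (use pos in auto)
  also have "\<dots> = n * 2 powr n * (H * (L powr n * e L) + H powr n * (L * e L))
      + 2 powr n * \<phi> * (H powr n * e H * e L * (L * \<bar>g K - g L\<bar>) + L powr n * e H * e L * (L * \<bar>g K - g L\<bar>))"
    by (simp add: algebra_simps)
  also have "\<dots> \<le> n * 2 powr n * (H * (L powr n * e L) + H powr n * (L * e L))
      + 2 powr n * \<phi> * (H powr n * e H * e L * (L * (sqrt (g H) * (sqrt (g K) + sqrt (g L))))
        + L powr n * e H * e L * (H * sqrt (g L) * sqrt (g K) + H * sqrt (g L) * sqrt (g H)
            + (H * sqrt (g H) * sqrt (g K) + H * sqrt (g H) * sqrt (g L))))"
    by (intro add_left_mono mult_left_mono add_mono mult_nonneg_nonneg a3 Lg2) (use pos e0 in auto)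
  finally show ?thesis by (simp add: algebra_simps)
qed

subsection \<open>The energy inequality\<close>

definition trunc :: "real \<Rightarrow> int^3 \<Rightarrow> real"
  where "trunc N k = min (euclid_norm k) N"

definition energy :: "real \<Rightarrow> real \<Rightarrow> real \<Rightarrow> field3 \<Rightarrow> real"
  where "energy n N \<phi> u =
    (\<Sum>\<^sub>\<infinity>k. exp (2 * \<phi> * trunc N k) * (euclid_norm k powr (2 * n) * (norm (u k))\<^sup>2))"

text \<open>Half the derivative of \<open>energy\<close> in \<phi>; with \<phi> decreasing it enters
  the time derivative with a negative sign.\<close>

definition dissipation :: "real \<Rightarrow> real \<Rightarrow> real \<Rightarrow> field3 \<Rightarrow> real"
  where "dissipation n N \<phi> u =
    (\<Sum>\<^sub>\<infinity>k. trunc N k * exp (2 * \<phi> * trunc N k) * (euclid_norm k powr (2 * n) * (norm (u k))\<^sup>2))"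

text \<open>Half the rate of change of \<open>energy\<close> along the equation at fixed
  \<phi>.\<close>

definition energy_flux :: "real \<Rightarrow> real \<Rightarrow> real \<Rightarrow> field3 \<Rightarrow> real"
  where "energy_flux n N \<phi> u = (\<Sum>\<^sub>\<infinity>k. exp (2 * \<phi> * trunc N k) *
    (euclid_norm k powr (2 * n) * Re (cdot (vcnj (u k)) (euler_P u u k))))"

lemma trunc_bounds: "0 < N \<Longrightarrow> 0 \<le> trunc N k" "trunc N k \<le> N" "trunc N k \<le> euclid_norm k"
  by (simp_all add: trunc_def)

text \<open>Outside a finite ball the weight is the constant c N, so every truncated sum is c N
  times a full sum plus finitely many corrections. Weights that depend on time can then be
  differentiated without interchange with an infinite sum.\<close>

lemma has_sum_trunc:
  fixes z :: "int^3 \<Rightarrow> real"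
  assumes "z summable_on UNIV"
  shows "((\<lambda>k. c (trunc N k) * z k) has_sum
    c N * infsum z UNIV + (\<Sum>k\<in>{k. euclid_norm k \<le> N}. (c (euclid_norm k) - c N) * z k)) UNIV"
proof -
  let ?F = "{k. euclid_norm k \<le> N}"
  have "((\<lambda>k. if k \<in> ?F then (c (euclid_norm k) - c N) * z k else 0) has_sum
      (\<Sum>k\<in>?F. (c (euclid_norm k) - c N) * z k)) UNIV"
    by (rule has_sum_finite_neutralI[OF finite_euclid_norm_le]) auto
  then have "((\<lambda>k. c N * z k + (if k \<in> ?F then (c (euclid_norm k) - c N) * z k else 0)) has_sum
      c N * infsum z UNIV + (\<Sum>k\<in>?F. (c (euclid_norm k) - c N) * z k)) UNIV"
    by (intro has_sum_add has_sum_cmult_right has_sum_infsum assms)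
  moreover have "c N * z k + (if k \<in> ?F then (c (euclid_norm k) - c N) * z k else 0) = c (trunc N k) * z k" for k
    by (auto simp: trunc_def min_def algebra_simps)
  ultimately show ?thesis by simp
qed

text \<open>Cauchy-Schwarz after inserting |k|^(1-n) |k|^n. The square of the first factor is
  summable over the lattice because 2 n - 2 > 3; this is where n > 5/2 enters the energy
  estimate.\<close>

lemma l1_le_weighted_l2:
  assumes n: "5 / 2 < n" and b: "\<And>k. 0 \<le> b k"
    and s: "(\<lambda>k. (euclid_norm k powr n * b k)\<^sup>2) summable_on UNIV"
  shows "(\<lambda>k. euclid_norm k * b k) summable_on UNIV"
    and "(\<Sum>\<^sub>\<infinity>k. euclid_norm k * b k) \<le>
      sqrt (\<Sum>\<^sub>\<infinity>k. euclid_norm k powr (- (2 * n - 2))) * sqrt (\<Sum>\<^sub>\<infinity>k. (euclid_norm k powr n * b k)\<^sup>2)"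
proof -
  have sq: "(euclid_norm k powr (1 - n))\<^sup>2 = euclid_norm k powr (- (2 * n - 2))" for k
    by (simp add: power2_eq_square flip: powr_add)
  have eq: "euclid_norm k powr (1 - n) * (euclid_norm k powr n * b k) = euclid_norm k * b k" for k
  proof -
    have "euclid_norm k powr (1 - n) * euclid_norm k powr n = euclid_norm k"
      by (simp flip: powr_add)
    then show ?thesis by (simp only: mult.assoc[symmetric])
  qed
  have s1: "(\<lambda>k. (euclid_norm k powr (1 - n))\<^sup>2) summable_on UNIV"
    unfolding sq using n by (intro summable_euclid_powr) auto
  note CS = Cauchy_Schwarz_infsum[OF s1 _ s]
  show "(\<lambda>k. euclid_norm k * b k) summable_on UNIV"
    using CS(1) b by (simp add: eq)
  show "(\<Sum>\<^sub>\<infinity>k. euclid_norm k * b k) \<le>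
      sqrt (\<Sum>\<^sub>\<infinity>k. euclid_norm k powr (- (2 * n - 2))) * sqrt (\<Sum>\<^sub>\<infinity>k. (euclid_norm k powr n * b k)\<^sup>2)"
    using CS(2) b unfolding sq eq by simp
qed

text \<open>The trilinear form is antisymmetric under \<open>(h, l) \<mapsto> (-h, h + l)\<close>, because \<open>u\<close> is real and
  divergence free.  Hence \<open>w k\<^sup>2\<close> may be replaced by \<open>w k (w k - w l)\<close>, which gains a derivative.\<close>

lemma energy_flux_commutator:
  fixes w :: "int^3 \<Rightarrow> real"
  assumes u: "u \<in> A_space"
    and w: "\<And>k. 0 \<le> w k" "\<And>k. w k \<le> c * euclid_norm k powr n"
  defines "X \<equiv> \<lambda>h l. Im (cdot (u h) (cvec l) * cdot (vcnj (u (h + l))) (u l))"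
  shows "(\<lambda>(h, l). w (h + l) * (w (h + l) - w l) * X h l) summable_on UNIV \<times> UNIV"
    and "(\<Sum>\<^sub>\<infinity>k. (w k)\<^sup>2 * Re (cdot (vcnj (u k)) (euler_P u u k)))
      = (\<Sum>\<^sub>\<infinity>(h, l)\<in>UNIV \<times> UNIV. w (h + l) * (w (h + l) - w l) * X h l)"
proof -
  note sol = solenoidalD[OF A_space_solenoidal[OF u]]
  have c0: "0 \<le> c"
  proof -
    obtain k :: "int^3" where k: "k \<noteq> 0" by (metis zero_neq_one)
    have "0 \<le> c * euclid_norm k powr n" using w order_trans by blast
    then show ?thesis using k by (simp add: zero_le_mult_iff)
  qed
  define Z where "Z h l = cdot (u h) (cvec l) * cdot (vcnj (u (h + l))) (u l)" for h l
  have X: "X h l = Re (- \<i> * Z h l)" for h l by (simp add: X_def Z_def)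
  \<comment> \<open>Analyticity is used only qualitatively here: any number of derivatives of
    \<open>u\<close> is absolutely summable, so both double sums converge before they are
    rearranged.\<close>
  have u1: "u \<in> wspace 1" and un: "u \<in> wspace n" and u2n: "u \<in> wspace (2 * n)"
    using u by (auto intro: A_space_wspace)
  have s0: "(\<lambda>k. norm (u k)) summable_on UNIV" by (rule wspace_summable_norm[OF u1]) simp
  have s1: "(\<lambda>k. euclid_norm k * norm (u k)) summable_on UNIV" by (rule wspace_summable_deriv[OF u1]) simp
  have Zle: "norm (Z h l) \<le> norm (u h) * (euclid_norm l * norm (u l)) * norm (u (h + l))" for h l
  proof -
    have "norm (Z h l) \<le> (norm (u h) * norm (cvec l)) * (norm (vcnj (u (h + l))) * norm (u l))"
      unfolding Z_def norm_mult by (intro mult_mono norm_cdot_le) auto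
    then show ?thesis by (simp add: norm_cvec mult_ac)
  qed
  define M where "M = wnorm n u"
  have wu: "w k * norm (u k) \<le> c * M" for k
  proof -
    have "w k * norm (u k) \<le> c * (euclid_norm k powr n * norm (u k))"
      using mult_right_mono[OF w(2)[of k], of "norm (u k)"] by simp
    also have "\<dots> \<le> c * M" unfolding M_def by (intro mult_left_mono norm_le_wnorm un c0)
    finally show ?thesis .
  qed
  have w2u: "(w k)\<^sup>2 * norm (u k) \<le> c\<^sup>2 * wnorm (2 * n) u" for k
  proof -
    have "(w k)\<^sup>2 * norm (u k) \<le> (c * euclid_norm k powr n)\<^sup>2 * norm (u k)"
      by (intro mult_right_mono power_mono w) auto
    also have "\<dots> = c\<^sup>2 * (euclid_norm k powr (2 * n) * norm (u k))"
      by (simp add: powr_double power2_eq_square)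
    also have "\<dots> \<le> c\<^sup>2 * wnorm (2 * n) u" by (intro mult_left_mono norm_le_wnorm u2n) auto
    finally show ?thesis .
  qed
  have prod: "(\<lambda>(h, l). norm (u h) * (euclid_norm l * norm (u l))) summable_on UNIV \<times> UNIV"
    using has_sum_product[OF s0 _ s1] by (auto dest: has_sum_imp_summable)
  have abs1: "(\<lambda>(h, l). norm (complex_of_real ((w (h + l))\<^sup>2) * Z h l)) summable_on UNIV \<times> UNIV"
  proof (rule summable_on_comparison_test)
    show "(\<lambda>p. c\<^sup>2 * wnorm (2 * n) u * (case p of (h, l) \<Rightarrow> norm (u h) * (euclid_norm l * norm (u l)))) summable_on UNIV \<times> UNIV"
      by (intro summable_on_cmult_right prod)
    show "(case p of (h, l) \<Rightarrow> norm (complex_of_real ((w (h + l))\<^sup>2) * Z h l))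
        \<le> c\<^sup>2 * wnorm (2 * n) u * (case p of (h, l) \<Rightarrow> norm (u h) * (euclid_norm l * norm (u l)))" for p
    proof (cases p)
      case (Pair h l)
      have "norm (complex_of_real ((w (h + l))\<^sup>2) * Z h l)
          \<le> (w (h + l))\<^sup>2 * (norm (u h) * (euclid_norm l * norm (u l)) * norm (u (h + l)))"
        unfolding norm_mult by (intro mult_mono Zle) (auto simp: norm_power)
      also have "\<dots> = ((w (h + l))\<^sup>2 * norm (u (h + l))) * (norm (u h) * (euclid_norm l * norm (u l)))" by simp
      also have "\<dots> \<le> c\<^sup>2 * wnorm (2 * n) u * (norm (u h) * (euclid_norm l * norm (u l)))"
        by (intro mult_right_mono w2u) auto
      finally show ?thesis by (simp add: Pair)
    qed
  qed auto
  then have Zs: "(\<lambda>(h, l). complex_of_real ((w (h + l))\<^sup>2) * Z h l) summable_on UNIV \<times> UNIV"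
    by (rule_tac abs_summable_summable) (simp add: case_prod_unfold)
  have s2: "(\<lambda>(h, l). (w (h + l))\<^sup>2 * X h l) summable_on UNIV \<times> UNIV"
    using summable_on_Im[OF Zs] by (simp add: case_prod_unfold X_def Z_def)
  have sl: "(\<lambda>l. w l * (euclid_norm l * norm (u l))) summable_on UNIV"
  proof (rule summable_on_comparison_test)
    show "(\<lambda>l. c * (euclid_norm l powr (n + 1) * norm (u l))) summable_on UNIV"
      using A_space_wspace[OF u, of "n + 1"] by (intro summable_on_cmult_right) (simp add: wspace_def)
    show "w l * (euclid_norm l * norm (u l)) \<le> c * (euclid_norm l powr (n + 1) * norm (u l))" for l
      using mult_right_mono[OF w(2)[of l], of "euclid_norm l * norm (u l)"] by (simp add: powr_add mult_ac)
  qed (use w in auto)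
  have prod': "(\<lambda>(h, l). norm (u h) * (w l * (euclid_norm l * norm (u l)))) summable_on UNIV \<times> UNIV"
    using has_sum_product[OF s0 _ sl] w by (auto dest: has_sum_imp_summable)
  have s3: "(\<lambda>(h, l). w (h + l) * w l * X h l) summable_on UNIV \<times> UNIV"
  proof (rule abs_summable_summable, rule summable_on_comparison_test)
    show "(\<lambda>p. c * M * (case p of (h, l) \<Rightarrow> norm (u h) * (w l * (euclid_norm l * norm (u l))))) summable_on UNIV \<times> UNIV"
      by (intro summable_on_cmult_right prod')
    show "norm (case p of (h, l) \<Rightarrow> w (h + l) * w l * X h l)
        \<le> c * M * (case p of (h, l) \<Rightarrow> norm (u h) * (w l * (euclid_norm l * norm (u l))))" for p
    proof (cases p)
      case (Pair h l)
      have "\<bar>X h l\<bar> \<le> norm (Z h l)" unfolding X_def Z_def by (rule abs_Im_le_cmod)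
      then have "\<bar>w (h + l) * w l * X h l\<bar>
          \<le> (w (h + l) * w l) * (norm (u h) * (euclid_norm l * norm (u l)) * norm (u (h + l)))"
        using w(1) Zle[of h l] unfolding abs_mult by (intro mult_mono) auto
      also have "\<dots> = (w (h + l) * norm (u (h + l))) * (norm (u h) * (w l * (euclid_norm l * norm (u l))))" by simp
      also have "\<dots> \<le> c * M * (norm (u h) * (w l * (euclid_norm l * norm (u l))))"
        using w(1) by (intro mult_right_mono wu) auto
      finally show ?thesis by (simp add: Pair)
    qed
  qed auto
  \<comment> \<open>The involution exchanges l and h + l, so the product w (h + l) w l is invariant
    while \<open>X\<close> changes sign.\<close>
  have zero: "(\<Sum>\<^sub>\<infinity>(h, l)\<in>UNIV \<times> UNIV. w (h + l) * w l * X h l) = 0"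
  proof -
    have "X (- h) (h + l) = - X h l" for h l
    proof -
      have "cdot (u (- h)) (cvec (h + l)) = cnj (cdot (u h) (cvec l))"
        using sol(2)[of h] unfolding sol(3) cvec_add cnj_cdot
        by (simp add: cdot.add_right) (metis cdot_commute cnj_cdot complex_cnj_zero vcnj_cvec)
      moreover have "cdot (vcnj (u (- h + (h + l)))) (u (h + l)) = cnj (cdot (vcnj (u (h + l))) (u l))"
        by (simp add: cnj_cdot cdot_commute)
      ultimately show ?thesis by (simp add: X_def)
    qed
    then have "(\<lambda>(h, l). w (h + l) * w l * X h l) (- h, h + l) = - (w (h + l) * w l * X h l)" for h l
      by (simp add: mult_ac)
    then have "(\<Sum>\<^sub>\<infinity>(h, l)\<in>UNIV \<times> UNIV. - (w (h + l) * w l * X h l))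
        = (\<Sum>\<^sub>\<infinity>(h, l)\<in>UNIV \<times> UNIV. w (h + l) * w l * X h l)"
      by (intro infsum_reindex_bij_witness[where i = "\<lambda>(h, l). (- h, h + l)" and j = "\<lambda>(h, l). (- h, h + l)"]) auto
    then show ?thesis by (simp add: case_prod_unfold infsum_uminus)
  qed
  have eq: "w (h + l) * (w (h + l) - w l) * X h l = (w (h + l))\<^sup>2 * X h l + - (w (h + l) * w l * X h l)" for h l
    by (simp add: power2_eq_square algebra_simps)
  have s3': "(\<lambda>(h, l). - (w (h + l) * w l * X h l)) summable_on UNIV \<times> UNIV"
    using summable_on_uminus[THEN iffD2, OF s3] by (simp add: case_prod_unfold)
  show "(\<lambda>(h, l). w (h + l) * (w (h + l) - w l) * X h l) summable_on UNIV \<times> UNIV"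
    unfolding eq using summable_on_add[OF s2 s3'] by (simp add: case_prod_unfold)
  have "(\<Sum>\<^sub>\<infinity>(h, l)\<in>UNIV \<times> UNIV. w (h + l) * (w (h + l) - w l) * X h l)
      = (\<Sum>\<^sub>\<infinity>(h, l)\<in>UNIV \<times> UNIV. (w (h + l))\<^sup>2 * X h l)"
    unfolding eq using infsum_add[OF s2 s3'] zero by (simp add: case_prod_unfold infsum_uminus)
  also have "\<dots> = (\<Sum>\<^sub>\<infinity>k. (w k)\<^sup>2 * Re (cdot (vcnj (u k)) (euler_P u u k)))"
  proof -
    have "((\<lambda>(h, l). (w (h + l))\<^sup>2 * X h l) has_sum S) (UNIV \<times> UNIV) \<longleftrightarrow>
        ((\<lambda>(k, h). (w k)\<^sup>2 * X h (k - h)) has_sum S) (UNIV \<times> UNIV)" for S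
      by (rule has_sum_reindex_bij_witness[where j = "\<lambda>(h, l). (h + l, h)" and i = "\<lambda>(k, h). (h, k - h)"]) auto
    with has_sum_infsum[OF s2]
    have hs: "((\<lambda>(k, h). (w k)\<^sup>2 * X h (k - h)) has_sum
        (\<Sum>\<^sub>\<infinity>(h, l)\<in>UNIV \<times> UNIV. (w (h + l))\<^sup>2 * X h l)) (UNIV \<times> UNIV)" by simp
    have row: "((\<lambda>h. case (k, h) of (k, h) \<Rightarrow> (w k)\<^sup>2 * X h (k - h)) has_sum
        (w k)\<^sup>2 * Re (cdot (vcnj (u k)) (euler_P u u k))) UNIV" for k
    proof -
      \<comment> \<open>u_k is orthogonal to k, so the Leray projection drops out of the
        pairing.\<close>
      have "cdot (cvec k) (vcnj (u k)) = 0"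
        using sol(2)[of k] by (metis cnj_cdot complex_cnj_zero vcnj_cvec)
      then have t: "- \<i> * cdot (vcnj (u k)) (euler_term u u k h) = - \<i> * Z h (k - h)" for h
        by (simp add: euler_term_def cdot_cmult_right cdot_Leray_orthogonal Z_def)
      have "(euler_term u u k has_sum infsum (euler_term u u k) UNIV) UNIV"
        using euler_term_summable(2)[OF s0 s1] by (rule has_sum_infsum)
      then have "((\<lambda>h. - \<i> * cdot (vcnj (u k)) (euler_term u u k h)) has_sum
          - \<i> * cdot (vcnj (u k)) (infsum (euler_term u u k) UNIV)) UNIV"
        by (intro has_sum_cmult_right has_sum_bounded_linear[OF cdot.bounded_linear_right])
      then have "((\<lambda>h. - \<i> * Z h (k - h)) has_sum cdot (vcnj (u k)) (euler_P u u k)) UNIV"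
        unfolding t euler_P_eq cdot_cmult_right .
      from has_sum_cmult_right[OF has_sum_Re[OF this], of "(w k)\<^sup>2"]
      show ?thesis by (simp only: prod.case X)
    qed
    show ?thesis
      by (rule infsumI[symmetric], rule has_sum_SigmaD[OF hs row])
  qed
  finally show "(\<Sum>\<^sub>\<infinity>k. (w k)\<^sup>2 * Re (cdot (vcnj (u k)) (euler_P u u k)))
      = (\<Sum>\<^sub>\<infinity>(h, l)\<in>UNIV \<times> UNIV. w (h + l) * (w (h + l) - w l) * X h l)" by simp
qed

text \<open>Every term in the bound of \<open>weight_diff_le\<close> takes the form x h * y l * z (h
  + l) and falls under a Young inequality: one factor carries a single derivative and is summed
  absolutely at the price S0, the other two are square summable.\<close>

lemma energy_flux_le:
  fixes n :: real
  assumes n: "5 / 2 < n"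
  obtains C1 C2 where "0 \<le> C1" "0 \<le> C2"
    "\<And>u N \<phi>. u \<in> A_space \<Longrightarrow> 0 < N \<Longrightarrow> 0 \<le> \<phi> \<Longrightarrow> energy_flux n N \<phi> u
      \<le> C1 * H_norm n u * energy n N \<phi> u + C2 * \<phi> * sqrt (energy n N \<phi> u) * dissipation n N \<phi> u"
proof -
  define S0 where "S0 = sqrt (\<Sum>\<^sub>\<infinity>k. euclid_norm k powr (- (2 * n - 2)))"
  define c1 where "c1 = n * 2 powr n"
  define c2 :: real where "c2 = 2 powr n"
  have S0: "0 \<le> S0" unfolding S0_def by (intro real_sqrt_ge_zero infsum_nonneg) auto
  have c12: "0 \<le> c1" "0 \<le> c2" using n by (auto simp: c1_def c2_def)
  have main: "energy_flux n N \<phi> u \<le> 2 * c1 * S0 * H_norm n u * energy n N \<phi> u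
      + 6 * c2 * S0 * \<phi> * sqrt (energy n N \<phi> u) * dissipation n N \<phi> u"
    if u: "u \<in> A_space" and N: "0 < N" and \<phi>: "0 \<le> \<phi>" for u N \<phi>
  proof -
    note u0 = solenoidalD(1)[OF A_space_solenoidal[OF u]]
    define e where "e k = exp (\<phi> * trunc N k)" for k
    define w where "w k = euclid_norm k powr n * e k" for k
    define a where "a k = norm (u k)" for k
    define g where "g k = trunc N k" for k
    have g0: "0 \<le> g k" for k using trunc_bounds(1)[OF N] by (simp add: g_def)
    have e2: "exp (2 * \<phi> * trunc N k) = (e k)\<^sup>2" for k
      by (simp add: e_def power2_eq_square flip: exp_add)
    have zs: "(\<lambda>k. euclid_norm k powr (2 * n) * (norm (u k))\<^sup>2) summable_on UNIV"
      by (rule wspace_summable_sq[OF A_space_wspace[OF u]])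
    \<comment> \<open>\<open>W\<close> and \<open>V\<close> carry the square roots of energy and
      dissipation, \<open>B\<close> the Sobolev norm. \<open>A\<close>, \<open>\<alpha>\<close> and
      \<open>\<beta>\<close> are the absolutely summed families with one derivative, controlled by
      the square sums of \<open>B\<close>, \<open>W\<close> and \<open>V\<close>
      respectively.\<close>
    define A where "A k = euclid_norm k * a k" for k
    define B where "B k = euclid_norm k powr n * a k" for k
    define W where "W k = w k * a k" for k
    define V where "V k = W k * sqrt (g k)" for k
    define \<alpha> where "\<alpha> k = euclid_norm k * (e k * a k)" for k
    define \<beta> where "\<beta> k = euclid_norm k * (e k * sqrt (g k) * a k)" for k
    have nn: "0 \<le> A k" "0 \<le> B k" "0 \<le> W k" "0 \<le> V k" "0 \<le> \<alpha> k" "0 \<le> \<beta> k" "0 \<le> e k" "0 \<le> w k" "0 \<le> a k" for k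
      using g0 by (auto simp: A_def B_def W_def V_def \<alpha>_def \<beta>_def a_def w_def e_def)
    have B2: "(B k)\<^sup>2 = euclid_norm k powr (2 * n) * (norm (u k))\<^sup>2" for k
      by (simp add: B_def a_def powr_double power2_eq_square)
    have W2: "(W k)\<^sup>2 = exp (2 * \<phi> * trunc N k) * (euclid_norm k powr (2 * n) * (norm (u k))\<^sup>2)" for k
      by (simp add: e2 W_def w_def a_def powr_double power2_eq_square)
    have V2: "(V k)\<^sup>2 = trunc N k * exp (2 * \<phi> * trunc N k) * (euclid_norm k powr (2 * n) * (norm (u k))\<^sup>2)" for k
      using g0[of k] by (simp add: V_def power_mult_distrib W2 g_def)
    have sB: "(\<lambda>k. (B k)\<^sup>2) summable_on UNIV" unfolding B2 by (rule zs)
    have sW: "(\<lambda>k. (W k)\<^sup>2) summable_on UNIV"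
      unfolding W2 using has_sum_trunc[OF zs, of "\<lambda>x. exp (2 * \<phi> * x)" N] by (rule has_sum_imp_summable)
    have sV: "(\<lambda>k. (V k)\<^sup>2) summable_on UNIV"
      unfolding V2 using has_sum_trunc[OF zs, of "\<lambda>x. x * exp (2 * \<phi> * x)" N] by (rule has_sum_imp_summable)
    let ?E = "energy n N \<phi> u" and ?D = "dissipation n N \<phi> u" and ?M = "H_norm n u"
    have E: "(\<Sum>\<^sub>\<infinity>k. (W k)\<^sup>2) = ?E" unfolding W2 energy_def ..
    have D: "(\<Sum>\<^sub>\<infinity>k. (V k)\<^sup>2) = ?D" unfolding V2 dissipation_def ..
    have M: "sqrt (\<Sum>\<^sub>\<infinity>k. (B k)\<^sup>2) = ?M" unfolding B2 H_norm_def H_inner_self ..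
    have E0: "0 \<le> ?E" unfolding E[symmetric] by (intro infsum_nonneg) auto
    have D0: "0 \<le> ?D" unfolding D[symmetric] by (intro infsum_nonneg) auto
    have M0: "0 \<le> ?M" unfolding M[symmetric] by (intro real_sqrt_ge_zero infsum_nonneg) auto
    have WB: "euclid_norm k powr n * (e k * a k) = W k" for k by (simp add: W_def w_def)
    have VB: "euclid_norm k powr n * (e k * sqrt (g k) * a k) = V k" for k by (simp add: V_def W_def w_def)
    have lA: "A summable_on UNIV" "infsum A UNIV \<le> S0 * ?M"
      using l1_le_weighted_l2[OF n, of a] nn(9) sB unfolding A_def B_def S0_def M[unfolded B_def, symmetric] by auto
    have l\<alpha>: "\<alpha> summable_on UNIV" "infsum \<alpha> UNIV \<le> S0 * sqrt ?E"
      using l1_le_weighted_l2[OF n, of "\<lambda>k. e k * a k"] nn(7,9) sW E unfolding \<alpha>_def WB S0_def by auto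
    have l\<beta>: "\<beta> summable_on UNIV" "infsum \<beta> UNIV \<le> S0 * sqrt ?D"
      using l1_le_weighted_l2[OF n, of "\<lambda>k. e k * sqrt (g k) * a k"] nn(7,9) g0 sV D
      unfolding \<beta>_def VB S0_def by auto
    define X where "X h l = Im (cdot (u h) (cvec l) * cdot (vcnj (u (h + l))) (u l))" for h l
    have "w k \<le> exp (\<phi> * N) * euclid_norm k powr n" for k
    proof -
      have "e k \<le> exp (\<phi> * N)" unfolding e_def using trunc_bounds(2)[of N k] \<phi> by (simp add: mult_left_mono)
      then show ?thesis unfolding w_def by (simp add: mult.commute mult_right_mono)
    qed
    note com = energy_flux_commutator[OF u nn(8) this, folded X_def]
    have flux: "energy_flux n N \<phi> u = (\<Sum>\<^sub>\<infinity>(h, l)\<in>UNIV \<times> UNIV. w (h + l) * (w (h + l) - w l) * X h l)"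
    proof -
      have "exp (2 * \<phi> * trunc N k) * (euclid_norm k powr (2 * n) * r) = (w k)\<^sup>2 * r" for k r
        by (simp add: e2 w_def powr_double power2_eq_square)
      then show ?thesis unfolding energy_flux_def by (simp only: com(2))
    qed
    define Y where "Y x y z = (\<lambda>(h, l). x h * y l * z (h + l))" for x y z :: "int^3 \<Rightarrow> real"
    have Y1: "Y A W W summable_on UNIV \<times> UNIV" "infsum (Y A W W) (UNIV \<times> UNIV) \<le> infsum A UNIV * (sqrt ?E * sqrt ?E)"
      using Young_lattice[OF lA(1) nn(1) sW nn(3) sW nn(3)] unfolding Y_def E by auto
    have Y2: "Y B \<alpha> W summable_on UNIV \<times> UNIV" "infsum (Y B \<alpha> W) (UNIV \<times> UNIV) \<le> infsum \<alpha> UNIV * (?M * sqrt ?E)"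
      using Young_lattice'[OF sB nn(2) l\<alpha>(1) nn(5) sW nn(3)] unfolding Y_def E M by auto
    have Y3: "Y V \<alpha> V summable_on UNIV \<times> UNIV" "infsum (Y V \<alpha> V) (UNIV \<times> UNIV) \<le> infsum \<alpha> UNIV * (sqrt ?D * sqrt ?D)"
      using Young_lattice'[OF sV nn(4) l\<alpha>(1) nn(5) sV nn(4)] unfolding Y_def D by auto
    have Y4: "Y V \<beta> W summable_on UNIV \<times> UNIV" "infsum (Y V \<beta> W) (UNIV \<times> UNIV) \<le> infsum \<beta> UNIV * (sqrt ?D * sqrt ?E)"
      using Young_lattice'[OF sV nn(4) l\<beta>(1) nn(6) sW nn(3)] unfolding Y_def D E by auto
    have Y5: "Y \<alpha> V V summable_on UNIV \<times> UNIV" "infsum (Y \<alpha> V V) (UNIV \<times> UNIV) \<le> infsum \<alpha> UNIV * (sqrt ?D * sqrt ?D)"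
      using Young_lattice[OF l\<alpha>(1) nn(5) sV nn(4) sV nn(4)] unfolding Y_def D by auto
    have Y6: "Y \<beta> V W summable_on UNIV \<times> UNIV" "infsum (Y \<beta> V W) (UNIV \<times> UNIV) \<le> infsum \<beta> UNIV * (sqrt ?D * sqrt ?E)"
      using Young_lattice[OF l\<beta>(1) nn(6) sV nn(4) sW nn(3)] unfolding Y_def D E by auto
    have Y7: "Y \<beta> W V summable_on UNIV \<times> UNIV" "infsum (Y \<beta> W V) (UNIV \<times> UNIV) \<le> infsum \<beta> UNIV * (sqrt ?E * sqrt ?D)"
      using Young_lattice[OF l\<beta>(1) nn(6) sW nn(3) sV nn(4)] unfolding Y_def D E by auto
    \<comment> \<open>In the terms with c1 the difference falls on |k|^n and the wave vector h keeps
      no exponential weight: hence one factor \<open>H_norm\<close> and only linear dependence on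
      the energy.\<close>
    define T where "T p = c1 * (Y A W W p + Y B \<alpha> W p)
        + c2 * \<phi> * (Y V \<alpha> V p + Y V \<beta> W p + Y \<alpha> V V p + 2 * Y \<beta> V W p + Y \<beta> W V p)" for p
    have Ts: "(T has_sum c1 * (infsum (Y A W W) (UNIV \<times> UNIV) + infsum (Y B \<alpha> W) (UNIV \<times> UNIV))
        + c2 * \<phi> * (infsum (Y V \<alpha> V) (UNIV \<times> UNIV) + infsum (Y V \<beta> W) (UNIV \<times> UNIV)
          + infsum (Y \<alpha> V V) (UNIV \<times> UNIV) + 2 * infsum (Y \<beta> V W) (UNIV \<times> UNIV)
          + infsum (Y \<beta> W V) (UNIV \<times> UNIV))) (UNIV \<times> UNIV)"
      unfolding T_def by (intro has_sum_add has_sum_cmult_right has_sum_infsum Y1 Y2 Y3 Y4 Y5 Y6 Y7)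
    \<comment> \<open>The weight estimate needs all three lengths to be at least 1; the terms with a
      zero wave vector vanish.\<close>
    have le: "w (h + l) * (w (h + l) - w l) * X h l \<le> T (h, l)" for h l
    proof (cases "h = 0 \<or> l = 0 \<or> h + l = 0")
      case True
      have "w 0 = 0" by (simp add: w_def)
      then have "w (h + l) * (w (h + l) - w l) * X h l = 0"
        using True by (auto simp: X_def u0 cdot.zero_left cdot.zero_right)
      also have "0 \<le> T (h, l)"
        unfolding T_def Y_def using c12 \<phi> nn by (auto intro!: add_nonneg_nonneg mult_nonneg_nonneg)
      finally show ?thesis .
    next
      case False
      let ?H = "euclid_norm h" and ?L = "euclid_norm l" and ?K = "euclid_norm (h + l)"
      have pos: "1 \<le> ?H" "1 \<le> ?L" "1 \<le> ?K" using False by (auto intro: euclid_norm_ge_1)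
      have "?H \<le> ?K + ?L" using euclid_norm_add_le[of "h + l" "- l"] by simp
      from weight_diff_le[OF _ pos N \<phi> euclid_norm_diff_le this, of n]
      have wd: "?L * \<bar>w (h + l) - w l\<bar>
          \<le> c1 * (?H * w l + ?H powr n * (?L * e l))
            + c2 * \<phi> * ((w h * sqrt (g h)) * (?L * e l) * sqrt (g (h + l)) + (w h * sqrt (g h)) * (?L * e l * sqrt (g l))
              + (?H * e h) * (w l * sqrt (g l)) * sqrt (g (h + l))
              + 2 * ((?H * e h * sqrt (g h)) * (w l * sqrt (g l)))
              + (?H * e h * sqrt (g h)) * w l * sqrt (g (h + l)))"
        using n by (simp add: c1_def c2_def w_def e_def g_def trunc_def)
      have aX: "\<bar>X h l\<bar> \<le> a h * (?L * a l) * a (h + l)"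
      proof -
        have "\<bar>X h l\<bar> \<le> norm (cdot (u h) (cvec l) * cdot (vcnj (u (h + l))) (u l))"
          unfolding X_def by (rule abs_Im_le_cmod)
        also have "\<dots> \<le> (norm (u h) * norm (cvec l)) * (norm (vcnj (u (h + l))) * norm (u l))"
          unfolding norm_mult by (intro mult_mono norm_cdot_le) auto
        finally show ?thesis by (simp add: norm_cvec a_def mult_ac)
      qed
      have "w (h + l) * (w (h + l) - w l) * X h l \<le> w (h + l) * \<bar>w (h + l) - w l\<bar> * \<bar>X h l\<bar>"
        by (rule order_trans[OF abs_ge_self]) (simp only: abs_mult abs_of_nonneg[OF nn(8)] order_refl)
      also have "\<dots> \<le> w (h + l) * \<bar>w (h + l) - w l\<bar> * (a h * (?L * a l) * a (h + l))"
        using nn(8)[of "h + l"] by (intro mult_left_mono aX) auto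
      also have "\<dots> = (?L * \<bar>w (h + l) - w l\<bar>) * (a h * a l * W (h + l))"
        by (simp add: W_def)
      also have "\<dots> \<le> (c1 * (?H * w l + ?H powr n * (?L * e l))
            + c2 * \<phi> * ((w h * sqrt (g h)) * (?L * e l) * sqrt (g (h + l)) + (w h * sqrt (g h)) * (?L * e l * sqrt (g l))
              + (?H * e h) * (w l * sqrt (g l)) * sqrt (g (h + l))
              + 2 * ((?H * e h * sqrt (g h)) * (w l * sqrt (g l)))
              + (?H * e h * sqrt (g h)) * w l * sqrt (g (h + l)))) * (a h * a l * W (h + l))"
        using nn by (intro mult_right_mono wd mult_nonneg_nonneg) auto
      also have "\<dots> = T (h, l)"
        by (simp add: T_def Y_def A_def B_def \<alpha>_def \<beta>_def V_def W_def algebra_simps)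
      finally show ?thesis .
    qed
    have "energy_flux n N \<phi> u \<le> infsum T (UNIV \<times> UNIV)"
      unfolding flux by (rule infsum_mono[OF com(1) has_sum_imp_summable[OF Ts]]) (use le in auto)
    also have "\<dots> = c1 * (infsum (Y A W W) (UNIV \<times> UNIV) + infsum (Y B \<alpha> W) (UNIV \<times> UNIV))
        + c2 * \<phi> * (infsum (Y V \<alpha> V) (UNIV \<times> UNIV) + infsum (Y V \<beta> W) (UNIV \<times> UNIV)
          + infsum (Y \<alpha> V V) (UNIV \<times> UNIV) + 2 * infsum (Y \<beta> V W) (UNIV \<times> UNIV)
          + infsum (Y \<beta> W V) (UNIV \<times> UNIV))"
      by (rule infsumI[OF Ts])
    also have "\<dots> \<le> c1 * (S0 * ?M * (sqrt ?E * sqrt ?E) + S0 * sqrt ?E * (?M * sqrt ?E))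
        + c2 * \<phi> * (S0 * sqrt ?E * (sqrt ?D * sqrt ?D) + S0 * sqrt ?D * (sqrt ?D * sqrt ?E)
          + S0 * sqrt ?E * (sqrt ?D * sqrt ?D) + 2 * (S0 * sqrt ?D * (sqrt ?D * sqrt ?E))
          + S0 * sqrt ?D * (sqrt ?E * sqrt ?D))"
      by (intro add_mono mult_left_mono order_trans[OF Y1(2)] order_trans[OF Y2(2)] order_trans[OF Y3(2)]
          order_trans[OF Y4(2)] order_trans[OF Y5(2)] order_trans[OF Y6(2)] order_trans[OF Y7(2)]
          mult_right_mono lA(2) l\<alpha>(2) l\<beta>(2)) (use c12 \<phi> E0 D0 M0 in auto)
    \<comment> \<open>The counts are 1 + 1 = 2 for c1 and 1 + 1 + 1 + 2 + 1 = 6 for c2.\<close>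
    also have "\<dots> = 2 * c1 * S0 * ?M * (sqrt ?E * sqrt ?E) + 6 * c2 * S0 * \<phi> * sqrt ?E * (sqrt ?D * sqrt ?D)"
      by (simp only: algebra_simps)
    finally show ?thesis using E0 D0 by simp
  qed
  show thesis
    by (rule that[of "2 * c1 * S0" "6 * c2 * S0"]) (use main c12 S0 in auto)
qed

subsection \<open>Persistence of analyticity\<close>

text \<open>A continuity argument: up to the first time \<open>s\<close> with E \<ge> B the
  differential inequality holds, so Gronwall gives E s \<le> E 0 exp(a T) < B, against the choice of
  \<open>s\<close>.\<close>

lemma bounded_by_bootstrap:
  fixes E E' :: "real \<Rightarrow> real"
  assumes deriv: "\<And>t. 0 \<le> t \<Longrightarrow> t < T \<Longrightarrow> (E has_real_derivative E' t) (at t)"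
    and le: "\<And>t. 0 \<le> t \<Longrightarrow> t < T \<Longrightarrow> E t \<le> B \<Longrightarrow> E' t \<le> a * E t"
    and init: "0 \<le> E 0" "E 0 * exp (a * T) < B" and a: "0 \<le> a" and t: "0 \<le> t" "t < T"
  shows "E t \<le> B"
proof (rule ccontr)
  assume "\<not> E t \<le> B"
  define X where "X = {s \<in> {0..t}. B \<le> E s}"
  have cont: "continuous_on {0..t} E"
    using t by (auto intro!: continuous_at_imp_continuous_on DERIV_isCont[OF deriv])
  have "t \<in> X" using \<open>\<not> E t \<le> B\<close> t by (simp add: X_def)
  have "closed X"
    unfolding X_def by (intro continuous_closed_preimage_constant continuous_on_closed_Collect_le cont
        continuous_on_const closed_atLeastAtMost)
  moreover have bdd: "bdd_below X" by (auto simp: X_def intro: bdd_belowI[of _ 0])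
  ultimately have "Inf X \<in> X" using \<open>t \<in> X\<close> by (intro closed_contains_Inf) auto
  define s where "s = Inf X"
  have s: "0 \<le> s" "s \<le> t" "B \<le> E s" using \<open>Inf X \<in> X\<close> by (auto simp: X_def s_def)
  have before: "E x \<le> B" if "0 \<le> x" "x < s" for x
    using cInf_lower[OF _ bdd, of x] that s by (force simp: X_def s_def)
  \<comment> \<open>The inequality is wanted at \<open>s\<close> itself too, where E \<le> B follows
    by continuity from the left or, if s = 0, from the initial bound.\<close>
  have Es: "E s \<le> B"
  proof (cases "s = 0")
    case True
    have "E 0 * 1 \<le> E 0 * exp (a * T)" using init a t by (intro mult_left_mono) auto
    then show ?thesis using True init by simp
  next
    case False
    have "(E \<longlongrightarrow> E s) (at_left s)"
      using DERIV_isCont[OF deriv[of s]] s t by (simp add: isCont_def filterlim_at_split)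
    moreover have "\<forall>\<^sub>F x in at_left s. E x \<le> B"
      unfolding eventually_at_left_field using before s(1) False by (intro exI[of _ 0]) auto
    ultimately show ?thesis by (rule tendsto_upperbound) simp
  qed
  have "E s * exp (- a * s) \<le> E 0 * exp (- a * 0)"
  proof (rule DERIV_nonpos_imp_nonincreasing[OF s(1)])
    show "\<exists>y. ((\<lambda>x. E x * exp (- a * x)) has_real_derivative y) (at x) \<and> y \<le> 0" if x: "0 \<le> x" "x \<le> s" for x
    proof (intro exI conjI)
      have xT: "x < T" using x s t by simp
      show "((\<lambda>x. E x * exp (- a * x)) has_real_derivative (E' x - a * E x) * exp (- a * x)) (at x)"
        using deriv[of x] x xT by (auto intro!: derivative_eq_intros simp: algebra_simps)
      have "E x \<le> B" using before[of x] Es x by (cases "x = s") auto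
      then show "(E' x - a * E x) * exp (- a * x) \<le> 0"
        using le[of x] x xT by (intro mult_nonpos_nonneg) auto
    qed
  qed
  then have "E s \<le> E 0 * exp (a * s)" by (simp add: exp_minus field_simps)
  also have "\<dots> \<le> E 0 * exp (a * T)"
    using s t a init by (intro mult_left_mono) (auto intro: mult_left_mono)
  finally show False using init s by simp
qed

section \<open>Time derivatives of the energies\<close>

lemma inner_eq_cdot: "inner x y = Re (cdot (vcnj x) (y :: complex^3))"
  by (simp add: inner_vec_def cdot_def vcnj_def inner_complex_def)

lemma H_inner_eq:
  assumes "v \<in> wspace n" "w \<in> wspace n"
  shows "((\<lambda>k. euclid_norm k powr (2 * n) * Re (cdot (vcnj (v k)) (w k))) has_sum H_inner n v w) UNIV"
  using has_sum_Re[OF has_sum_infsum[OF abs_summable_summable[OF H_term_summable(1)[OF assms]]]]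
  by (simp add: H_inner_def)

lemma H_inner_commute: "H_inner n v w = H_inner n w v"
proof -
  have "cdot (vcnj (v k)) (w k) = cnj (cdot (vcnj (w k)) (v k))" for k
    by (simp add: cnj_cdot cdot_commute)
  then have "(\<Sum>\<^sub>\<infinity>k. of_real (euclid_norm k powr (2 * n)) * cdot (vcnj (v k)) (w k))
      = (\<Sum>\<^sub>\<infinity>k. cnj (of_real (euclid_norm k powr (2 * n)) * cdot (vcnj (w k)) (v k)))"
    by simp
  then show ?thesis unfolding H_inner_def by (simp only: infsum_cnj) simp
qed

text \<open>Read off from the power series of the squared norm about t, whose coefficient of order 1
  is twice the inner product of u_0 and u_1 = P(u_0, u_0).\<close>

lemma H_inner_self_derivative:
  assumes A: "A_series u t \<delta> (euler_coeff (u t))"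
  shows "((\<lambda>t. H_inner n (u t) (u t)) has_real_derivative 2 * H_inner n (u t) (euler_P (u t) (u t))) (at t)"
proof -
  define c where "c j = (\<Sum>l\<le>j. H_inner n (euler_coeff (u t) l) (euler_coeff (u t) (j - l)))" for j
  have c: "(\<lambda>j. c j * s ^ j) sums H_inner n (u (t + s)) (u (t + s))" if "\<bar>s\<bar> < \<delta>" for s
    using A_series_H_inner[OF A that, of n] by (simp add: c_def mult.commute)
  have \<delta>: "0 < \<delta>" by (rule A_series_pos[OF A])
  have "((\<lambda>x. \<Sum>j. c j * x ^ j) has_real_derivative (\<Sum>j. diffs c j * 0 ^ j)) (at 0)"
    by (rule termdiffs_strong[OF sums_summable[OF c[of "\<delta> / 2"]]]) (use \<delta> in auto)
  moreover have "(\<Sum>j. diffs c j * 0 ^ j) = 2 * H_inner n (u t) (euler_P (u t) (u t))"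
    by (simp add: powser_zero diffs_def c_def euler_coeff_Suc[of _ 0, simplified] H_inner_commute[of n "euler_P (u t) (u t)"])
  ultimately have "((\<lambda>x. \<Sum>j. c j * x ^ j) has_real_derivative 2 * H_inner n (u t) (euler_P (u t) (u t))) (at 0)"
    by simp
  then have "((\<lambda>s. H_inner n (u (t + s)) (u (t + s))) has_real_derivative 2 * H_inner n (u t) (euler_P (u t) (u t))) (at 0)"
  proof (rule has_field_derivative_transform_within[OF _ \<delta>])
    fix x :: real assume "dist x 0 < \<delta>"
    then show "(\<Sum>j. c j * x ^ j) = H_inner n (u (t + x)) (u (t + x))"
      by (intro sums_unique[symmetric] c) (simp add: dist_real_def)
  qed simp
  then show ?thesis
    using DERIV_shift[of "\<lambda>t. H_inner n (u t) (u t)" _ 0 t] by (simp add: add.commute)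
qed

text \<open>By \<open>has_sum_trunc\<close> the energy is exp(2 \<phi> N) times the squared Sobolev
  norm plus finitely many differentiable terms. Splitting \<open>dissipation\<close> and
  \<open>energy_flux\<close> in the same way identifies the derivative.\<close>

lemma energy_has_derivative:
  fixes \<phi> :: "real \<Rightarrow> real"
  assumes \<epsilon>: "0 < \<epsilon>" and u: "\<And>s. \<bar>s\<bar> < \<epsilon> \<Longrightarrow> local_solution u (t + s)"
    and \<phi>: "(\<phi> has_real_derivative \<phi>') (at t)"
  shows "((\<lambda>t. energy n N (\<phi> t) (u t)) has_real_derivative
    2 * \<phi>' * dissipation n N (\<phi> t) (u t) + 2 * energy_flux n N (\<phi> t) (u t)) (at t)"
proof -
  let ?F = "{k. euclid_norm k \<le> N}"
  let ?P = "euler_P (u t) (u t)"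
  define z where "z v k = euclid_norm k powr (2 * n) * (norm (v k))\<^sup>2" for v :: field3 and k
  define z' where "z' k = euclid_norm k powr (2 * n) * Re (cdot (vcnj (u t k)) (?P k))" for k
  obtain \<delta> where A: "A_series u t \<delta> (euler_coeff (u t))"
    using local_solution_Taylor[OF \<epsilon> u] by blast
  have d: "euler_derivative u t" using u[of 0] \<epsilon> by (simp add: local_solution_def)
  have uA: "u (t + s) \<in> A_space" if "\<bar>s\<bar> < \<delta>" for s by (rule A_series_A_space[OF A that])
  have ut: "u t \<in> A_space" using uA[of 0] A_series_pos[OF A] by simp
  have PA: "?P \<in> A_space" by (rule euler_P_A_space[OF ut ut])
  have zs: "z v summable_on UNIV" "infsum (z v) UNIV = H_inner n v v" if "v \<in> A_space" for v
    using wspace_summable_sq[OF A_space_wspace[OF that], of n] by (simp_all add: z_def[abs_def] H_inner_self)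
  have z's: "z' summable_on UNIV" "infsum z' UNIV = H_inner n (u t) ?P"
    using H_inner_eq[OF A_space_wspace[OF ut] A_space_wspace[OF PA], of n]
    by (auto simp: z'_def[abs_def] has_sum_imp_summable infsumI)
  define G where "G t = exp (2 * \<phi> t * N) * H_inner n (u t) (u t)
      + (\<Sum>k\<in>?F. (exp (2 * \<phi> t * euclid_norm k) - exp (2 * \<phi> t * N)) * z (u t) k)" for t
  have zd: "((\<lambda>t. z (u t) k) has_real_derivative 2 * z' k) (at t)" for k
  proof -
    have "((\<lambda>t. u t k) has_vector_derivative ?P k) (at t)" by (rule euler_derivative_coeff[OF d])
    then have "((\<lambda>t. u t k) has_derivative (\<lambda>x. x *\<^sub>R ?P k)) (at t)"
      by (simp add: has_vector_derivative_def)
    from has_derivative_inner[OF this this]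
    have "((\<lambda>t. inner (u t k) (u t k)) has_derivative (\<lambda>x. x * (2 * inner (u t k) (?P k)))) (at t)"
      by (simp add: inner_commute algebra_simps)
    then have "((\<lambda>t. (norm (u t k))\<^sup>2) has_real_derivative 2 * Re (cdot (vcnj (u t k)) (?P k))) (at t)"
      unfolding power2_norm_eq_inner inner_eq_cdot[symmetric] has_field_derivative_def
      by (simp add: mult_commute_abs)
    from DERIV_cmult[OF this, of "euclid_norm k powr (2 * n)"] show ?thesis
      by (simp add: z_def z'_def mult_ac)
  qed
  have "(G has_real_derivative
      (2 * \<phi>' * N * exp (2 * \<phi> t * N) * H_inner n (u t) (u t) + exp (2 * \<phi> t * N) * (2 * H_inner n (u t) ?P))
      + (\<Sum>k\<in>?F. 2 * \<phi>' * (euclid_norm k * exp (2 * \<phi> t * euclid_norm k) - N * exp (2 * \<phi> t * N)) * z (u t) k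
          + (exp (2 * \<phi> t * euclid_norm k) - exp (2 * \<phi> t * N)) * (2 * z' k))) (at t)"
    unfolding G_def
    by (rule derivative_eq_intros refl \<phi> H_inner_self_derivative[OF A] zd | simp)+
      (simp add: algebra_simps)
  moreover have "(2 * \<phi>' * N * exp (2 * \<phi> t * N) * H_inner n (u t) (u t) + exp (2 * \<phi> t * N) * (2 * H_inner n (u t) ?P))
      + (\<Sum>k\<in>?F. 2 * \<phi>' * (euclid_norm k * exp (2 * \<phi> t * euclid_norm k) - N * exp (2 * \<phi> t * N)) * z (u t) k
          + (exp (2 * \<phi> t * euclid_norm k) - exp (2 * \<phi> t * N)) * (2 * z' k))
      = 2 * \<phi>' * dissipation n N (\<phi> t) (u t) + 2 * energy_flux n N (\<phi> t) (u t)"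
  proof -
    have D: "dissipation n N (\<phi> t) (u t) = N * exp (2 * \<phi> t * N) * H_inner n (u t) (u t)
        + (\<Sum>k\<in>?F. (euclid_norm k * exp (2 * \<phi> t * euclid_norm k) - N * exp (2 * \<phi> t * N)) * z (u t) k)"
      using infsumI[OF has_sum_trunc[OF zs(1)[OF ut], of "\<lambda>x. x * exp (2 * \<phi> t * x)" N]]
      by (simp add: dissipation_def zs(2)[OF ut]) (simp add: z_def)
    have Q: "energy_flux n N (\<phi> t) (u t) = exp (2 * \<phi> t * N) * H_inner n (u t) ?P
        + (\<Sum>k\<in>?F. (exp (2 * \<phi> t * euclid_norm k) - exp (2 * \<phi> t * N)) * z' k)"
      using infsumI[OF has_sum_trunc[OF z's(1), of "\<lambda>x. exp (2 * \<phi> t * x)" N]]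
      by (simp add: energy_flux_def z's(2)) (simp add: z'_def)
    show ?thesis unfolding D Q by (simp add: sum.distrib sum_subtractf sum_distrib_left algebra_simps)
  qed
  ultimately have "(G has_real_derivative
      2 * \<phi>' * dissipation n N (\<phi> t) (u t) + 2 * energy_flux n N (\<phi> t) (u t)) (at t)" by simp
  then show ?thesis
  proof (rule has_field_derivative_transform_within[OF _ A_series_pos[OF A]])
    fix x assume "dist x t < \<delta>"
    then have ux: "u x \<in> A_space" using uA[of "x - t"] by (simp add: dist_real_def)
    show "G x = energy n N (\<phi> x) (u x)"
      using infsumI[OF has_sum_trunc[OF zs(1)[OF ux], of "\<lambda>y. exp (2 * \<phi> x * y)" N]]
      by (simp add: G_def energy_def zs(2)[OF ux]) (simp add: z_def)
  qed simp
qed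

lemma energy_nonneg: "0 \<le> energy n N \<phi> u"
  unfolding energy_def by (intro infsum_nonneg) auto

lemma dissipation_nonneg: "0 < N \<Longrightarrow> 0 \<le> dissipation n N \<phi> u"
  unfolding dissipation_def by (intro infsum_nonneg) (auto simp: trunc_bounds)

text \<open>One term of the energy suffices; with N \<ge> |k| the truncation is not felt at
  \<open>k\<close>.\<close>

lemma coeff_le_energy:
  assumes u: "u \<in> A_space" and N: "euclid_norm k \<le> N" and n: "0 \<le> n"
  shows "norm (u k) \<le> sqrt (energy n N \<phi> u) * exp (- \<phi> * euclid_norm k)"
proof (cases "k = 0")
  case True
  then show ?thesis
    using solenoidalD(1)[OF A_space_solenoidal[OF u]] energy_nonneg by simp
next
  case False
  have s: "(\<lambda>k. exp (2 * \<phi> * trunc N k) * (euclid_norm k powr (2 * n) * (norm (u k))\<^sup>2)) summable_on UNIV"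
    using has_sum_trunc[OF wspace_summable_sq[OF A_space_wspace[OF u]], of "\<lambda>x. exp (2 * \<phi> * x)"]
    by (rule has_sum_imp_summable)
  have "(exp (\<phi> * euclid_norm k) * norm (u k))\<^sup>2 = exp (2 * \<phi> * trunc N k) * (1 * (norm (u k))\<^sup>2)"
    using N by (simp add: trunc_def power_mult_distrib power2_eq_square flip: exp_add)
  also have "\<dots> \<le> exp (2 * \<phi> * trunc N k) * (euclid_norm k powr (2 * n) * (norm (u k))\<^sup>2)"
    using euclid_norm_ge_1[OF False] n by (intro mult_left_mono mult_right_mono ge_one_powr_ge_zero) auto
  also have "\<dots> \<le> energy n N \<phi> u"
    unfolding energy_def using finite_sum_le_infsum[OF s, of "{k}"] by simp
  finally have "exp (\<phi> * euclid_norm k) * norm (u k) \<le> sqrt (energy n N \<phi> u)"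
    by (rule real_le_rsqrt)
  then show ?thesis by (simp add: exp_minus field_simps)
qed

text \<open>At half the width the exponential weight in the energy is at most exp(\<sigma> |k|),
  against exp(- 2 \<sigma> |k|) from the squared coefficients; the bound is free of N.\<close>

lemma energy_le_decay:
  assumes u: "u \<in> A_space" and d: "exp_decay \<sigma> C u" "0 < \<sigma>"
  shows "energy n N (\<sigma> / 2) u \<le> C\<^sup>2 * (\<Sum>\<^sub>\<infinity>k. euclid_norm k powr (2 * n) * exp (- \<sigma> * euclid_norm k))"
  unfolding energy_def infsum_cmult_right'[symmetric]
proof (rule infsum_mono)
  show "(\<lambda>k. exp (2 * (\<sigma> / 2) * trunc N k) * (euclid_norm k powr (2 * n) * (norm (u k))\<^sup>2)) summable_on UNIV"
    using has_sum_trunc[OF wspace_summable_sq[OF A_space_wspace[OF u]], of "\<lambda>x. exp (2 * (\<sigma> / 2) * x)"]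
    by (rule has_sum_imp_summable)
  show "(\<lambda>k. C\<^sup>2 * (euclid_norm k powr (2 * n) * exp (- \<sigma> * euclid_norm k))) summable_on UNIV"
    by (intro summable_on_cmult_right summable_powr_exp d)
  fix k
  have "(norm (u k))\<^sup>2 \<le> (C * exp (- \<sigma> * euclid_norm k))\<^sup>2"
    using d(1) by (intro power_mono) (auto simp: exp_decay_def)
  then have "exp (2 * (\<sigma> / 2) * trunc N k) * (euclid_norm k powr (2 * n) * (norm (u k))\<^sup>2)
      \<le> exp (\<sigma> * euclid_norm k) * (euclid_norm k powr (2 * n) * (C * exp (- \<sigma> * euclid_norm k))\<^sup>2)"
    using trunc_bounds(3)[of N k] d(2) by (intro mult_mono) auto
  also have "\<dots> = C\<^sup>2 * (euclid_norm k powr (2 * n) * (exp (\<sigma> * euclid_norm k) * (exp (- \<sigma> * euclid_norm k))\<^sup>2))"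
    by (simp add: power_mult_distrib)
  also have "exp (\<sigma> * euclid_norm k) * (exp (- \<sigma> * euclid_norm k))\<^sup>2 = exp (- \<sigma> * euclid_norm k)"
    by (simp add: power2_eq_square flip: exp_add)
  finally show "exp (2 * (\<sigma> / 2) * trunc N k) * (euclid_norm k powr (2 * n) * (norm (u k))\<^sup>2)
      \<le> C\<^sup>2 * (euclid_norm k powr (2 * n) * exp (- \<sigma> * euclid_norm k))" .
qed

lemma uniform_analyticity:
  assumes n: "5 / 2 < n" and sol: "A_solution u0 S (ereal T) u"
    and bound: "\<And>t. 0 \<le> t \<Longrightarrow> t < T \<Longrightarrow> H_norm n (u t) \<le> M"
  obtains \<rho> c where "0 < \<rho>" "0 < c" "\<And>t. 0 \<le> t \<Longrightarrow> t < T \<Longrightarrow> u t \<in> espace \<rho> \<and> enorm \<rho> (u t) \<le> c"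
proof -
  let ?I = "time_interval S (ereal T)"
  have ST: "0 < S" "0 < T" and ls: "\<And>t. t \<in> ?I \<Longrightarrow> local_solution u t" and u0: "u 0 = u0"
    using sol unfolding A_solution_iff by auto
  have uA: "u t \<in> A_space" if "t \<in> ?I" for t
    using sol that by (simp add: A_solution_def)
  have tI: "t \<in> ?I" if "0 \<le> t" "t < T" for t
  proof -
    have "- S < 0" using ST(1) by (simp add: ereal_uminus_less_reorder)
    also have "0 \<le> ereal t" using that by simp
    finally show ?thesis using that by (simp add: time_interval_def)
  qed
  obtain C1 C2 where C: "0 \<le> C1" "0 \<le> C2"
    and flux: "\<And>u N \<phi>. u \<in> A_space \<Longrightarrow> 0 < N \<Longrightarrow> 0 \<le> \<phi> \<Longrightarrow> energy_flux n N \<phi> u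
      \<le> C1 * H_norm n u * energy n N \<phi> u + C2 * \<phi> * sqrt (energy n N \<phi> u) * dissipation n N \<phi> u"
    using energy_flux_le[OF n] by metis
  have u0A: "u 0 \<in> A_space" using uA tI ST by simp
  obtain \<sigma> C where \<sigma>: "0 < \<sigma>" "exp_decay \<sigma> C (u 0)" using A_spaceE[OF u0A] .
  define E0 where "E0 = C\<^sup>2 * (\<Sum>\<^sub>\<infinity>k. euclid_norm k powr (2 * n) * exp (- \<sigma> * euclid_norm k))"
  have M: "0 \<le> M" using bound[of 0] ST by (auto intro: order_trans[rotated] simp: H_norm_def H_inner_self_nonneg)
  \<comment> \<open>The Gronwall bound over [0, T), enlarged by 1 for the strict inequality of the
    bootstrap. It is fixed before \<kappa> and does not involve N.\<close>
  define B where "B = E0 * exp (2 * C1 * M * T) + 1"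
  have E0: "0 \<le> E0" unfolding E0_def by (intro mult_nonneg_nonneg infsum_nonneg) auto
  then have B: "0 < B" by (auto simp: B_def intro: add_nonneg_pos)
  define \<kappa> where "\<kappa> = C2 * sqrt B"
  have \<kappa>: "0 \<le> \<kappa>" using C B by (simp add: \<kappa>_def)
  define \<phi> where "\<phi> t = \<sigma> / 2 * exp (- \<kappa> * t)" for t
  have \<phi>0: "0 \<le> \<phi> t" for t using \<sigma> by (simp add: \<phi>_def)
  have E: "energy n N (\<phi> t) (u t) \<le> B" if N: "0 < N" and t: "0 \<le> t" "t < T" for N t
  proof (rule bounded_by_bootstrap[where a = "2 * C1 * M", OF _ _ _ _ _ t])
    fix t assume t: "0 \<le> t" "t < T"
    obtain e where e: "0 < e" "\<And>y. dist y t < e \<Longrightarrow> y \<in> ?I"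
      using open_time_interval[of S "ereal T"] tI[OF t] unfolding open_dist by blast
    have d: "(\<phi> has_real_derivative - \<kappa> * \<phi> t) (at t)"
      unfolding \<phi>_def by (auto intro!: derivative_eq_intros)
    show "((\<lambda>t. energy n N (\<phi> t) (u t)) has_real_derivative
        2 * (- \<kappa> * \<phi> t) * dissipation n N (\<phi> t) (u t) + 2 * energy_flux n N (\<phi> t) (u t)) (at t)"
      by (rule energy_has_derivative[OF e(1) _ d]) (use ls e in \<open>simp add: dist_real_def\<close>)
    assume le: "energy n N (\<phi> t) (u t) \<le> B"
    let ?E = "energy n N (\<phi> t) (u t)" and ?D = "dissipation n N (\<phi> t) (u t)"
    have "energy_flux n N (\<phi> t) (u t) \<le> C1 * H_norm n (u t) * ?E + C2 * \<phi> t * sqrt ?E * ?D"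
      by (rule flux[OF uA[OF tI[OF t]] N \<phi>0])
    also have "\<dots> \<le> C1 * M * ?E + C2 * \<phi> t * sqrt B * ?D"
      using C \<phi>0 le bound[OF t] energy_nonneg dissipation_nonneg[OF N]
      by (intro add_mono mult_right_mono mult_left_mono) auto
    finally show "2 * (- \<kappa> * \<phi> t) * ?D + 2 * energy_flux n N (\<phi> t) (u t) \<le> 2 * C1 * M * ?E"
      by (simp add: \<kappa>_def algebra_simps)
  next
    have "energy n N (\<phi> 0) (u 0) \<le> E0"
      using energy_le_decay[OF u0A \<sigma>(2,1), of n N] by (simp add: \<phi>_def E0_def)
    then have "energy n N (\<phi> 0) (u 0) * exp (2 * C1 * M * T) \<le> E0 * exp (2 * C1 * M * T)"
      by (rule mult_right_mono) simp
    then show "energy n N (\<phi> 0) (u 0) * exp (2 * C1 * M * T) < B"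
      unfolding B_def by linarith
    show "0 \<le> 2 * C1 * M" using C M by simp
  qed (rule energy_nonneg)
  define \<rho> where "\<rho> = \<sigma> / 2 * exp (- \<kappa> * T)"
  have \<rho>: "0 < \<rho>" using \<sigma> by (simp add: \<rho>_def)
  have decay: "exp_decay \<rho> (sqrt B) (u t)" if t: "0 \<le> t" "t < T" for t
    unfolding exp_decay_def
  proof
    fix k
    \<comment> \<open>The energy bound is uniform in N, so for each wave vector N may be taken
      beyond its length, which removes the truncation.\<close>
    define N where "N = max 1 (euclid_norm k)"
    have N: "0 < N" "euclid_norm k \<le> N" by (auto simp: N_def)
    have "norm (u t k) \<le> sqrt (energy n N (\<phi> t) (u t)) * exp (- \<phi> t * euclid_norm k)"
      using n by (intro coeff_le_energy uA tI t N) auto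
    also have "\<dots> \<le> sqrt B * exp (- \<rho> * euclid_norm k)"
    proof (intro mult_mono real_sqrt_le_mono E N t)
      have "\<rho> \<le> \<phi> t" unfolding \<rho>_def \<phi>_def using \<sigma> \<kappa> t by (intro mult_left_mono) (auto intro: mult_left_mono)
      then show "exp (- \<phi> t * euclid_norm k) \<le> exp (- \<rho> * euclid_norm k)" by (simp add: mult_right_mono)
    qed (use B in auto)
    finally show "norm (u t k) \<le> sqrt B * exp (- \<rho> * euclid_norm k)" .
  qed
  \<comment> \<open>Decay of single coefficients at width \<rho> is summed at width \<rho> / 2; the
    1 makes \<open>c\<close> positive.\<close>
  define c where "c = sqrt B * (\<Sum>\<^sub>\<infinity>k. exp (- (\<rho> - \<rho> / 2) * euclid_norm k)) + 1"
  have "0 < c" unfolding c_def using B by (intro add_nonneg_pos mult_nonneg_nonneg infsum_nonneg) auto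
  moreover have "u t \<in> espace (\<rho> / 2) \<and> enorm (\<rho> / 2) (u t) \<le> c" if "0 \<le> t" "t < T" for t
    using exp_decay_espace[OF decay[OF that], of "\<rho> / 2"] \<rho> by (simp add: c_def)
  ultimately show thesis using that[of "\<rho> / 2" c] \<rho> by auto
qed

subsection \<open>Convergence radii\<close>

lemma radius_nonneg: "0 \<le> radius a"
  unfolding radius_def by (rule Liminf_bounded) (auto intro!: always_eventually)

text \<open>Together with the converse \<open>le_radius\<close> this trades the root formula for
  geometric bounds. Finitely many indices, among them j = 0 with its degenerate exponent, go into
  the constant.\<close>

lemma bound_of_less_radius:
  assumes a: "\<And>j. 0 \<le> a j" and x: "0 < x" "ereal x < radius a"
  obtains C where "0 \<le> C" "\<And>j. a j \<le> C * (1 / x) ^ j"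
proof -
  obtain J where J: "\<And>j. J \<le> j \<Longrightarrow> ereal x < (if a j = 0 then \<infinity> else ereal (a j powr (- 1 / real j)))"
    using less_LiminfD[OF x(2)[unfolded radius_def]] by (auto simp: eventually_sequentially)
  define C where "C = 1 + (\<Sum>j\<le>J. a j * x ^ j)"
  have C1: "1 \<le> C" unfolding C_def using a x by (auto intro!: sum_nonneg)
  have "a j \<le> C * (1 / x) ^ j" for j
  proof (cases "j \<le> J")
    case True
    have "a j * x ^ j \<le> (\<Sum>j\<le>J. a j * x ^ j)"
      using a x True by (intro member_le_sum) auto
    then have "a j * x ^ j \<le> C" by (simp add: C_def)
    then show ?thesis using x by (simp add: power_divide field_simps)
  next
    case False
    then have j: "0 < real j" "J \<le> j" by auto
    show ?thesis
    proof (cases "a j = 0")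
      case nz: False
      then have aj: "0 < a j" using a[of j] by simp
      have "x < a j powr (- 1 / real j)" using J[OF j(2)] nz by simp
      then have "(a j powr (- 1 / real j)) powr (- real j) < x powr (- real j)"
        using x j by (intro powr_less_mono2_neg) auto
      then have "a j < x powr (- real j)" using aj j by (simp add: powr_powr)
      also have "\<dots> = 1 * (1 / x) ^ j" using x by (simp add: powr_minus powr_realpow power_divide inverse_eq_divide)
      also have "\<dots> \<le> C * (1 / x) ^ j" using x C1 by (intro mult_right_mono) auto
      finally show ?thesis by simp
    qed (use C1 x in simp)
  qed
  then show thesis using that[of C] C1 by simp
qed

text \<open>A strictly smaller y makes C (y / x)^j < 1 eventually, which absorbs the constant before
  roots are taken.\<close>

lemma le_radius:
  assumes a: "\<And>j. 0 \<le> a j" and x: "0 < y" "y < x" and le: "\<And>j. a j \<le> C * (1 / x) ^ j"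
  shows "ereal y \<le> radius a"
  unfolding radius_def
proof (rule Liminf_bounded)
  have "(\<lambda>j. C * (y / x) ^ j) \<longlonglongrightarrow> C * 0"
    using x by (intro tendsto_mult_left LIMSEQ_power_zero) auto
  then have "(\<lambda>j. C * (y / x) ^ j) \<longlonglongrightarrow> 0" by simp
  then have ev: "\<forall>\<^sub>F j in sequentially. C * (y / x) ^ j < 1"
    by (rule order_tendstoD(2)) simp
  show "\<forall>\<^sub>F j in sequentially. ereal y \<le> (if a j = 0 then \<infinity> else ereal (a j powr (- 1 / real j)))"
    using ev eventually_gt_at_top[of 0]
  proof eventually_elim
    case (elim j)
    show ?case
    proof (cases "a j = 0")
      case False
      then have aj: "0 < a j" using a[of j] by simp
      have "a j \<le> (C * (y / x) ^ j) * (1 / y) ^ j"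
        using le[of j] x by (simp add: power_divide)
      also have "\<dots> \<le> 1 * (1 / y) ^ j" using elim x by (intro mult_right_mono) auto
      also have "\<dots> = y powr (- real j)" using x by (simp add: powr_minus powr_realpow power_divide inverse_eq_divide)
      finally have "(y powr (- real j)) powr (- 1 / real j) \<le> a j powr (- 1 / real j)"
        using aj elim by (intro powr_mono2') auto
      then show ?thesis using x elim False by (simp add: powr_powr)
    qed simp
  qed
qed

lemma abs_H_inner_le_H_norm:
  assumes v: "v \<in> wspace n" and w: "w \<in> wspace n"
  shows "\<bar>H_inner n v w\<bar> \<le> H_norm n v * H_norm n w"
proof -
  let ?b = "\<lambda>v k. euclid_norm k powr n * norm (v k :: complex^3)"
  have sq: "(?b v k)\<^sup>2 = euclid_norm k powr (2 * n) * (norm (v k))\<^sup>2" for v k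
    by (simp add: powr_double power2_eq_square)
  note s = wspace_summable_sq[OF v, folded sq] wspace_summable_sq[OF w, folded sq]
  note CS = Cauchy_Schwarz_infsum[OF s(1) _ s(2)]
  have le: "norm (complex_of_real (euclid_norm k powr (2 * n)) * cdot (vcnj (v k)) (w k)) \<le> ?b v k * ?b w k" for k
  proof -
    have "norm (complex_of_real (euclid_norm k powr (2 * n)) * cdot (vcnj (v k)) (w k))
        \<le> euclid_norm k powr (2 * n) * (norm (v k) * norm (w k))"
      unfolding norm_mult using norm_cdot_le[of "vcnj (v k)" "w k"] by (intro mult_mono) auto
    also have "\<dots> = ?b v k * ?b w k" by (simp add: powr_double)
    finally show ?thesis .
  qed
  have "\<bar>H_inner n v w\<bar> \<le> (\<Sum>\<^sub>\<infinity>k. norm (complex_of_real (euclid_norm k powr (2 * n)) * cdot (vcnj (v k)) (w k)))"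
    unfolding H_inner_def
    by (rule order_trans[OF abs_Re_le_cmod norm_infsum_bound]) (rule H_term_summable[OF v w])
  also have "\<dots> \<le> (\<Sum>\<^sub>\<infinity>k. ?b v k * ?b w k)"
    using CS(1) by (intro infsum_mono H_term_summable[OF v w] le) auto
  also have "\<dots> \<le> H_norm n v * H_norm n w"
    using CS(2) by (simp add: H_norm_def H_inner_self sq)
  finally show ?thesis .
qed

text \<open>The coefficient of order j is a sum of j + 1 products, each at most C^2 x^(-j) by
  Cauchy-Schwarz. Hence three radii z < y < x: passing from x to y absorbs the factor j + 1, from y
  to z the constant in \<open>le_radius\<close>.\<close>

lemma tau_le_theta:
  assumes u: "u0 \<in> A_space"
  shows "tau n u0 \<le> theta n u0"
proof (rule ccontr)
  assume "\<not> tau n u0 \<le> theta n u0"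
  then obtain x where x: "theta n u0 < ereal x" "ereal x < tau n u0"
    using ereal_dense2 by (meson not_le)
  then obtain y where y: "theta n u0 < ereal y" "ereal y < ereal x" using ereal_dense2 by blast
  then obtain z where z: "theta n u0 < ereal z" "ereal z < ereal y" using ereal_dense2 by blast
  have "0 < ereal z"
    by (rule le_less_trans[OF radius_nonneg]) (use z(1) in \<open>simp add: theta_def\<close>)
  then have pos: "0 < z" "z < y" "y < x" using y z by auto
  let ?h = "\<lambda>j. H_norm n (euler_coeff u0 j)"
  have h0: "0 \<le> ?h j" for j by (simp add: H_norm_def H_inner_self_nonneg)
  obtain C where C: "0 \<le> C" "\<And>j. ?h j \<le> C * (1 / x) ^ j"
    using bound_of_less_radius[of ?h x] h0 x pos unfolding tau_def by (metis less_trans)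
  have nu: "\<bar>euler_nu n u0 j\<bar> \<le> C\<^sup>2 * (real (Suc j) * (1 / x) ^ j)" for j
  proof -
    have "\<bar>euler_nu n u0 j\<bar> \<le> (\<Sum>l\<le>j. \<bar>H_inner n (euler_coeff u0 l) (euler_coeff u0 (j - l))\<bar>)"
      unfolding euler_nu_def by (rule sum_abs)
    also have "\<dots> \<le> (\<Sum>l\<le>j. C\<^sup>2 * (1 / x) ^ j)"
    proof (rule sum_mono)
      fix l assume l: "l \<in> {..j}"
      have "\<bar>H_inner n (euler_coeff u0 l) (euler_coeff u0 (j - l))\<bar> \<le> ?h l * ?h (j - l)"
        by (intro abs_H_inner_le_H_norm A_space_wspace euler_coeff_A_space u)
      also have "\<dots> \<le> (C * (1 / x) ^ l) * (C * (1 / x) ^ (j - l))"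
        using C pos by (intro mult_mono h0) auto
      also have "\<dots> = C\<^sup>2 * ((1 / x) ^ l * (1 / x) ^ (j - l))" by (simp add: power2_eq_square)
      also have "(1 / x) ^ l * (1 / x) ^ (j - l) = (1 / x) ^ j"
        using l by (simp flip: power_add)
      finally show "\<bar>H_inner n (euler_coeff u0 l) (euler_coeff u0 (j - l))\<bar> \<le> C\<^sup>2 * (1 / x) ^ j" .
    qed
    finally show ?thesis by (simp add: mult_ac)
  qed
  have q: "norm (y / x) < 1" using pos by simp
  have "Bseq (\<lambda>j. real (Suc j) * (y / x) ^ j)"
  proof -
    have "(\<lambda>j. real j * (y / x) ^ j + (y / x) ^ j) \<longlonglongrightarrow> 0 + 0"
      using q by (intro tendsto_add powser_times_n_limit_0 LIMSEQ_power_zero)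
    then show ?thesis by (intro convergent_imp_Bseq convergentI[of _ 0]) (simp add: algebra_simps)
  qed
  then obtain K where K: "\<And>j. real (Suc j) * (y / x) ^ j \<le> K"
    unfolding Bseq_def using pos by (metis abs_le_iff real_norm_def)
  have "\<bar>euler_nu n u0 j\<bar> \<le> (C\<^sup>2 * K) * (1 / y) ^ j" for j
  proof -
    have "real (Suc j) * (1 / x) ^ j = (real (Suc j) * (y / x) ^ j) * (1 / y) ^ j"
      using pos by (simp add: power_divide)
    also have "\<dots> \<le> K * (1 / y) ^ j" using pos by (intro mult_right_mono K) auto
    finally have "C\<^sup>2 * (real (Suc j) * (1 / x) ^ j) \<le> C\<^sup>2 * (K * (1 / y) ^ j)"
      by (intro mult_left_mono) auto
    with nu[of j] show ?thesis by (simp add: mult.assoc)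
  qed
  from le_radius[OF _ pos(1,2) this] have "ereal z \<le> theta n u0" by (simp add: theta_def)
  with z show False by simp
qed

subsection \<open>Time reversal\<close>

lemma limitin_A_minus:
  assumes "limitin A_topology f l F"
  shows "limitin A_topology (\<lambda>x k. - f x k) (\<lambda>k. - l k) F"
proof (rule limitin_A_seminormI)
  have neg: "(\<lambda>k. - v k) \<in> A_space" if "v \<in> A_space" for v
    using A_space_scaleR[OF that, of "-1"] by simp
  show "(\<lambda>k. - l k) \<in> A_space" by (rule neg[OF limitin_A_space(1)[OF assms]])
  show ev: "\<forall>\<^sub>F x in F. (\<lambda>k. - f x k) \<in> A_space"
    using limitin_A_space(2)[OF assms] by eventually_elim (rule neg)
  fix p assume p: "A_seminorm p"
  have "\<forall>\<^sub>F x in F. p (\<lambda>k. f x k - l k) = p (\<lambda>k. - f x k - - l k)"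
    using limitin_A_space(2)[OF assms]
  proof eventually_elim
    case (elim x)
    then have "(\<lambda>k. f x k - l k) \<in> A_space" using limitin_A_space(1)[OF assms] by (rule A_space_diff)
    from A_seminorm_scaleR[OF p this, of "-1"] show ?case by simp
  qed
  then show "((\<lambda>x. p (\<lambda>k. - f x k - - l k)) \<longlongrightarrow> 0) F"
    using limitin_A_seminorm[OF assms p] by (rule Lim_transform_eventually[rotated])
qed

text \<open>Reversing t flips the sign of du/dt; negating u flips it back and leaves the quadratic
  nonlinearity unchanged.\<close>

lemma local_solution_reverse:
  assumes "local_solution u (- t)"
  shows "local_solution (\<lambda>t k. - u (- t) k) t"
proof -
  obtain \<delta> a where A: "A_series u (- t) \<delta> a" and d: "euler_derivative u (- t)"
    using assms by (auto simp: local_solution_def)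
  have "A_series (\<lambda>t k. - u (- t) k) t \<delta> (\<lambda>j k. (- ((-1) ^ j)) *\<^sub>R a j k)"
    unfolding A_series_def
  proof (intro conjI allI impI A_series_pos[OF A] A_space_scaleR A_series_coeff[OF A])
    fix s :: real assume s: "\<bar>s\<bar> < \<delta>"
    have "limitin A_topology (\<lambda>N k. \<Sum>j<N. (- s) ^ j *\<^sub>R a j k) (u (- t + - s)) sequentially"
      by (rule A_series_limit[OF A]) (use s in simp)
    from limitin_A_minus[OF this]
    show "limitin A_topology (\<lambda>N k. \<Sum>j<N. s ^ j *\<^sub>R (- ((- 1) ^ j)) *\<^sub>R a j k) (\<lambda>k. - u (- (t + s)) k) sequentially"
      by (simp add: power_minus[of s] sum_negf mult.commute)
  qed
  moreover have "euler_derivative (\<lambda>t k. - u (- t) k) t"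
  proof -
    have P: "euler_P (\<lambda>k. - u (- t) k) (\<lambda>k. - u (- t) k) = euler_P (u (- t)) (u (- t))"
      using euler_P_scaleR[of "-1" "u (- t)" "-1" "u (- t)"] by (simp add: fun_eq_iff)
    have "limitin A_topology (\<lambda>h k. (1 / - h) *\<^sub>R (u (- t + - h) k - u (- t) k)) (euler_P (u (- t)) (u (- t))) (at 0)"
      unfolding limitin_def
    proof (intro conjI allI impI)
      show "euler_P (u (- t)) (u (- t)) \<in> topspace A_topology"
        using d by (simp add: euler_derivative_def limitin_def)
      fix U assume "openin A_topology U \<and> euler_P (u (- t)) (u (- t)) \<in> U"
      then have "\<forall>\<^sub>F h in at 0. (\<lambda>k. (1 / h) *\<^sub>R (u (- t + h) k - u (- t) k)) \<in> U"
        using d by (simp add: euler_derivative_def limitin_def)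
      then have "\<forall>\<^sub>F h in filtermap uminus (at 0). (\<lambda>k. (1 / h) *\<^sub>R (u (- t + h) k - u (- t) k)) \<in> U"
        by (simp add: filtermap_at_minus)
      then show "\<forall>\<^sub>F h in at 0. (\<lambda>k. (1 / - h) *\<^sub>R (u (- t + - h) k - u (- t) k)) \<in> U"
        by (simp only: eventually_filtermap)
    qed
    then show ?thesis unfolding euler_derivative_def P by (simp add: algebra_simps)
  qed
  ultimately show ?thesis by (auto simp: local_solution_def)
qed

lemma mem_time_interval: "t \<in> time_interval S T \<longleftrightarrow> ereal (- t) < S \<and> ereal t < T"
  by (cases S) (auto simp: time_interval_def)

lemma minus_in_time_interval: "- t \<in> time_interval S T \<longleftrightarrow> t \<in> time_interval T S"
  by (auto simp: mem_time_interval)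

lemma A_solution_reverse:
  assumes "A_solution u0 S T u"
  shows "A_solution (\<lambda>k. - u0 k) T S (\<lambda>t k. - u (- t) k)"
proof -
  have *: "0 < S \<and> 0 < T \<and> (\<forall>t\<in>time_interval S T. local_solution u t) \<and> u 0 = u0"
    using assms by (simp add: A_solution_iff)
  show ?thesis
    unfolding A_solution_iff using * by (auto intro!: local_solution_reverse simp: minus_in_time_interval)
qed

subsection \<open>Blow-up criterion\<close>

lemma no_blowup:
  assumes n: "5 / 2 < n" and sol: "A_solution u0 S T u"
    and bound: "\<And>t. 0 \<le> t \<Longrightarrow> ereal t < T \<Longrightarrow> H_norm n (u t) \<le> M" and T: "T < \<infinity>"
  shows "\<exists>T' u'. T < T' \<and> A_solution u0 S T' u' \<and> (\<forall>t\<in>time_interval S T. u' t = u t)"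
proof -
  have "0 < T" using sol by (simp add: A_solution_def)
  then obtain r where r: "T = ereal r" using T by (cases T) auto
  obtain \<rho> c where b: "0 < \<rho>" "0 < c" "\<And>t. 0 \<le> t \<Longrightarrow> t < r \<Longrightarrow> u t \<in> espace \<rho> \<and> enorm \<rho> (u t) \<le> c"
    using uniform_analyticity[OF n sol[unfolded r] bound] by (metis r less_ereal.simps(1))
  show ?thesis unfolding r by (rule A_solution_extend[OF sol[unfolded r] b(3,2,1)])
qed

theorem mainTheorem1:
  fixes n :: real and u0 :: field3 and S T :: ereal and u :: "real \<Rightarrow> field3"
  assumes "5 / 2 < n"
    and "u0 \<in> A_space"
    and "maximal_A_solution u0 S T u"
  shows "tau n u0 \<le> theta n u0 \<and> theta n u0 \<le> min S T \<and>
    (\<forall>t. - theta n u0 < ereal t \<and> ereal t < theta n u0 \<longrightarrow>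
      (\<lambda>j. euler_nu n u0 j * t ^ j) sums (H_norm n (u t))\<^sup>2)"
proof -
  note n = assms(1) and u0A = assms(2)
  let ?\<theta> = "theta n u0" and ?\<nu> = "euler_nu n u0"
  have sol: "A_solution u0 S T u"
    and max: "\<And>S' T' u'. A_solution u0 S' T' u' \<Longrightarrow> S \<le> S' \<Longrightarrow> T \<le> T' \<Longrightarrow>
      (\<forall>t\<in>time_interval S T. u' t = u t) \<Longrightarrow> S' = S \<and> T' = T"
    using assms(3) unfolding maximal_A_solution_def by blast+
  have ST: "0 < S" "0 < T" and ls: "\<And>t. t \<in> time_interval S T \<Longrightarrow> local_solution u t" and u0: "u 0 = u0"
    using sol unfolding A_solution_iff by auto
  define f where "f t = (\<Sum>j. ?\<nu> j * t ^ j)" for t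
  have bd: "\<exists>C. 0 \<le> C \<and> (\<forall>j. \<bar>?\<nu> j\<bar> \<le> C * (1 / x) ^ j)" if "0 < x" "ereal x < ?\<theta>" for x
    using bound_of_less_radius[of "\<lambda>j. \<bar>?\<nu> j\<bar>" x] that unfolding theta_def by (metis abs_ge_zero)
  have abs_s: "summable (\<lambda>j. \<bar>?\<nu> j\<bar> * x ^ j)" if x: "0 \<le> x" "ereal x < ?\<theta>" for x
  proof -
    obtain y where y: "ereal x < ereal y" "ereal y < ?\<theta>" using ereal_dense2[OF x(2)] by blast
    then obtain C where C: "\<And>j. \<bar>?\<nu> j\<bar> \<le> C * (1 / y) ^ j" using bd[of y] x by auto
    show ?thesis
    proof (rule summable_comparison_test')
      show "summable (\<lambda>j. C * (x / y) ^ j)"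
        using x y by (intro summable_mult summable_geometric) auto
      show "norm (\<bar>?\<nu> j\<bar> * x ^ j) \<le> C * (x / y) ^ j" for j
        using mult_right_mono[OF C[of j], of "x ^ j"] x by (simp add: power_divide mult_ac abs_mult)
    qed
  qed
  have in_\<theta>: "ereal \<bar>t\<bar> < ?\<theta> \<longleftrightarrow> t \<in> time_interval ?\<theta> ?\<theta>" for t
    by (cases ?\<theta>) (auto simp: time_interval_def abs_less_iff)
  have f_sums: "(\<lambda>j. ?\<nu> j * t ^ j) sums f t" and f_le: "\<And>r. \<bar>t\<bar> \<le> r \<Longrightarrow> ereal r < ?\<theta> \<Longrightarrow> f t \<le> (\<Sum>j. \<bar>?\<nu> j\<bar> * r ^ j)"
    if t: "t \<in> time_interval ?\<theta> ?\<theta>" for t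
  proof -
    have s: "summable (\<lambda>j. norm (?\<nu> j * t ^ j))"
      using abs_s[of "\<bar>t\<bar>"] t by (simp add: in_\<theta> abs_mult power_abs)
    then show fs: "(\<lambda>j. ?\<nu> j * t ^ j) sums f t"
      unfolding f_def by (intro summable_sums) (rule summable_norm_cancel)
    show "f t \<le> (\<Sum>j. \<bar>?\<nu> j\<bar> * r ^ j)" if r: "\<bar>t\<bar> \<le> r" "ereal r < ?\<theta>" for r
    proof (rule sums_le[OF _ fs summable_sums[OF abs_s]])
      fix j
      have "?\<nu> j * t ^ j \<le> \<bar>?\<nu> j\<bar> * \<bar>t\<bar> ^ j" by (metis abs_ge_self abs_mult power_abs)
      also have "\<dots> \<le> \<bar>?\<nu> j\<bar> * r ^ j" using r by (intro mult_left_mono power_mono) auto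
      finally show "?\<nu> j * t ^ j \<le> \<bar>?\<nu> j\<bar> * r ^ j" .
    qed (use r in auto)
  qed
  \<comment> \<open>The identity theorem needs analyticity of \<open>f\<close> at every point of its
    interval, not only at 0; re-expansion about t provides it.\<close>
  have f_analytic: "analytic_at (\<lambda>t. of_real (f t)) t" if t: "t \<in> time_interval ?\<theta> ?\<theta>" for t
  proof -
    obtain x where x: "ereal \<bar>t\<bar> < ereal x" "ereal x < ?\<theta>" using ereal_dense2 t in_\<theta> by blast
    moreover have "0 < x" using x(1) by (simp add: abs_less_iff)
    ultimately obtain C where C: "\<And>j. norm (?\<nu> j) \<le> C * (1 / x) ^ j" using bd[of x] by auto
    define \<epsilon> where "\<epsilon> = (x - \<bar>t\<bar>) / 2"
    define b where "b i = (\<Sum>j. (real ((i + j) choose i) * t ^ j) *\<^sub>R ?\<nu> (i + j))" for i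
    have "\<bar>t\<bar> < x" using x by simp
    note re = powser_reexpand(3)[OF C this \<epsilon>_def b_def]
    have "(\<lambda>j. of_real (b j) * of_real s ^ j) sums (complex_of_real (f (t + s)))" if "\<bar>s\<bar> < \<epsilon>" for s
    proof -
      have "(\<lambda>j. b j * s ^ j) sums f (t + s)" using re[OF that] by (simp add: f_def mult.commute)
      from sums_of_real[OF this] show ?thesis by simp
    qed
    moreover have "0 < \<epsilon>" using x by (simp add: \<epsilon>_def)
    ultimately show ?thesis unfolding analytic_at_def by (intro exI[of _ \<epsilon>] conjI exI[of _ "\<lambda>j. of_real (b j)"]) auto
  qed
  have u_analytic: "analytic_at (\<lambda>t. of_real (H_inner n (u t) (u t))) t" if t: "t \<in> time_interval S T" for t
  proof -
    obtain \<delta> a where A: "A_series u t \<delta> a" using ls[OF t] by (auto simp: local_solution_def)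
    define c where "c j = (\<Sum>l\<le>j. H_inner n (a l) (a (j - l)))" for j
    have "(\<lambda>j. of_real (c j) * of_real s ^ j) sums (complex_of_real (H_inner n (u (t + s)) (u (t + s))))"
      if "\<bar>s\<bar> < \<delta>" for s
    proof -
      have "(\<lambda>j. c j * s ^ j) sums H_inner n (u (t + s)) (u (t + s))"
        using A_series_H_inner[OF A that, of n] by (simp add: c_def mult.commute)
      from sums_of_real[OF this] show ?thesis by simp
    qed
    then show ?thesis
      unfolding analytic_at_def
      using A_series_pos[OF A] by (intro exI[of _ \<delta>] conjI exI[of _ "\<lambda>j. of_real (c j)"]) auto
  qed
  have eq: "H_inner n (u t) (u t) = f t"
    if t: "t \<in> time_interval S T" "t \<in> time_interval ?\<theta> ?\<theta>" for t
  proof -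
    have "0 < ?\<theta>" using t(2) unfolding in_\<theta>[symmetric]
      by (metis abs_ge_zero ereal_less_eq(5) le_less_trans)
    \<comment> \<open>The common interval of the two functions. It is connected and contains 0, near
      which both are the sum of the series with coefficients \<open>?\<nu> j\<close>.\<close>
    let ?I = "time_interval (min S ?\<theta>) (min T ?\<theta>)"
    have I: "x \<in> ?I \<longleftrightarrow> x \<in> time_interval S T \<and> x \<in> time_interval ?\<theta> ?\<theta>" for x
      by (auto simp: mem_time_interval)
    have z: "0 \<in> ?I"
      using ST \<open>0 < ?\<theta>\<close> by (simp add: mem_time_interval flip: zero_ereal_def)
    obtain e where e: "0 < e" "\<And>y. dist y 0 < e \<Longrightarrow> y \<in> ?I"
      using open_time_interval z unfolding open_dist by blast
    have "\<And>s. \<bar>s\<bar> < e \<Longrightarrow> local_solution u (0 + s)" using e(2) I ls by simp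
    from local_solution_Taylor[OF e(1) this] obtain \<delta> where A: "A_series u 0 \<delta> (euler_coeff u0)"
      unfolding u0 by blast
    have "complex_of_real (H_inner n (u t) (u t)) = of_real (f t)"
    proof (rule identity_theorem_real[where I = ?I and ?t1.0 = 0 and \<epsilon> = "min e \<delta>"
          and f = "\<lambda>t. of_real (H_inner n (u t) (u t))" and g = "\<lambda>t. of_real (f t)"])
      show "of_real (H_inner n (u (0 + s)) (u (0 + s))) = complex_of_real (f (0 + s))"
        if s: "\<bar>s\<bar> < min e \<delta>" for s
      proof -
        have "(\<lambda>j. ?\<nu> j * s ^ j) sums H_inner n (u (0 + s)) (u (0 + s))"
          using A_series_H_inner[OF A, of s n] s by (simp add: euler_nu_def mult.commute)
        moreover have "s \<in> time_interval ?\<theta> ?\<theta>" using e(2)[of s] s I by simp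
        ultimately show ?thesis using f_sums sums_unique2 by fastforce
      qed
      show "0 < min e \<delta>" using e(1) A_series_pos[OF A] by simp
      show "t \<in> ?I" using t I by simp
    qed (use z I u_analytic f_analytic open_time_interval connected_time_interval in auto)
    then show ?thesis by simp
  qed
  \<comment> \<open>The series of absolute values at a radius r < \<theta> bounds the norm for all
    |t| \<le> r at once. It is applied with r a finite end point of the interval of existence,
    assumed to lie below \<theta>.\<close>
  have H_le: "H_norm n (u t) \<le> sqrt (\<Sum>j. \<bar>?\<nu> j\<bar> * r ^ j)"
    if "t \<in> time_interval S T" "\<bar>t\<bar> \<le> r" "ereal r < ?\<theta>" for t r
  proof -
    have "ereal \<bar>t\<bar> < ?\<theta>" using that by (metis ereal_less_eq(3) le_less_trans)
    then have "t \<in> time_interval ?\<theta> ?\<theta>" by (simp add: in_\<theta>)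
    then show ?thesis using that f_le by (simp add: H_norm_def eq)
  qed
  have T: "?\<theta> \<le> T"
  proof (rule ccontr)
    assume "\<not> ?\<theta> \<le> T"
    then obtain r where r: "T = ereal r" "ereal r < ?\<theta>" using ST by (cases T) auto
    have "H_norm n (u t) \<le> sqrt (\<Sum>j. \<bar>?\<nu> j\<bar> * r ^ j)" if "0 \<le> t" "ereal t < T" for t
    proof (rule H_le)
      show "t \<in> time_interval S T"
        using that ST le_less_trans[of "ereal (- t)" 0 S] by (simp add: mem_time_interval)
    qed (use that r in auto)
    from no_blowup[OF n sol this] obtain T' u' where "T < T'" "A_solution u0 S T' u'"
      "\<forall>t\<in>time_interval S T. u' t = u t" using r by auto
    then show False using max[of S T' u'] by (auto simp: less_le)
  qed
  have S: "?\<theta> \<le> S"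
  proof (rule ccontr)
    assume "\<not> ?\<theta> \<le> S"
    then obtain r where r: "S = ereal r" "ereal r < ?\<theta>" using ST by (cases S) auto
    \<comment> \<open>The reversed solution has S and T exchanged, so the continuation argument now
      acts at S; the extended solution is reversed back to contradict maximality of u.\<close>
    let ?v = "\<lambda>t k. - u (- t) k"
    have "H_norm n (?v t) \<le> sqrt (\<Sum>j. \<bar>?\<nu> j\<bar> * r ^ j)" if "0 \<le> t" "ereal t < S" for t
    proof -
      have "t \<in> time_interval T S"
        using that ST le_less_trans[of "ereal (- t)" 0 T] by (simp add: mem_time_interval)
      then have "- t \<in> time_interval S T" by (simp add: minus_in_time_interval)
      then have "H_norm n (u (- t)) \<le> sqrt (\<Sum>j. \<bar>?\<nu> j\<bar> * r ^ j)"
        by (rule H_le) (use that r in auto)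
      then show ?thesis
        using H_inner_scaleR[of n "-1" "u (- t)" "-1" "u (- t)"] by (simp add: H_norm_def)
    qed
    from no_blowup[OF n A_solution_reverse[OF sol] this] obtain S' v where v: "S < S'"
      "A_solution (\<lambda>k. - u0 k) T S' v" "\<forall>t\<in>time_interval T S. v t = ?v t" using r by auto
    have "A_solution u0 S' T (\<lambda>t k. - v (- t) k)" using A_solution_reverse[OF v(2)] by simp
    moreover have "(\<lambda>k. - v (- t) k) = u t" if "t \<in> time_interval S T" for t
    proof -
      have "- t \<in> time_interval T S" using that by (simp add: minus_in_time_interval)
      then show ?thesis using v(3) by simp
    qed
    ultimately show False using max[of S' T "\<lambda>t k. - v (- t) k"] v(1) by (auto simp: less_le)
  qed
  \<comment> \<open>As \<theta> \<le> min S T, the identity known on the common interval holds on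
    the whole interval of convergence.\<close>
  have "(\<lambda>j. ?\<nu> j * t ^ j) sums (H_norm n (u t))\<^sup>2" if "- ?\<theta> < ereal t \<and> ereal t < ?\<theta>" for t
  proof -
    have t\<theta>: "t \<in> time_interval ?\<theta> ?\<theta>" using that by (simp add: time_interval_def)
    have "t \<in> time_interval S T"
      using t\<theta> S T by (auto simp: mem_time_interval)
    then show ?thesis using f_sums[OF t\<theta>] eq[OF _ t\<theta>] by (simp add: H_norm_power2)
  qed
  then show ?thesis using tau_le_theta[OF u0A] S T by simp
qed

end
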